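(* Let $0<\tau<\infty$ and let $l:[0,\tau]\to(a,b)$ be continuously differentiable with $\dot l\in\mathcal C([0,\tau],\mathbb R)$. Assume: (1) $\mathcal Q^\pm\in\mathcal C^1([a,b],\mathbb R^{2\times2})$ are diagonal, $\mathcal Q^\pm(z)=\begin{bmatrix}Q_{11}^\pm(z)&0\\0&Q_{22}^\pm(z)\end{bmatrix}$, and satisfy $\frac{Q_{11}^+}{Q_{11}^-}(0)=1$ and $\frac{Q_{11}^+}{Q_{11}^-}(z)=\frac{Q_{22}^+}{Q_{22}^-}(z)$ for all $z\in[a,b]$; (2) $r=0$, $W_B\in\mathbb R^{2\times 4}$, $\operatorname{rank}(W_B)=2$ and $W_B\Sigma W_B^\top\ge0$. Then the family $(A(t))_{t\in[0,\tau]}$ of port-Hamiltonian operators $A(t)=A_{\mathcal Q_{l(t)}}$ is stable on $(X,\|\cdot\|_{\mathcal Q_0})$.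
   Context: Let $a<0<b$ and $X=L^2([a,b],\mathbb R^2)$. $\mathcal Q^\pm$ are symmetric $2\times2$-matrix-valued functions on $[a,b]$ with $mI\le\mathcal Q^\pm(z)\le MI$ for constants $0<m\le M$. For $l\in(a,b)$ put $c_l=\mathbf 1_{[a,l)}$, $\overline c_l=\mathbf 1_{(l,b]}$, and $\mathcal Q_l=c_l\mathcal Q^-+\overline c_l\mathcal Q^+\in\mathcal L(X)$ (a coercive multiplication operator). $\langle x,y\rangle_{\mathcal Q_l}=\frac12\int_a^by^\top(z)\mathcal Q_l(z)x(z)\,dz$, with norm $\|\cdot\|_{\mathcal Q_l}$; $\mathcal Q_0$ is the case $l=0$. For $l\in(a,b)$ the operator $\mathcal J_l$ on $X$ has domain $D(\mathcal J_l)=\{e=(e_1,e_2)\in X: e_1|_{(a,l)}\in H^1((a,l),\mathbb R),\ e_1|_{(l,b)}\in H^1((l,b),\mathbb R),\ e_2\in H^1([a,b],\mathbb R)\}$ and acts as $\mathcal J_le=P_1\frac{d}{dz}e$ on each of $(a,l)$ and $(l,b)$, $P_1=\begin{bmatrix}0&-1\\-1&0\end{bmatrix}$. For $e\in D(\mathcal J_l)$ put $f_{\partial,e}=\frac1{\sqrt2}(P_1e(b)-P_1e(a))$, $e_{\partial,e}=\frac1{\sqrt2}(e(b)+e(a))$, $f_{I,e}=e_2(l)$, $e_{I,e}=e_1(l^-)-e_1(l^+)$. For $r\ge0$ and $W_B\in\mathbb R^{2\times4}$, the port-Hamiltonian operator $A_{\mathcal Q_l}$ is $$D(A_{\mathcal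 Q_l})=\left\{x\in X:\ \mathcal Q_lx\in D(\mathcal J_l),\ f_{I,\mathcal Q_lx}=r\,e_{I,\mathcal Q_lx},\ W_B\begin{bmatrix}f_{\partial,\mathcal Q_lx}\\ e_{\partial,\mathcal Q_lx}\end{bmatrix}=0\right\},\qquad A_{\mathcal Q_l}x=\mathcal J_l(\mathcal Q_lx).$$ $\Sigma=\begin{bmatrix}0&I\\ I&0\end{bmatrix}\in\mathbb R^{4\times4}$ with $2\times2$ identity blocks. A family $(A(t))_{t\in[0,\tau]}$ of infinitesimal generators of $C_0$-semigroups on a Hilbert space $X$ is called stable if there are constants $M\ge1$, $\omega\in\mathbb R$ such that $(\omega,\infty)\subset\rho(A(t))$ for all $t\in[0,\tau]$, and for every finite sequence $0\le t_1\le t_2\le\dots\le t_k\le\tau$, $k\in\mathbb N$, $\left\|\prod_{j=1}^kR(\lambda,A(t_j))\right\|_{\mathcal L(X)}\le\frac{M}{(\lambda-\omega)^k}$ for all $\lambda>\omega$, where $R(\lambda,A)=(\lambda I-A)^{-1}$. *)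

theory Defs
  imports "HOL-Analysis.Analysis"
begin

section \<open>The space $L^2$\<close>

text \<open>
  The type \<open>l2\<close> is $L^2(\mathbb{R},\mathbb{R}^2)$: square-integrable functions modulo equality
  almost everywhere. As a type cannot depend on $a$ and $b$, the space $L^2([a,b],\mathbb{R}^2)$ is
  the subspace \<open>X_space a b\<close> of the classes that vanish outside $[a,b]$ (extension by zero).
\<close>

definition sq_integrable :: "(real \<Rightarrow> real^2) \<Rightarrow> bool" where
  "sq_integrable f \<longleftrightarrow> f \<in> borel_measurable lborel \<and> integrable lborel (\<lambda>z. (norm (f z))\<^sup>2)"

definition l2_rel :: "(real \<Rightarrow> real^2) \<Rightarrow> (real \<Rightarrow> real^2) \<Rightarrow> bool" where
  "l2_rel f g \<longleftrightarrow> sq_integrable f \<and> sq_integrable g \<and> (AE z in lborel. f z = g z)"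

lemma sq_integrable_zero: "sq_integrable (\<lambda>z. 0)"
  by (simp add: sq_integrable_def)

lemma sq_integrable_add:
  assumes "sq_integrable f" "sq_integrable g"
  shows "sq_integrable (\<lambda>z. f z + g z)"
proof -
  have [measurable]: "f \<in> borel_measurable borel" "g \<in> borel_measurable borel"
    using assms by (auto simp: sq_integrable_def)
  have "integrable lborel (\<lambda>z. 2 * (norm (f z))\<^sup>2 + 2 * (norm (g z))\<^sup>2)"
    using assms by (auto simp: sq_integrable_def)
  then have "integrable lborel (\<lambda>z. (norm (f z + g z))\<^sup>2)"
  proof (rule Bochner_Integration.integrable_bound)
    have "(norm (f z + g z))\<^sup>2 \<le> 2 * (norm (f z))\<^sup>2 + 2 * (norm (g z))\<^sup>2" for z
    proof -
      have "(norm (f z + g z))\<^sup>2 \<le> (norm (f z) + norm (g z))\<^sup>2"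
        by (intro power_mono norm_triangle_ineq) auto
      also have "\<dots> \<le> 2 * (norm (f z))\<^sup>2 + 2 * (norm (g z))\<^sup>2"
        using sum_squares_bound[of "norm (f z)" "norm (g z)"] by (simp add: power2_sum)
      finally show ?thesis .
    qed
    then show "AE z in lborel. norm ((norm (f z + g z))\<^sup>2)
        \<le> norm (2 * (norm (f z))\<^sup>2 + 2 * (norm (g z))\<^sup>2)"
      by auto
  qed measurable
  then show ?thesis
    by (simp add: sq_integrable_def)
qed

lemma sq_integrable_scaleR: "sq_integrable f \<Longrightarrow> sq_integrable (\<lambda>z. c *\<^sub>R f z)"
  by (auto simp: sq_integrable_def power_mult_distrib)

quotient_type l2 = "real \<Rightarrow> real^2" / partial: l2_rel
proof (rule part_equivpI)
  show "\<exists>f. l2_rel f f"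
    using sq_integrable_zero by (auto simp: l2_rel_def)
  show "symp l2_rel"
    by (auto simp: symp_def l2_rel_def)
  show "transp l2_rel"
    by (auto simp: transp_def l2_rel_def elim: eventually_elim2)
qed

instantiation l2 :: real_vector
begin

lift_definition zero_l2 :: l2 is "\<lambda>z. 0"
  by (simp add: l2_rel_def sq_integrable_zero)

lift_definition plus_l2 :: "l2 \<Rightarrow> l2 \<Rightarrow> l2" is "\<lambda>f g z. f z + g z"
  by (auto simp: l2_rel_def sq_integrable_add elim: eventually_elim2)

lift_definition scaleR_l2 :: "real \<Rightarrow> l2 \<Rightarrow> l2" is "\<lambda>c f z. c *\<^sub>R f z"
  by (auto simp: l2_rel_def sq_integrable_scaleR)

definition uminus_l2 :: "l2 \<Rightarrow> l2" where
  "uminus_l2 x = (- 1) *\<^sub>R x"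

definition minus_l2 :: "l2 \<Rightarrow> l2 \<Rightarrow> l2" where
  "minus_l2 x y = x + (- y)"

instance
proof
  fix x y z :: l2 and c d :: real
  show "x + y + z = x + (y + z)"
    by transfer (auto simp: l2_rel_def sq_integrable_add add.assoc)
  show "x + y = y + x"
    by transfer (auto simp: l2_rel_def sq_integrable_add add.commute)
  show "0 + x = x"
    by transfer (auto simp: l2_rel_def)
  show "- x + x = 0"
    unfolding uminus_l2_def
    by transfer (auto simp: l2_rel_def sq_integrable_zero)
  show "x - y = x + - y"
    by (simp add: minus_l2_def)
  show "c *\<^sub>R (x + y) = c *\<^sub>R x + c *\<^sub>R y"
    by transfer
      (auto simp: l2_rel_def sq_integrable_add sq_integrable_scaleR scaleR_add_right)
  show "(c + d) *\<^sub>R x = c *\<^sub>R x + d *\<^sub>R x"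
    by transfer
      (auto simp: l2_rel_def sq_integrable_add sq_integrable_scaleR scaleR_add_left)
  show "c *\<^sub>R d *\<^sub>R x = (c * d) *\<^sub>R x"
    by transfer (auto simp: l2_rel_def sq_integrable_scaleR)
  show "1 *\<^sub>R x = x"
    by transfer (auto simp: l2_rel_def)
qed

end

definition X_space :: "real \<Rightarrow> real \<Rightarrow> l2 set" where
  "X_space a b = {x. AE z in lborel. z \<notin> {a..b} \<longrightarrow> rep_l2 x z = 0}"

definition component :: "2 \<Rightarrow> l2 \<Rightarrow> real \<Rightarrow> real" where
  "component i x z = rep_l2 x z $ i"

text \<open>Multiplication operators; meaningful for bounded measurable \<open>Q\<close>.\<close>

definition mult_op :: "(real \<Rightarrow> real^2^2) \<Rightarrow> l2 \<Rightarrow> l2" where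
  "mult_op Q x = abs_l2 (\<lambda>z. Q z *v rep_l2 x z)"

definition Q_l :: "real \<Rightarrow> real \<Rightarrow> (real \<Rightarrow> real^2^2) \<Rightarrow> (real \<Rightarrow> real^2^2) \<Rightarrow> real \<Rightarrow> real \<Rightarrow> real^2^2"
  where "Q_l a b Qm Qp l z = indicat_real {a..<l} z *\<^sub>R Qm z + indicat_real {l<..b} z *\<^sub>R Qp z"

definition inner_Q :: "real \<Rightarrow> real \<Rightarrow> (real \<Rightarrow> real^2^2) \<Rightarrow> l2 \<Rightarrow> l2 \<Rightarrow> real" where
  "inner_Q a b Q x y = 1/2 * (LBINT z:{a..b}. rep_l2 y z \<bullet> (Q z *v rep_l2 x z))"

definition norm_Q :: "real \<Rightarrow> real \<Rightarrow> (real \<Rightarrow> real^2^2) \<Rightarrow> l2 \<Rightarrow> real" where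
  "norm_Q a b Q x = sqrt (inner_Q a b Q x x)"


section \<open>The Sobolev space $H^1$ of an interval\<close>

definition sq_integrable_on :: "real set \<Rightarrow> (real \<Rightarrow> real) \<Rightarrow> bool" where
  "sq_integrable_on S f \<longleftrightarrow>
     set_borel_measurable lborel S f \<and> set_integrable lborel S (\<lambda>z. (f z)\<^sup>2)"

text \<open>Weak derivatives are tested against $C^1_c(c,d)$, as in Brezis; testing against
  $C^\infty_c(c,d)$ gives the same derivatives.\<close>

definition test_fun :: "real \<Rightarrow> real \<Rightarrow> (real \<Rightarrow> real) \<Rightarrow> bool" where
  "test_fun c d \<phi> \<longleftrightarrow> \<phi> C1_differentiable_on UNIV \<and> closure {z. \<phi> z \<noteq> 0} \<subseteq> {c<..<d}"

definition weak_deriv :: "real \<Rightarrow> real \<Rightarrow> (real \<Rightarrow> real) \<Rightarrow> (real \<Rightarrow> real) \<Rightarrow> bool" where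
  "weak_deriv c d f g \<longleftrightarrow> sq_integrable_on {c<..<d} g \<and>
     (\<forall>\<phi>. test_fun c d \<phi> \<longrightarrow>
       (LBINT z:{c<..<d}. f z * deriv \<phi> z) = - (LBINT z:{c<..<d}. g z * \<phi> z))"

definition H1 :: "real \<Rightarrow> real \<Rightarrow> (real \<Rightarrow> real) \<Rightarrow> bool" where
  "H1 c d f \<longleftrightarrow> sq_integrable_on {c<..<d} f \<and> (\<exists>g. weak_deriv c d f g)"

text \<open>The weak derivative, determined almost everywhere on $(c,d)$.\<close>

definition wderiv :: "real \<Rightarrow> real \<Rightarrow> (real \<Rightarrow> real) \<Rightarrow> real \<Rightarrow> real" where
  "wderiv c d f = (SOME g. weak_deriv c d f g)"

text \<open>Pointwise values of an $H^1(c,d)$ function at \<open>p\<close> $\in [c,d]$: those of its representative that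
  is continuous on $[c,d]$. At an end point this is the one-sided limit.\<close>

definition pt_value :: "real \<Rightarrow> real \<Rightarrow> (real \<Rightarrow> real) \<Rightarrow> real \<Rightarrow> real" where
  "pt_value c d f p = (THE v. \<exists>F. continuous_on {c..d} F \<and>
     (AE z in lborel. z \<in> {c<..<d} \<longrightarrow> F z = f z) \<and> F p = v)"


section \<open>Port-Hamiltonian operators\<close>

text \<open>An unbounded operator is a pair of its domain and a map that is relevant on the domain only.\<close>

type_synonym 'x unbounded_op = "'x set \<times> ('x \<Rightarrow> 'x)"

definition P1 :: "real^2^2" where
  "P1 = vector [vector [0, - 1], vector [- 1, 0]]"

definition J_dom :: "real \<Rightarrow> real \<Rightarrow> real \<Rightarrow> l2 set" where
  "J_dom a b l = {e \<in> X_space a b. H1 a l (component 1 e) \<and> H1 l b (component 1 e) \<and> H1 a b (component 2 e)}"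

definition J_map :: "real \<Rightarrow> real \<Rightarrow> real \<Rightarrow> l2 \<Rightarrow> l2" where
  "J_map a b l e = abs_l2 (\<lambda>z.
     if z \<in> {a<..<l} then P1 *v vector [wderiv a l (component 1 e) z, wderiv a l (component 2 e) z]
     else if z \<in> {l<..<b} then P1 *v vector [wderiv l b (component 1 e) z, wderiv l b (component 2 e) z]
     else 0)"

definition val_a :: "real \<Rightarrow> real \<Rightarrow> real \<Rightarrow> l2 \<Rightarrow> real^2" where
  "val_a a b l e = vector [pt_value a l (component 1 e) a, pt_value a b (component 2 e) a]"

definition val_b :: "real \<Rightarrow> real \<Rightarrow> real \<Rightarrow> l2 \<Rightarrow> real^2" where
  "val_b a b l e = vector [pt_value l b (component 1 e) b, pt_value a b (component 2 e) b]"

definition f_bd :: "real \<Rightarrow> real \<Rightarrow> real \<Rightarrow> l2 \<Rightarrow> real^2" where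
  "f_bd a b l e = (1 / sqrt 2) *\<^sub>R (P1 *v val_b a b l e - P1 *v val_a a b l e)"

definition e_bd :: "real \<Rightarrow> real \<Rightarrow> real \<Rightarrow> l2 \<Rightarrow> real^2" where
  "e_bd a b l e = (1 / sqrt 2) *\<^sub>R (val_b a b l e + val_a a b l e)"

definition f_I :: "real \<Rightarrow> real \<Rightarrow> real \<Rightarrow> l2 \<Rightarrow> real" where
  "f_I a b l e = pt_value a b (component 2 e) l"

definition e_I :: "real \<Rightarrow> real \<Rightarrow> real \<Rightarrow> l2 \<Rightarrow> real" where
  "e_I a b l e = pt_value a l (component 1 e) l - pt_value l b (component 1 e) l"

definition stack :: "real^2 \<Rightarrow> real^2 \<Rightarrow> real^4" where
  "stack f e = vector [f $ 1, f $ 2, e $ 1, e $ 2]"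

definition Sigma_mat :: "real^4^4" where
  "Sigma_mat = vector [vector [0, 0, 1, 0], vector [0, 0, 0, 1],
                       vector [1, 0, 0, 0], vector [0, 1, 0, 0]]"

definition pH_op :: "real \<Rightarrow> real \<Rightarrow> (real \<Rightarrow> real^2^2) \<Rightarrow> (real \<Rightarrow> real^2^2) \<Rightarrow> real \<Rightarrow> real^4^2 \<Rightarrow> real
    \<Rightarrow> l2 unbounded_op" where
  "pH_op a b Qm Qp r W l =
    ({x \<in> X_space a b. let e = mult_op (Q_l a b Qm Qp l) x in
        e \<in> J_dom a b l \<and> f_I a b l e = r * e_I a b l e \<and>
        W *v stack (f_bd a b l e) (e_bd a b l e) = 0},
     \<lambda>x. J_map a b l (mult_op (Q_l a b Qm Qp l) x))"


section \<open>Generators of semigroups and stable families\<close>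

text \<open>The space is a subspace \<open>V\<close> of a real vector space with a norm \<open>N\<close>, since the norm of interest
  depends on \<open>Q\<close> and is not the norm of a type.\<close>

definition bounded_linear_op :: "'x::real_vector set \<Rightarrow> ('x \<Rightarrow> real) \<Rightarrow> ('x \<Rightarrow> 'x) \<Rightarrow> bool" where
  "bounded_linear_op V N T \<longleftrightarrow>
     (\<forall>x\<in>V. T x \<in> V) \<and>
     (\<forall>x\<in>V. \<forall>y\<in>V. T (x + y) = T x + T y) \<and>
     (\<forall>c. \<forall>x\<in>V. T (c *\<^sub>R x) = c *\<^sub>R T x) \<and>
     (\<exists>K. \<forall>x\<in>V. N (T x) \<le> K * N x)"

definition op_norm :: "'x::real_vector set \<Rightarrow> ('x \<Rightarrow> real) \<Rightarrow> ('x \<Rightarrow> 'x) \<Rightarrow> real" where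
  "op_norm V N T = (SUP x\<in>V. N (T x) / N x)"

definition C0_semigroup :: "'x::real_vector set \<Rightarrow> ('x \<Rightarrow> real) \<Rightarrow> (real \<Rightarrow> 'x \<Rightarrow> 'x) \<Rightarrow> bool" where
  "C0_semigroup V N T \<longleftrightarrow>
     (\<forall>t\<ge>0. bounded_linear_op V N (T t)) \<and>
     (\<forall>x\<in>V. T 0 x = x) \<and>
     (\<forall>s\<ge>0. \<forall>t\<ge>0. \<forall>x\<in>V. T (s + t) x = T s (T t x)) \<and>
     (\<forall>x\<in>V. ((\<lambda>t. N (T t x - x)) \<longlongrightarrow> 0) (at_right 0))"

definition generates :: "'x::real_vector set \<Rightarrow> ('x \<Rightarrow> real) \<Rightarrow> 'x unbounded_op \<Rightarrow> (real \<Rightarrow> 'x \<Rightarrow> 'x) \<Rightarrow> bool"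
  where "generates V N A T \<longleftrightarrow>
     (let lim_at = (\<lambda>x y. ((\<lambda>h. N ((1 / h) *\<^sub>R (T h x - x) - y)) \<longlongrightarrow> 0) (at_right 0)) in
       fst A = {x \<in> V. \<exists>y\<in>V. lim_at x y} \<and>
       (\<forall>x\<in>fst A. snd A x \<in> V \<and> lim_at x (snd A x)))"

definition resolvent :: "'x::real_vector unbounded_op \<Rightarrow> real \<Rightarrow> 'x \<Rightarrow> 'x" where
  "resolvent A \<mu> = inv_into (fst A) (\<lambda>x. \<mu> *\<^sub>R x - snd A x)"

definition resolvent_set :: "'x::real_vector set \<Rightarrow> ('x \<Rightarrow> real) \<Rightarrow> 'x unbounded_op \<Rightarrow> real set" where
  "resolvent_set V N A = {\<mu>. bij_betw (\<lambda>x. \<mu> *\<^sub>R x - snd A x) (fst A) V \<and>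
     bounded_linear_op V N (resolvent A \<mu>)}"

text \<open>The resolvents need not commute; as usual for stable families (Kato, Pazy) the product is
  time-ordered, later times to the left: \<open>resolvent_prod A \<mu> [t\<^sub>1, \<dots>, t\<^sub>k]\<close> is
  \<open>R(\<mu>, A(t\<^sub>k)) \<circ> \<dots> \<circ> R(\<mu>, A(t\<^sub>1))\<close>.\<close>

definition resolvent_prod ::
    "(real \<Rightarrow> 'x::real_vector unbounded_op) \<Rightarrow> real \<Rightarrow> real list \<Rightarrow> 'x \<Rightarrow> 'x" where
  "resolvent_prod A \<mu> ts = fold (\<lambda>t S. resolvent (A t) \<mu> \<circ> S) ts id"

definition stable_family ::
    "'x::real_vector set \<Rightarrow> ('x \<Rightarrow> real) \<Rightarrow> real \<Rightarrow> (real \<Rightarrow> 'x unbounded_op) \<Rightarrow> bool" where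
  "stable_family V N \<tau> A \<longleftrightarrow>
     (\<forall>t\<in>{0..\<tau>}. \<exists>T. C0_semigroup V N T \<and> generates V N (A t) T) \<and>
     (\<exists>M \<omega>. M \<ge> 1 \<and>
        (\<forall>t\<in>{0..\<tau>}. {\<omega><..} \<subseteq> resolvent_set V N (A t)) \<and>
        (\<forall>ts. sorted ts \<and> set ts \<subseteq> {0..\<tau>} \<longrightarrow>
          (\<forall>\<mu>>\<omega>. op_norm V N (resolvent_prod A \<mu> ts) \<le> M / (\<mu> - \<omega>) ^ length ts)))"


section \<open>Regularity and matrix inequalities\<close>

text \<open>One-sided derivatives at the end points of an interval \<open>S\<close>; nothing is required outside \<open>S\<close>.\<close>

definition C1_on :: "real set \<Rightarrow> (real \<Rightarrow> 'b::real_normed_vector) \<Rightarrow> bool" where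
  "C1_on S f \<longleftrightarrow> (\<exists>f'. (\<forall>x\<in>S. (f has_vector_derivative f' x) (at x within S)) \<and> continuous_on S f')"

definition pos_semidef :: "real^'n^'n \<Rightarrow> bool" where
  "pos_semidef A \<longleftrightarrow> (\<forall>v. 0 \<le> v \<bullet> (A *v v))"

end

theory Submission
  imports Defs
begin

text \<open>
  As \<open>r = 0\<close>, every \<open>e = Q\<^sub>l x\<close> with \<open>x\<close> in the domain of the operator \<open>A\<^sub>l = J\<^sub>l Q\<^sub>l\<close> satisfies
  \<open>e\<^sub>2 (l) = 0\<close>. Hence the energy balance of \<open>J\<^sub>l\<close> stays valid for weights \<open>h\<close> that jump at \<open>l\<close>: for
  \<open>h (a) = h (b) = 1\<close> the boundary terms are non-positive by \<open>W \<Sigma> W\<^sup>T \<ge> 0\<close>, and what remains is bounded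
  by the derivative of \<open>h\<close> on both sides of \<open>l\<close>. By the proportionality of \<open>Q\<^sup>+\<close> and \<open>Q\<^sup>-\<close>
  the jump can be chosen such that \<open>h Q\<^sub>l = k Q\<^sup>-\<close> does not depend on \<open>l\<close>. All the operators are
  therefore quasi-dissipative, with the same constant, in the one inner product with weight \<open>k Q\<^sup>-\<close>, so
  that products of resolvents are estimated factor by factor.

  For the generation of a semigroup, the resolvent equation of \<open>J\<^sub>l\<close> is solved explicitly and that of
  \<open>J\<^sub>l Q\<^sub>l\<close> by a contraction argument. The semigroup of an m-dissipative \<open>A\<close> is the limit of the implicit
  Euler approximations \<open>J (t / 2\<^sup>n) ^^ 2\<^sup>n\<close>, \<open>J h = (I - h A)\<^sup>-\<^sup>1\<close>, which converge because
  \<open>J (h + k) - J h J k\<close> is of order \<open>h k\<close> on the domain of \<open>A\<^sup>2\<close>.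
\<close>

text \<open>In the energy norm of its own \<open>Q_l\<close> every \<open>A(t)\<close> is
  dissipative, but these norms vary with \<open>t\<close>, and not in a Lipschitz way: for
  \<open>x\<close> supported between two interface positions, the ratio of the two norms is governed
  by \<open>Q\<^sup>+ / Q\<^sup>-\<close> there and need not tend to 1 as the positions approach
  each other. Changing the norm at every factor would multiply such constants along a product of
  resolvents, so one norm has to serve all positions. The two ends decide its weight: the left
  weight \<open>k\<close> must be 1 at \<open>a\<close>, the right one
  \<open>k Q\<^sup>- / Q\<^sup>+\<close> must be 1 at \<open>b\<close>, and the affine
  \<open>k\<close> with end values 1 and \<open>(Q\<^sup>+ / Q\<^sup>-)(b)\<close> does this. The
  price is a growth rate, governed by the derivatives of \<open>k\<close> and of
  \<open>k Q\<^sup>- / Q\<^sup>+\<close>; these are bounded on all of \<open>[a,b]\<close>, hence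
  uniformly in \<open>l\<close>. Passing from this norm to that of \<open>Q_0\<close> costs a
  constant only once per product.\<close>

section \<open>Contraction semigroups by implicit Euler approximation\<close>

text \<open>Two norms are kept apart: the norm of the type provides completeness and the topology,
  while \<open>N\<close>, equivalent to it on \<open>V\<close>, is the one in which \<open>A\<close>
  is dissipative. Quasi-dissipative operators are brought into this form by subtracting a multiple
  of the identity.\<close>

locale m_dissipative =
  fixes V D :: "'a::banach set" and A :: "'a \<Rightarrow> 'a" and N :: "'a \<Rightarrow> real" and c C :: real
  assumes V_subspace: "subspace V" and V_closed: "closed V"
    and D_subspace: "subspace D" and D_V: "D \<subseteq> V" and D_dense: "V \<subseteq> closure D"
    and A_add: "\<And>x y. x \<in> D \<Longrightarrow> y \<in> D \<Longrightarrow> A (x + y) = A x + A y"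
    and A_scale: "\<And>r x. x \<in> D \<Longrightarrow> A (r *\<^sub>R x) = r *\<^sub>R A x"
    and A_V: "\<And>x. x \<in> D \<Longrightarrow> A x \<in> V"
    and N_add: "\<And>x y. N (x + y) \<le> N x + N y"
    and N_scale: "\<And>r x. N (r *\<^sub>R x) = \<bar>r\<bar> * N x"
    and N_lower: "\<And>x. x \<in> V \<Longrightarrow> norm x \<le> c * N x"
    and N_upper: "\<And>x. N x \<le> C * norm x"
    and c_pos: "0 < c" and C_pos: "0 < C"
    and dissipative: "\<And>h x. x \<in> D \<Longrightarrow> 0 < h \<Longrightarrow> N x \<le> N (x - h *\<^sub>R A x)"
    and range_full: "\<And>h y. y \<in> V \<Longrightarrow> 0 < h \<Longrightarrow> \<exists>x\<in>D. x - h *\<^sub>R A x = y"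
begin

text \<open>The value at \<open>h = 0\<close> is the identity, so that the semigroup law below needs no case distinction.\<close>

definition J :: "real \<Rightarrow> 'a \<Rightarrow> 'a" where
  "J h y = (if h \<le> 0 then y else THE x. x \<in> D \<and> x - h *\<^sub>R A x = y)"

lemma N_zero [simp]: "N 0 = 0"
  using N_scale[of 0 0] by simp

lemma eq_zero_if_N_le_zero: "x \<in> V \<Longrightarrow> N x \<le> 0 \<Longrightarrow> x = 0"
proof -
  assume "x \<in> V" "N x \<le> 0"
  then have "norm x \<le> 0"
    using N_lower[of x] c_pos mult_nonneg_nonpos[of c "N x"] by linarith
  then show ?thesis by simp
qed

lemma N_minus: "N (x - y) = N (y - x)"
  using N_scale[of "-1" "x - y"] by simp

lemma N_nonneg: "0 \<le> N x"
  using N_add[of x "- x"] N_scale[of "-1" x] by simp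

lemma N_diff: "N x - N y \<le> N (x - y)"
  using N_add[of "x - y" y] by simp

lemma A_minus: "x \<in> D \<Longrightarrow> y \<in> D \<Longrightarrow> A (x - y) = A x - A y"
  using A_add[of x "-y"] A_scale[of y "-1"] subspace_neg[OF D_subspace] by simp

lemma V_intros [simp, intro]:
  "0 \<in> V" "x \<in> V \<Longrightarrow> y \<in> V \<Longrightarrow> x + y \<in> V" "x \<in> V \<Longrightarrow> y \<in> V \<Longrightarrow> x - y \<in> V" "x \<in> V \<Longrightarrow> r *\<^sub>R x \<in> V"
  using V_subspace by (auto simp: subspace_0 subspace_add subspace_diff subspace_scale)

lemma D_intros [simp, intro]:
  "0 \<in> D" "x \<in> D \<Longrightarrow> y \<in> D \<Longrightarrow> x + y \<in> D" "x \<in> D \<Longrightarrow> y \<in> D \<Longrightarrow> x - y \<in> D" "x \<in> D \<Longrightarrow> r *\<^sub>R x \<in> D"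
  using D_subspace by (auto simp: subspace_0 subspace_add subspace_diff subspace_scale)

lemma D_in_V [simp, intro]: "x \<in> D \<Longrightarrow> x \<in> V"
  using D_V by auto

lemma D_unique:
  assumes "x \<in> D" "x' \<in> D" "0 < h" "x - h *\<^sub>R A x = x' - h *\<^sub>R A x'"
  shows "x = x'"
proof -
  have "(x - x') - h *\<^sub>R A (x - x') = 0"
    using assms by (simp add: A_minus algebra_simps)
  with dissipative[of "x - x'" h] assms have "N (x - x') \<le> 0"
    by auto
  then show ?thesis
    using eq_zero_if_N_le_zero[of "x - x'"] assms by simp
qed

section \<open>The resolvents and their commutation relations\<close>

lemma J_inverse:
  assumes "y \<in> V" "0 < h"
  shows "J h y \<in> D" "J h y - h *\<^sub>R A (J h y) = y"
proof -
  have "\<exists>!x. x \<in> D \<and> x - h *\<^sub>R A x = y"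
    using range_full[OF assms] D_unique assms by blast
  from theI'[OF this] show "J h y \<in> D" "J h y - h *\<^sub>R A (J h y) = y"
    using assms by (auto simp: J_def)
qed

lemma J_left_inverse: "x \<in> D \<Longrightarrow> 0 \<le> h \<Longrightarrow> J h (x - h *\<^sub>R A x) = x"
proof (cases "h = 0")
  case False
  assume "x \<in> D" "0 \<le> h"
  with False D_unique[of "J h (x - h *\<^sub>R A x)" x h] J_inverse[of "x - h *\<^sub>R A x" h] show ?thesis
    using A_V by auto
qed (auto simp: J_def)

lemma J_V [simp, intro]: "y \<in> V \<Longrightarrow> J h y \<in> V"
  using J_inverse[of y h] by (cases "h \<le> 0") (auto simp: J_def)

lemma J_add: "x \<in> V \<Longrightarrow> y \<in> V \<Longrightarrow> J h (x + y) = J h x + J h y"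
proof (cases "h \<le> 0")
  case False
  assume "x \<in> V" "y \<in> V"
  with False have *: "J h x \<in> D" "J h x - h *\<^sub>R A (J h x) = x" "J h y \<in> D" "J h y - h *\<^sub>R A (J h y) = y"
    using J_inverse[of _ h] by auto
  then have "J h ((J h x + J h y) - h *\<^sub>R A (J h x + J h y)) = J h x + J h y"
    using False by (intro J_left_inverse) auto
  moreover have "(J h x + J h y) - h *\<^sub>R A (J h x + J h y)
      = (J h x - h *\<^sub>R A (J h x)) + (J h y - h *\<^sub>R A (J h y))"
    unfolding A_add[OF *(1,3)] by (simp add: algebra_simps)
  then have "(J h x + J h y) - h *\<^sub>R A (J h x + J h y) = x + y"
    by (simp only: *)
  ultimately show ?thesis by simp
qed (simp add: J_def)

lemma J_scale: "x \<in> V \<Longrightarrow> J h (r *\<^sub>R x) = r *\<^sub>R J h x"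
proof (cases "h \<le> 0")
  case False
  assume "x \<in> V"
  with False have *: "J h x \<in> D" "J h x - h *\<^sub>R A (J h x) = x"
    using J_inverse[of _ h] by auto
  then have "J h ((r *\<^sub>R J h x) - h *\<^sub>R A (r *\<^sub>R J h x)) = r *\<^sub>R J h x"
    using False by (intro J_left_inverse) auto
  moreover have "(r *\<^sub>R J h x) - h *\<^sub>R A (r *\<^sub>R J h x) = r *\<^sub>R x"
  proof -
    have "r *\<^sub>R J h x - h *\<^sub>R A (r *\<^sub>R J h x) = r *\<^sub>R (J h x - h *\<^sub>R A (J h x))"
      unfolding A_scale[OF *(1)] by (simp add: scaleR_right_diff_distrib mult.commute)
    then show ?thesis by (simp only: *)
  qed
  ultimately show ?thesis by simp
qed (simp add: J_def)

lemma J_diff: "x \<in> V \<Longrightarrow> y \<in> V \<Longrightarrow> J h (x - y) = J h x - J h y"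
  using J_add[of x "- y" h] J_scale[of y h "-1"] subspace_neg[OF V_subspace] by simp

lemma J_contraction: "y \<in> V \<Longrightarrow> N (J h y) \<le> N y"
  using J_inverse[of y h] dissipative[of "J h y" h] by (cases "h \<le> 0") (auto simp: J_def)

lemma J_D [simp, intro]: "x \<in> D \<Longrightarrow> J h x \<in> D"
  using J_inverse[of x h] by (cases "h \<le> 0") (auto simp: J_def)

text \<open>From \<open>A (J h x) = (1/h) *\<^sub>R (J h x - x)\<close> one reads off that
  \<open>A (J h x)\<close> is again in \<open>D\<close>. So \<open>I - h A\<close> applies to it,
  and the result is \<open>A x\<close>.\<close>

lemma A_J: "x \<in> D \<Longrightarrow> A (J h x) = J h (A x)"
proof (cases "h \<le> 0")
  case False
  assume x: "x \<in> D"
  have *: "J h x \<in> D" "J h x - h *\<^sub>R A (J h x) = x"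
    using J_inverse[of x h] x False by auto
  then have AJ: "A (J h x) = (1/h) *\<^sub>R (J h x - x)"
  proof -
    have "h *\<^sub>R A (J h x) = J h x - x"
      using *(2) by (simp add: algebra_simps)
    then have "(1/h) *\<^sub>R (h *\<^sub>R A (J h x)) = (1/h) *\<^sub>R (J h x - x)"
      by simp
    then show ?thesis using False by simp
  qed
  then have "A (J h x) \<in> D"
    using x by simp
  then have "J h (A (J h x) - h *\<^sub>R A (A (J h x))) = A (J h x)"
    using False by (intro J_left_inverse) auto
  moreover have "A (J h x) - h *\<^sub>R A (A (J h x)) = A (J h x - h *\<^sub>R A (J h x))"
    using *(1) \<open>A (J h x) \<in> D\<close> by (simp add: A_minus A_scale)
  ultimately show ?thesis
    by (simp only: *)
qed (simp add: J_def)

text \<open>As \<open>J h\<close> commutes with \<open>A\<close> on \<open>D\<close>, applying it to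
  \<open>x = (I - k A) J k x\<close> gives \<open>J h x = (I - k A) J h J k x\<close>; then invert
  \<open>I - k A\<close>.\<close>

lemma J_commute: 
  assumes "x \<in> V" "0 \<le> h" "0 \<le> k"
  shows "J h (J k x) = J k (J h x)"
proof (cases "k = 0 \<or> h = 0")
  case False
  with assms have k: "0 < k" and h: "0 < h" by auto
  have 1: "J k x \<in> D" "J k x - k *\<^sub>R A (J k x) = x"
    using J_inverse[OF assms(1) k] by auto
  then have "J h x = J h (J k x) - k *\<^sub>R A (J h (J k x))"
  proof -
    have "J h x = J h (J k x - k *\<^sub>R A (J k x))"
      by (simp only: 1(2))
    also have "\<dots> = J h (J k x) - k *\<^sub>R J h (A (J k x))"
      using 1(1) A_V by (simp only: J_diff J_scale D_in_V V_intros)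
    finally show ?thesis by (simp only: A_J[OF 1(1)])
  qed
  then show ?thesis
    using J_left_inverse[of "J h (J k x)" k] 1 assms by simp
qed (auto simp: J_def)

definition D2 :: "'a set" where
  "D2 = {x \<in> D. A x \<in> D}"

lemma J_D2: "x \<in> D2 \<Longrightarrow> J h x \<in> D2"
  by (auto simp: D2_def A_J)

text \<open>For \<open>p = J h J k x\<close> one has \<open>x = (I - k A) (I - h A) p = (I - (h + k)
  A) p + h k A\<^sup>2 p\<close>. So \<open>p\<close> solves the equation for
  \<open>J (h + k) x\<close> with a right-hand side that is off by
  \<open>h k A\<^sup>2 p\<close>.\<close>

lemma J_splitting:
  assumes "x \<in> D2" "0 \<le> h" "0 \<le> k"
  shows "N (J (h + k) x - J h (J k x)) \<le> h * k * N (A (A x))"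
proof -
  define p where "p = J h (J k x)"
  have p: "p \<in> D" "A p \<in> D" "A (A p) = J h (J k (A (A x)))"
    using assms by (auto simp: p_def D2_def A_J)
  have x: "x \<in> V" "x \<in> D" "A x \<in> D" "A (A x) \<in> V"
    using assms A_V by (auto simp: D2_def)
  have inv: "J r y - r *\<^sub>R A (J r y) = y" if "y \<in> D" "0 \<le> r" for r y
    using that J_inverse[of y r] by (cases "r = 0") (auto simp: J_def)
  have e1: "p - h *\<^sub>R A p = J k x"
    unfolding p_def using inv[of "J k x" h] assms x by auto
  have e2: "J k x - k *\<^sub>R A (J k x) = x"
    using inv x assms by auto
  have "A (J k x) = A p - h *\<^sub>R A (A p)"
    unfolding e1[symmetric] using p by (simp add: A_minus A_scale)
  then have "x = p - h *\<^sub>R A p - k *\<^sub>R (A p - h *\<^sub>R A (A p))"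
    using e1 e2 by simp
  then have *: "p - (h + k) *\<^sub>R A p = x - (h * k) *\<^sub>R A (A p)"
    by (simp add: algebra_simps)
  have "p = J (h + k) (p - (h + k) *\<^sub>R A p)"
    using J_left_inverse[of p "h + k"] p assms by simp
  also have "\<dots> = J (h + k) x - (h * k) *\<^sub>R J (h + k) (A (A p))"
    unfolding * using p A_V x by (simp add: J_diff J_scale)
  finally have "J (h + k) x - p = (h * k) *\<^sub>R J (h + k) (A (A p))"
    by (simp add: algebra_simps)
  then have "N (J (h + k) x - p) = h * k * N (J (h + k) (A (A p)))"
    using assms by (simp add: N_scale)
  also have "\<dots> \<le> h * k * N (A (A x))"
    using J_contraction[of "A (A p)" "h + k"] J_contraction[of "J k (A (A x))" h]
      J_contraction[of "A (A x)" k] p x assms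
    by (intro mult_left_mono) auto
  finally show ?thesis by (simp add: p_def)
qed

lemma funpow_J_V [simp, intro]: "x \<in> V \<Longrightarrow> (J h ^^ n) x \<in> V"
  by (induction n) auto

lemma funpow_J_add: "x \<in> V \<Longrightarrow> y \<in> V \<Longrightarrow> (J h ^^ n) (x + y) = (J h ^^ n) x + (J h ^^ n) y"
  by (induction n) (auto simp: J_add)

lemma funpow_J_scale: "x \<in> V \<Longrightarrow> (J h ^^ n) (r *\<^sub>R x) = r *\<^sub>R (J h ^^ n) x"
  by (induction n) (auto simp: J_scale)

lemma funpow_J_diff: "x \<in> V \<Longrightarrow> y \<in> V \<Longrightarrow> (J h ^^ n) (x - y) = (J h ^^ n) x - (J h ^^ n) y"
  by (induction n) (auto simp: J_diff)

lemma funpow_J_contraction: "x \<in> V \<Longrightarrow> N ((J h ^^ n) x) \<le> N x"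
  by (induction n) (auto intro: order_trans[OF J_contraction])

text \<open>\<open>P\<^sup>n - R\<^sup>n\<close> is the sum of the \<open>n\<close> terms
  \<open>P\<^sup>i (P - R) R\<^sup>j\<close> with \<open>i + j = n - 1\<close>; as \<open>P\<close>
  and \<open>R\<close> commute and are contractions, each contributes at most
  \<open>N (P x - R x)\<close>. This turns the local error of one step into a global error.\<close>

lemma funpow_diff_bound:
  assumes P: "\<And>y. y \<in> V \<Longrightarrow> P y \<in> V" "\<And>y z. y \<in> V \<Longrightarrow> z \<in> V \<Longrightarrow> P (y - z) = P y - P z"
      "\<And>y. y \<in> V \<Longrightarrow> N (P y) \<le> N y"
    and R: "\<And>y. y \<in> V \<Longrightarrow> R y \<in> V" "\<And>y z. y \<in> V \<Longrightarrow> z \<in> V \<Longrightarrow> R (y - z) = R y - R z"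
      "\<And>y. y \<in> V \<Longrightarrow> N (R y) \<le> N y"
    and PR: "\<And>y. y \<in> V \<Longrightarrow> P (R y) = R (P y)"
    and x: "x \<in> V"
  shows "N ((P ^^ n) x - (R ^^ n) x) \<le> real n * N (P x - R x)"
  using x
proof (induction n arbitrary: x)
  case (Suc n)
  have Pn: "(P ^^ k) y \<in> V" "N ((P ^^ k) y) \<le> N y" if "y \<in> V" for k y
    using that by (induction k) (auto simp: P(1) intro: order_trans[OF P(3)])
  have Pnd: "(P ^^ k) (y - z) = (P ^^ k) y - (P ^^ k) z" if "y \<in> V" "z \<in> V" for k y z
    using that by (induction k) (auto simp: P Pn)
  have Rn: "(R ^^ k) y \<in> V" if "y \<in> V" for k y
    using that by (induction k) (auto simp: R(1))
  have "(P ^^ Suc n) x - (R ^^ Suc n) x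
      = (P ^^ n) (P x - R x) + ((P ^^ n) (R x) - (R ^^ n) (R x))"
    using Suc.prems by (simp add: Pnd P R funpow_swap1)
  also have "N \<dots> \<le> N (P x - R x) + real n * N (P (R x) - R (R x))"
    using Suc.IH[of "R x"] Suc.prems Pn[of "P x - R x" n] P R
    by (intro order_trans[OF N_add] add_mono) auto
  also have "P (R x) - R (R x) = R (P x - R x)"
    using Suc.prems PR P(1) R by simp
  also have "N (P x - R x) + real n * N (R (P x - R x)) \<le> N (P x - R x) + real n * N (P x - R x)"
    using Suc.prems P(1) R(1) by (intro add_left_mono mult_left_mono R(3) V_intros) auto
  finally show ?case
    by (simp add: algebra_simps)
qed simp

section \<open>Convergence of the dyadic Euler approximations\<close>

definition Tn :: "nat \<Rightarrow> real \<Rightarrow> 'a \<Rightarrow> 'a" where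
  "Tn n t = J (t / 2 ^ n) ^^ (2 ^ n)"

definition T :: "real \<Rightarrow> 'a \<Rightarrow> 'a" where
  "T t x = lim (\<lambda>n. Tn n t x)"

text \<open>Step sizes are dyadic so that a refinement replaces each \<open>J (h + h)\<close> by
  \<open>J h\<close> applied twice. The splitting error \<open>h\<^sup>2 N (A\<^sup>2 x)\<close>
  occurs \<open>2 ^ n\<close> times with \<open>h = t / 2 ^ (n + 1)\<close>, so the increments decay
  geometrically.\<close>

lemma Tn_step:
  assumes "x \<in> D2" "0 \<le> t"
  shows "N (Tn (Suc n) t x - Tn n t x) \<le> (1/2) ^ n * (t\<^sup>2 * N (A (A x)))"
proof -
  define h where "h = t / 2 ^ Suc n"
  have h: "0 \<le> h" using assms by (simp add: h_def)
  have th: "t / 2 ^ n = h + h" by (simp add: h_def)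
  have xV: "x \<in> V" using assms by (auto simp: D2_def)
  have "Tn (Suc n) t x = ((J h ^^ 2) ^^ (2 ^ n)) x"
    by (simp add: Tn_def h_def funpow_mult mult.commute)
  moreover have "Tn n t x = (J (h + h) ^^ (2 ^ n)) x"
    by (simp add: Tn_def th)
  ultimately have "N (Tn (Suc n) t x - Tn n t x) \<le> real (2 ^ n) * N ((J h ^^ 2) x - J (h + h) x)"
    using xV h
    by (simp only:) (intro funpow_diff_bound,
      auto simp: numeral_2_eq_2 J_diff J_commute intro: J_contraction order_trans[OF J_contraction])
  also have "N ((J h ^^ 2) x - J (h + h) x) \<le> h * h * N (A (A x))"
    using J_splitting[OF assms(1) h h] by (simp add: numeral_2_eq_2 N_minus)
  also have "real (2 ^ n) * (h * h * N (A (A x))) = (1/2) ^ n * (t\<^sup>2 * N (A (A x))) / 4"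
    by (simp add: h_def power2_eq_square field_simps)
  also have "\<dots> \<le> (1/2) ^ n * (t\<^sup>2 * N (A (A x)))"
    using N_nonneg[of "A (A x)"] by (simp add: mult_nonneg_nonneg)
  finally show ?thesis
    by (simp add: mult_left_mono)
qed

lemma norm_to_N: "(\<lambda>n. norm (f n)) \<longlonglongrightarrow> 0 \<Longrightarrow> (\<lambda>n. N (f n)) \<longlonglongrightarrow> 0"
  by (rule tendsto_sandwich[of "\<lambda>_. 0" _ _ "\<lambda>n. C * norm (f n)"])
    (auto simp: N_nonneg N_upper intro: tendsto_eq_intros)

lemma J_near_identity: "x \<in> D \<Longrightarrow> 0 \<le> h \<Longrightarrow> N (J h x - x) \<le> h * N (A x)"
proof -
  assume x: "x \<in> D" and h: "0 \<le> h"
  have "J h x - x = J h x - J h (x - h *\<^sub>R A x)"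
    using J_left_inverse[OF x h] by simp
  also have "\<dots> = h *\<^sub>R J h (A x)"
    using x A_V by (simp add: J_diff J_scale)
  finally show ?thesis
    using h x A_V J_contraction[of "A x" h] by (simp add: N_scale mult_left_mono)
qed

text \<open>\<open>J h\<close> maps \<open>D\<close> into \<open>D2\<close> and moves a point
  \<open>z\<close> of \<open>D\<close> by at most \<open>h N (A z)\<close>; the given point of
  \<open>V\<close> is first replaced by such a \<open>z\<close>.\<close>

lemma D2_approx:
  assumes "x \<in> V" "0 < \<epsilon>"
  obtains y where "y \<in> D2" "N (x - y) < \<epsilon>"
proof -
  obtain z where z: "z \<in> D" "dist z x < \<epsilon> / (2 * C)"
    using D_dense assms C_pos closure_approachable[of x D] by (metis divide_pos_pos mult_pos_pos subsetD zero_less_numeral)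
  have "N (x - z) \<le> C * norm (x - z)"
    by (rule N_upper)
  also have "\<dots> < \<epsilon> / 2"
    using z C_pos by (simp add: dist_norm norm_minus_commute field_simps)
  finally have 1: "N (x - z) < \<epsilon> / 2" .
  \<comment> \<open>The summand 1 keeps the quotient meaningful when \<open>N (A z)\<close>
    vanishes.\<close>
  define h where "h = \<epsilon> / (2 * (N (A z) + 1))"
  have h: "0 < h"
    using assms N_nonneg[of "A z"] by (simp add: h_def)
  have "N (J h z - z) \<le> h * N (A z)"
    using z h by (intro J_near_identity) auto
  also have "\<dots> \<le> \<epsilon> / 2"
    using assms N_nonneg[of "A z"] by (simp add: h_def field_simps)
  finally have 2: "N (z - J h z) \<le> \<epsilon> / 2"
    by (simp add: N_minus)
  have "J h z - h *\<^sub>R A (J h z) = z" "J h z \<in> D"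
    using J_inverse[of z h] z h by auto
  then have "A (J h z) \<in> D"
    using z h J_inverse[of "A z" h] A_V by (simp add: A_J)
  then have "J h z \<in> D2"
    using z by (simp add: D2_def)
  moreover have "N (x - J h z) < \<epsilon>"
    using N_add[of "x - z" "z - J h z"] 1 2 by simp
  ultimately show thesis
    by (rule that)
qed

lemma Tn_V [simp, intro]: "x \<in> V \<Longrightarrow> Tn n t x \<in> V"
  by (simp add: Tn_def)

lemma Tn_diff: "x \<in> V \<Longrightarrow> y \<in> V \<Longrightarrow> Tn n t (x - y) = Tn n t x - Tn n t y"
  by (simp add: Tn_def funpow_J_diff)

lemma Tn_contraction: "x \<in> V \<Longrightarrow> N (Tn n t x) \<le> N x"
  by (simp add: Tn_def funpow_J_contraction)

lemma Tn_convergent_D2: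
  assumes "x \<in> D2" "0 \<le> t"
  shows "convergent (\<lambda>n. Tn n t x)"
proof -
  have "summable (\<lambda>n. Tn (Suc n) t x - Tn n t x)"
  proof (rule summable_comparison_test)
    show "\<exists>n0. \<forall>n\<ge>n0. norm (Tn (Suc n) t x - Tn n t x) \<le> c * ((1/2) ^ n * (t\<^sup>2 * N (A (A x))))"
    proof (intro exI allI impI)
      fix n
      have "x \<in> V" using assms by (auto simp: D2_def)
      then have "norm (Tn (Suc n) t x - Tn n t x) \<le> c * N (Tn (Suc n) t x - Tn n t x)"
        by (intro N_lower) auto
      also have "\<dots> \<le> c * ((1/2) ^ n * (t\<^sup>2 * N (A (A x))))"
        using Tn_step[OF assms] c_pos by (intro mult_left_mono) auto
      finally show "norm (Tn (Suc n) t x - Tn n t x) \<le> \<dots>" .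
    qed
    show "summable (\<lambda>n. c * ((1/2) ^ n * (t\<^sup>2 * N (A (A x)))))"
      by (intro summable_mult summable_mult2 summable_geometric) auto
  qed
  then obtain s where "(\<lambda>n. Tn (Suc n) t x - Tn n t x) sums s"
    by (auto simp: summable_def)
  then have "(\<lambda>n. Tn n t x - Tn 0 t x) \<longlonglongrightarrow> s"
    unfolding sums_def sum_lessThan_telescope[of "\<lambda>n. Tn n t x"] .
  then have "(\<lambda>n. Tn n t x - Tn 0 t x + Tn 0 t x) \<longlonglongrightarrow> s + Tn 0 t x"
    by (intro tendsto_add tendsto_const)
  then show ?thesis
    by (auto simp: convergent_def)
qed

text \<open>Three-epsilon argument: \<open>D2\<close> is dense, the approximations converge there,
  and they are contractions in \<open>N\<close> for every \<open>n\<close>. The factor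
  \<open>c\<close> in the tolerance converts from \<open>N\<close> to the norm of the type, in which
  completeness is available.\<close>

lemma Tn_tendsto:
  assumes "x \<in> V" "0 \<le> t"
  shows "(\<lambda>n. Tn n t x) \<longlonglongrightarrow> T t x"
proof -
  have "Cauchy (\<lambda>n. Tn n t x)"
  proof (rule metric_CauchyI)
    fix e :: real assume e: "0 < e"
    obtain y where y: "y \<in> D2" "N (x - y) < e / (3 * c)"
      using D2_approx[OF assms(1), of "e / (3 * c)"] e c_pos by auto
    have yV: "y \<in> V" using y by (auto simp: D2_def)
    have "Cauchy (\<lambda>n. Tn n t y)"
      using Tn_convergent_D2[OF y(1) assms(2)] by (rule convergent_Cauchy)
    then obtain K where K: "\<And>m n. m \<ge> K \<Longrightarrow> n \<ge> K \<Longrightarrow> dist (Tn m t y) (Tn n t y) < e / 3"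
      using e by (metis metric_CauchyD divide_pos_pos zero_less_numeral)
    have near: "norm (Tn n t x - Tn n t y) < e / 3" for n
    proof -
      have "norm (Tn n t x - Tn n t y) \<le> c * N (Tn n t (x - y))"
        using N_lower[of "Tn n t (x - y)"] assms yV by (simp add: Tn_diff)
      also have "\<dots> \<le> c * N (x - y)"
        using Tn_contraction[of "x - y"] assms yV c_pos by (intro mult_left_mono) auto
      also have "\<dots> < e / 3"
        using y c_pos by (simp add: field_simps)
      finally show ?thesis .
    qed
    show "\<exists>K. \<forall>m\<ge>K. \<forall>n\<ge>K. dist (Tn m t x) (Tn n t x) < e"
    proof (intro exI allI impI)
      fix m n assume "K \<le> m" "K \<le> n"
      from K[OF this] near[of m] near[of n] show "dist (Tn m t x) (Tn n t x) < e"
        unfolding dist_norm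
        using norm_triangle_ineq[of "Tn m t x - Tn m t y" "Tn m t y - Tn n t y"]
          norm_triangle_ineq[of "Tn m t x - Tn n t y" "Tn n t y - Tn n t x"]
        by (simp add: norm_minus_commute)
    qed
  qed
  then show ?thesis
    by (simp add: T_def Cauchy_convergent convergent_LIMSEQ_iff[symmetric])
qed

lemma T_V [simp, intro]: "x \<in> V \<Longrightarrow> 0 \<le> t \<Longrightarrow> T t x \<in> V"
  using closed_sequentially[OF V_closed, of "\<lambda>n. Tn n t x" "T t x"] Tn_tendsto by auto

lemma T_add: "x \<in> V \<Longrightarrow> y \<in> V \<Longrightarrow> 0 \<le> t \<Longrightarrow> T t (x + y) = T t x + T t y"
  by (rule LIMSEQ_unique[OF Tn_tendsto])
    (auto simp: Tn_def funpow_J_add intro!: tendsto_add Tn_tendsto[unfolded Tn_def])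

lemma T_scale: "x \<in> V \<Longrightarrow> 0 \<le> t \<Longrightarrow> T t (r *\<^sub>R x) = r *\<^sub>R T t x"
  by (rule LIMSEQ_unique[OF Tn_tendsto])
    (auto simp: Tn_def funpow_J_scale intro!: tendsto_scaleR Tn_tendsto[unfolded Tn_def])

lemma T_diff: "x \<in> V \<Longrightarrow> y \<in> V \<Longrightarrow> 0 \<le> t \<Longrightarrow> T t (x - y) = T t x - T t y"
  using T_add[of x "-y" t] T_scale[of y t "-1"] subspace_neg[OF V_subspace] by simp

lemma N_tendsto:
  assumes "f \<longlonglongrightarrow> x"
  shows "(\<lambda>n. N (f n)) \<longlonglongrightarrow> N x"
proof -
  have "(\<lambda>n. N (f n - x)) \<longlonglongrightarrow> 0"
    using assms by (intro norm_to_N) (simp add: LIM_zero tendsto_norm_zero)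
  then have "(\<lambda>n. N (f n) - N x) \<longlonglongrightarrow> 0"
  proof (rule Lim_null_comparison[rotated])
    show "\<forall>\<^sub>F n in sequentially. norm (N (f n) - N x) \<le> N (f n - x)"
    proof (rule always_eventually, rule allI)
      fix n show "norm (N (f n) - N x) \<le> N (f n - x)"
        using N_diff[of "f n" x] N_diff[of x "f n"] N_minus[of x "f n"] by simp
    qed
  qed
  then show ?thesis
    by (rule LIM_zero_cancel)
qed

lemma T_contraction: "x \<in> V \<Longrightarrow> 0 \<le> t \<Longrightarrow> N (T t x) \<le> N x"
  by (rule LIMSEQ_le_const2[OF N_tendsto[OF Tn_tendsto]]) (auto intro: Tn_contraction)

lemma T_zero: "x \<in> V \<Longrightarrow> T 0 x = x"
proof -
  assume "x \<in> V"
  have "J 0 ^^ k = id" for k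
    by (induction k) (auto simp: J_def)
  then have "Tn n 0 x = x" for n
    by (simp add: Tn_def)
  with Tn_tendsto[OF \<open>x \<in> V\<close>, of 0] show ?thesis
    by (simp add: LIMSEQ_const_iff)
qed

section \<open>The semigroup law\<close>

lemma limit_eq_zero_if_N_le:
  assumes "f \<longlonglongrightarrow> x" "x \<in> V" "g \<longlonglongrightarrow> 0" "\<And>n. N (f n) \<le> g n"
  shows "x = 0"
  using LIMSEQ_le[OF N_tendsto[OF assms(1)] assms(3)] assms(2,4) by (intro eq_zero_if_N_le_zero) auto

text \<open>There are two errors. At the discrete level \<open>J (h + k)\<close> is compared with
  \<open>J h J k\<close> in each of \<open>2 ^ n\<close> steps, a total of order
  \<open>s t / 2 ^ n\<close>; then \<open>Tn n t x\<close> is replaced by its limit inside the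
  contraction \<open>Tn n s\<close>.\<close>

lemma T_semigroup_D2:
  assumes "x \<in> D2" "0 \<le> s" "0 \<le> t"
  shows "T (s + t) x = T s (T t x)"
proof -
  have xV: "x \<in> V" using assms by (auto simp: D2_def)
  have est: "N (Tn n (s + t) x - Tn n s (Tn n t x)) \<le> (1/2) ^ n * (s * t * N (A (A x)))" for n
  proof -
    define h k where "h = s / 2 ^ n" and "k = t / 2 ^ n"
    have hk: "0 \<le> h" "0 \<le> k" "h + k = (s + t) / 2 ^ n"
      using assms by (auto simp: h_def k_def add_divide_distrib)
    have comm: "(J h ^^ j) (J k y) = J k ((J h ^^ j) y)" if "y \<in> V" for j y
      using that hk by (induction j) (auto simp: J_commute)
    have prod: "((\<lambda>y. J h (J k y)) ^^ j) y = (J h ^^ j) ((J k ^^ j) y)" if "y \<in> V" for j y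
      using that
    proof (induction j)
      case (Suc j)
      have "((\<lambda>y. J h (J k y)) ^^ Suc j) y = J h (J k ((J h ^^ j) ((J k ^^ j) y)))"
        using Suc by simp
      also have "\<dots> = J h ((J h ^^ j) (J k ((J k ^^ j) y)))"
        using Suc.prems by (simp add: comm)
      finally show ?case by simp
    qed simp
    have "N (Tn n (s + t) x - Tn n s (Tn n t x))
        = N ((J (h + k) ^^ (2 ^ n)) x - ((\<lambda>y. J h (J k y)) ^^ (2 ^ n)) x)"
      using xV by (simp only: prod hk(3)) (simp add: Tn_def h_def k_def)
    also have "\<dots> \<le> real (2 ^ n) * N (J (h + k) x - J h (J k x))"
      using xV hk by (intro funpow_diff_bound)
        (auto simp: J_diff J_commute intro: J_contraction order_trans[OF J_contraction])
    also have "\<dots> \<le> real (2 ^ n) * (h * k * N (A (A x)))"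
      using J_splitting[OF assms(1) hk(1,2)] by (intro mult_left_mono) auto
    also have "\<dots> = (1/2) ^ n * (s * t * N (A (A x)))"
      by (simp add: h_def k_def field_simps)
    finally show ?thesis .
  qed
  have "(\<lambda>n. (Tn n (s + t) x - T (s + t) x) - (Tn n s (T t x) - T s (T t x)) + (T (s + t) x - T s (T t x)))
      \<longlonglongrightarrow> 0 - 0 + (T (s + t) x - T s (T t x))"
    using assms xV by (intro tendsto_intros LIM_zero Tn_tendsto) auto
  then have lim: "(\<lambda>n. Tn n (s + t) x - Tn n s (T t x)) \<longlonglongrightarrow> T (s + t) x - T s (T t x)"
    by simp
  have "T (s + t) x - T s (T t x) = 0"
  proof (rule limit_eq_zero_if_N_le[OF lim])
    show "T (s + t) x - T s (T t x) \<in> V"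
      using xV assms by auto
    have "(\<lambda>n. N (Tn n t x - T t x)) \<longlonglongrightarrow> 0"
      using Tn_tendsto[OF xV assms(3)] by (intro norm_to_N) (simp add: LIM_zero tendsto_norm_zero)
    then show "(\<lambda>n. (1/2) ^ n * (s * t * N (A (A x))) + N (Tn n t x - T t x)) \<longlonglongrightarrow> 0"
      by (intro tendsto_add_zero tendsto_mult_left_zero LIMSEQ_power_zero) auto
    fix n
    have split: "Tn n (s + t) x - Tn n s (T t x)
        = (Tn n (s + t) x - Tn n s (Tn n t x)) + Tn n s (Tn n t x - T t x)"
      using xV assms by (simp add: Tn_diff)
    show "N (Tn n (s + t) x - Tn n s (T t x))
        \<le> (1/2) ^ n * (s * t * N (A (A x))) + N (Tn n t x - T t x)"
      unfolding split using est[of n] Tn_contraction[of "Tn n t x - T t x" n s] xV assms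
        N_add[of "Tn n (s + t) x - Tn n s (Tn n t x)" "Tn n s (Tn n t x - T t x)"] by auto
  qed
  then show ?thesis by simp
qed

lemma T_semigroup:
  assumes "x \<in> V" "0 \<le> s" "0 \<le> t"
  shows "T (s + t) x = T s (T t x)"
proof -
  have "T (s + t) x - T s (T t x) = 0"
  proof (rule eq_zero_if_N_le_zero)
    show "T (s + t) x - T s (T t x) \<in> V" using assms by auto
    show "N (T (s + t) x - T s (T t x)) \<le> 0"
    proof (rule field_le_epsilon)
      fix \<epsilon> :: real assume "0 < \<epsilon>"
      then obtain y where y: "y \<in> D2" "N (x - y) < \<epsilon> / 2"
        using D2_approx[OF assms(1), of "\<epsilon> / 2"] by auto
      have yV: "y \<in> V" using y by (auto simp: D2_def)
      have "T (s + t) x - T s (T t x) = T (s + t) (x - y) - T s (T t (x - y))"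
        using assms yV T_semigroup_D2[OF y(1) assms(2,3)] by (simp add: T_diff)
      moreover have "N (T (s + t) (x - y)) \<le> N (x - y)"
        using assms yV by (intro T_contraction) auto
      moreover have "N (T s (T t (x - y))) \<le> N (x - y)"
        using assms yV by (intro order_trans[OF T_contraction T_contraction]) auto
      ultimately show "N (T (s + t) x - T s (T t x)) \<le> 0 + \<epsilon>"
        using y N_add[of "T (s + t) (x - y)" "- T s (T t (x - y))"] N_scale[of "-1" "T s (T t (x - y))"]
        by simp
    qed
  qed
  then show ?thesis by simp
qed

section \<open>The generator of the limit semigroup\<close>

lemma funpow_J_near_identity:
  assumes "y \<in> D" "0 \<le> h"
  shows "N ((J h ^^ j) y - y) \<le> real j * h * N (A y)"
proof (induction j)
  case (Suc j)
  have "(J h ^^ Suc j) y - y = ((J h ^^ j) (J h y - y)) + ((J h ^^ j) y - y)"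
    using assms by (simp add: funpow_J_diff funpow_swap1)
  also have "N \<dots> \<le> h * N (A y) + real j * h * N (A y)"
    using J_near_identity[OF assms] funpow_J_contraction[of "J h y - y" j h] assms Suc
    by (intro order_trans[OF N_add] add_mono) auto
  finally show ?case by (simp add: algebra_simps)
qed simp

text \<open>Discrete counterpart of writing \<open>T t x - x\<close> as the integral of
  \<open>T s (A x)\<close> over \<open>0 \<le> s \<le> t\<close>.\<close>

lemma funpow_J_increment:
  assumes "x \<in> D" "0 \<le> h"
  shows "(J h ^^ n) x - x = h *\<^sub>R (\<Sum>j<n. (J h ^^ Suc j) (A x))"
proof (induction n)
  case (Suc n)
  have "J h x - x = J h x - J h (x - h *\<^sub>R A x)"
    using J_left_inverse[OF assms] by simp
  also have "\<dots> = h *\<^sub>R J h (A x)"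
    using assms A_V by (simp add: J_diff J_scale)
  finally have "(J h ^^ n) (J h x - x) = h *\<^sub>R (J h ^^ Suc n) (A x)"
    using assms A_V by (simp add: funpow_J_scale funpow_swap1)
  moreover have "(J h ^^ Suc n) x - x = (J h ^^ n) (J h x - x) + ((J h ^^ n) x - x)"
    using assms by (simp add: funpow_J_diff funpow_swap1)
  ultimately show ?case
    using Suc by (simp add: scaleR_right_distrib)
qed simp

text \<open>By \<open>funpow_J_increment\<close> the quotient for \<open>Tn n\<close> is the mean of
  the vectors \<open>(J h ^^ Suc j) (A x)\<close>. The distance from the identity is controlled only
  on \<open>D\<close>, where \<open>A x\<close> need not lie; hence the detour through
  \<open>y\<close>, which costs \<open>N (A x - y)\<close> twice. The bound is independent of
  \<open>n\<close>.\<close>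

lemma T_difference_quotient:
  assumes "x \<in> D" "y \<in> D" "0 < t"
  shows "N ((1 / t) *\<^sub>R (T t x - x) - A x) \<le> 2 * N (A x - y) + t * N (A y)"
proof (rule LIMSEQ_le_const2[OF N_tendsto])
  show "(\<lambda>n. (1 / t) *\<^sub>R (Tn n t x - x) - A x) \<longlonglongrightarrow> (1 / t) *\<^sub>R (T t x - x) - A x"
    using assms by (intro tendsto_intros Tn_tendsto) auto
  have "N ((1 / t) *\<^sub>R (Tn n t x - x) - A x) \<le> 2 * N (A x - y) + t * N (A y)" for n
  proof -
    define h m where "h = t / 2 ^ n" and "m = (2::nat) ^ n"
    have h: "0 < h" "h * m = t" and m: "0 < m" and t: "1 / t * h = 1 / m"
      using assms by (auto simp: h_def m_def)
    have N_sum: "N (\<Sum>j<k. f j) \<le> (\<Sum>j<k. N (f j))" for f and k :: nat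
      by (induction k) (auto intro: order_trans[OF N_add])
    have summand: "N ((J h ^^ Suc j) (A x) - A x) \<le> 2 * N (A x - y) + t * N (A y)" if "j < m" for j
    proof -
      have "(J h ^^ Suc j) (A x) - A x = (J h ^^ Suc j) (A x - y) + (((J h ^^ Suc j) y - y) + (y - A x))"
        using assms A_V by (simp only: funpow_J_diff D_in_V) (simp add: algebra_simps)
      also have "N \<dots> \<le> N (A x - y) + (real (Suc j) * h * N (A y) + N (A x - y))"
        using funpow_J_contraction[of "A x - y" "Suc j" h] funpow_J_near_identity[of y h "Suc j"]
          N_minus[of y "A x"] A_V assms h
        by (intro order_trans[OF N_add] add_mono) auto
      also have "real (Suc j) * h * N (A y) \<le> t * N (A y)"
      proof (rule mult_right_mono)
        have "real (Suc j) * h \<le> real m * h"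
          using that h by (intro mult_right_mono) auto
        then show "real (Suc j) * h \<le> t"
          using h by (simp add: mult.commute)
      qed (rule N_nonneg)
      finally show ?thesis by simp
    qed
    have "(1 / t) *\<^sub>R (Tn n t x - x) - A x
        = (1 / m) *\<^sub>R (\<Sum>j<m. (J h ^^ Suc j) (A x)) - (1 / m) *\<^sub>R (\<Sum>j<m. A x)"
      using funpow_J_increment[of x h m] assms(1) h m t
      by (simp add: Tn_def m_def[symmetric] h_def[symmetric] sum_constant_scaleR del: funpow.simps)
    also have "\<dots> = (1 / m) *\<^sub>R (\<Sum>j<m. (J h ^^ Suc j) (A x) - A x)"
      by (simp only: sum_subtractf scaleR_diff_right)
    also have "N \<dots> = 1 / m * N (\<Sum>j<m. (J h ^^ Suc j) (A x) - A x)"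
      by (simp only: N_scale) simp
    also have "\<dots> \<le> 1 / m * (\<Sum>j<m. N ((J h ^^ Suc j) (A x) - A x))"
      by (intro mult_left_mono N_sum) auto
    also have "\<dots> \<le> 1 / m * (\<Sum>j<m. 2 * N (A x - y) + t * N (A y))"
      using summand by (intro mult_left_mono sum_mono) auto
    also have "\<dots> = 2 * N (A x - y) + t * N (A y)"
      using m by simp
    finally show ?thesis .
  qed
  then show "\<exists>k. \<forall>n\<ge>k. N ((1 / t) *\<^sub>R (Tn n t x - x) - A x) \<le> 2 * N (A x - y) + t * N (A y)"
    by auto
qed

lemma N_tendsto_zero_iff:
  assumes "\<And>h. 0 < h \<Longrightarrow> f h \<in> V"
  shows "((\<lambda>h. norm (f h)) \<longlongrightarrow> 0) (at_right (0::real)) \<longleftrightarrow> ((\<lambda>h. N (f h)) \<longlongrightarrow> 0) (at_right 0)"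
proof
  assume *: "((\<lambda>h. norm (f h)) \<longlongrightarrow> 0) (at_right 0)"
  show "((\<lambda>h. N (f h)) \<longlongrightarrow> 0) (at_right 0)"
    by (rule tendsto_sandwich[of "\<lambda>_. 0" _ _ "\<lambda>h. C * norm (f h)"])
      (auto simp: N_nonneg N_upper intro: tendsto_mult_right_zero *)
next
  assume *: "((\<lambda>h. N (f h)) \<longlongrightarrow> 0) (at_right 0)"
  show "((\<lambda>h. norm (f h)) \<longlongrightarrow> 0) (at_right 0)"
    by (rule tendsto_sandwich[of "\<lambda>_. 0" _ _ "\<lambda>h. c * N (f h)"])
      (auto simp: eventually_at_right_less intro!: tendsto_mult_right_zero * eventually_at_rightI[of 0 1] N_lower assms)
qed

lemma A_difference_quotient:
  assumes "x \<in> D"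
  shows "((\<lambda>h. N ((1 / h) *\<^sub>R (T h x - x) - A x)) \<longlongrightarrow> 0) (at_right 0)"
proof (rule tendstoI)
  fix e :: real assume e: "0 < e"
  obtain y where y: "y \<in> D2" "N (A x - y) < e / 4"
    using D2_approx[OF A_V[OF assms], of "e / 4"] e by auto
  have yD: "y \<in> D" using y by (auto simp: D2_def)
  define d where "d = e / (2 * (N (A y) + 1))"
  have d: "0 < d" using e N_nonneg[of "A y"] by (simp add: d_def)
  show "\<forall>\<^sub>F h in at_right 0. dist (N ((1 / h) *\<^sub>R (T h x - x) - A x)) 0 < e"
  proof (rule eventually_at_rightI[OF _ d])
    fix h assume h: "h \<in> {0<..<d}"
    have "h * N (A y) \<le> d * N (A y)"
      using h N_nonneg by (intro mult_right_mono) auto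
    also have "\<dots> \<le> e / 2"
      using e N_nonneg[of "A y"] by (simp add: d_def field_simps)
    finally show "dist (N ((1 / h) *\<^sub>R (T h x - x) - A x)) 0 < e"
      using T_difference_quotient[OF assms yD, of h] h y N_nonneg[of "(1 / h) *\<^sub>R (T h x - x) - A x"] by simp
  qed
qed

lemma T_strongly_continuous:
  assumes "x \<in> V"
  shows "((\<lambda>h. N (T h x - x)) \<longlongrightarrow> 0) (at_right 0)"
proof (rule tendstoI)
  fix e :: real assume e: "0 < e"
  obtain y where y: "y \<in> D2" "N (x - y) < e / 4"
    using D2_approx[OF assms, of "e / 4"] e by auto
  have yD: "y \<in> D" and yV: "y \<in> V" using y by (auto simp: D2_def)
  have "((\<lambda>h. h * N ((1 / h) *\<^sub>R (T h y - y) - A y) + h * N (A y)) \<longlongrightarrow> 0 * 0 + 0 * N (A y)) (at_right 0)"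
    by (intro tendsto_intros A_difference_quotient[OF yD] tendsto_ident_at)
  then have "\<forall>\<^sub>F h in at_right 0. h * N ((1 / h) *\<^sub>R (T h y - y) - A y) + h * N (A y) < e / 2"
    using e by (intro order_tendstoD) auto
  moreover have "\<forall>\<^sub>F h::real in at_right 0. 0 < h"
    by (simp add: eventually_at_right_less)
  ultimately show "\<forall>\<^sub>F h in at_right 0. dist (N (T h x - x)) 0 < e"
  proof eventually_elim
    case (elim h)
    have "T h y - y = h *\<^sub>R ((1 / h) *\<^sub>R (T h y - y) - A y) + h *\<^sub>R A y"
      using elim by (simp add: scaleR_diff_right)
    then have "N (T h y - y) < e / 2"
      using elim N_add[of "h *\<^sub>R ((1 / h) *\<^sub>R (T h y - y) - A y)" "h *\<^sub>R A y"] N_scale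
      by simp
    moreover have "T h x - x = T h (x - y) + ((T h y - y) + (y - x))"
      using elim assms yV by (simp add: T_diff)
    then have "N (T h x - x) \<le> N (T h (x - y)) + (N (T h y - y) + N (y - x))"
      by (metis N_add add_left_mono order_trans)
    moreover have "N (T h (x - y)) \<le> N (x - y)"
      using assms yV elim by (intro T_contraction) auto
    ultimately show ?case
      using y N_minus[of y x] N_nonneg[of "T h x - x"] by simp
  qed
qed

text \<open>\<open>I - A\<close> is onto and \<open>I\<close> minus the generator is injective, so the generator cannot be a proper
  extension of \<open>A\<close>.\<close>

lemma generator_domain:
  assumes x: "x \<in> V" and y: "y \<in> V"
    and lim: "((\<lambda>h. N ((1 / h) *\<^sub>R (T h x - x) - y)) \<longlongrightarrow> 0) (at_right 0)"
  shows "x \<in> D" "A x = y"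
proof -
  have xy: "x - y \<in> V" using x y by auto
  from J_inverse[OF xy, of 1] have z: "J 1 (x - y) \<in> D" "J 1 (x - y) - A (J 1 (x - y)) = x - y"
    by auto
  \<comment> \<open>\<open>w\<close> would be an eigenvector of the generator for the eigenvalue 1,
    since its difference quotients converge to \<open>w\<close> itself. A contraction semigroup
    leaves room only for \<open>w = 0\<close>.\<close>
  define w where "w = x - J 1 (x - y)"
  have w: "w \<in> V" using x z by (auto simp: w_def)
  have w_eq: "w = y - A (J 1 (x - y))"
    unfolding w_def using z by (simp add: algebra_simps)
  have "((\<lambda>h. N ((1 / h) *\<^sub>R (T h x - x) - y) + N ((1 / h) *\<^sub>R (T h (J 1 (x - y)) - J 1 (x - y)) - A (J 1 (x - y))))
      \<longlongrightarrow> 0 + 0) (at_right 0)"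
    by (intro tendsto_add lim A_difference_quotient z)
  moreover have "\<forall>\<^sub>F h in at_right 0. N w \<le> N ((1 / h) *\<^sub>R (T h x - x) - y) + N ((1 / h) *\<^sub>R (T h (J 1 (x - y)) - J 1 (x - y)) - A (J 1 (x - y)))"
    using eventually_at_right_less[of "0::real"]
  proof eventually_elim
    case (elim h)
    define a b where "a = (1 / h) *\<^sub>R (T h x - x) - y"
      and "b = (1 / h) *\<^sub>R (T h (J 1 (x - y)) - J 1 (x - y)) - A (J 1 (x - y))"
    have "a - b = (1 / h) *\<^sub>R (T h w - w) - w"
      using elim x z unfolding a_def b_def w_eq[symmetric]
      by (simp add: w_def T_diff w_eq[symmetric] scaleR_diff_right) (simp add: w_eq[unfolded w_def] algebra_simps)
    then have "h *\<^sub>R (a - b) = h *\<^sub>R ((1 / h) *\<^sub>R (T h w - w) - w)"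
      by simp
    also have "\<dots> = T h w - (1 + h) *\<^sub>R w"
      using elim by (simp add: algebra_simps)
    finally have "h *\<^sub>R (a - b) = T h w - (1 + h) *\<^sub>R w" .
    then have "(1 + h) *\<^sub>R w = T h w - h *\<^sub>R (a - b)"
      by (simp add: algebra_simps)
    then have "(1 + h) * N w \<le> N (T h w) + h * N (a - b)"
      using elim N_scale[of "1 + h" w] N_add[of "T h w" "- (h *\<^sub>R (a - b))"] N_scale[of "- h" "a - b"]
      by simp
    moreover have "N (T h w) \<le> N w"
      using elim w by (intro T_contraction) auto
    ultimately have "h * N w \<le> h * N (a - b)"
      by (simp add: algebra_simps)
    then have "N w \<le> N (a - b)"
      using elim by simp
    also have "\<dots> \<le> N a + N b"
      using N_add[of a "- b"] N_scale[of "-1" b] by simp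
    finally show ?case by (simp add: a_def b_def)
  qed
  ultimately have "N w \<le> 0"
    by (intro tendsto_lowerbound[where F = "at_right (0::real)"]) auto
  then have "w = 0"
    using w by (rule_tac eq_zero_if_N_le_zero)
  then show "x \<in> D" "A x = y"
    using z w_eq w_def by auto
qed

end

section \<open>Stability of families that are quasi-contractive in a common norm\<close>

text \<open>Product rule at 0 for one-sided limits. It is applied with \<open>w\<close> to pass from
  \<open>T\<close> to the shifted semigroup, and with \<open>- w\<close> to come back.\<close>

lemma exp_rescaled_difference_quotient:
  fixes f :: "real \<Rightarrow> 'a::real_normed_vector"
  assumes "((\<lambda>h. (1 / h) *\<^sub>R (f h - x)) \<longlongrightarrow> z) (at_right 0)"
  shows "((\<lambda>h. (1 / h) *\<^sub>R (exp (w * h) *\<^sub>R f h - x)) \<longlongrightarrow> z + w *\<^sub>R x) (at_right 0)"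
proof -
  have "((\<lambda>h. exp (w * h)) has_real_derivative w) (at 0)"
    by (auto intro!: derivative_eq_intros)
  then have "((\<lambda>h. (exp (w * h) - 1) / h) \<longlongrightarrow> w) (at 0)"
    by (simp add: DERIV_def)
  then have d: "((\<lambda>h. (exp (w * h) - 1) / h) \<longlongrightarrow> w) (at_right 0)"
    by (rule tendsto_mono[rotated]) (simp add: at_le)
  have "((\<lambda>h. exp (w * h)) \<longlongrightarrow> exp (w * 0)) (at_right 0)"
    by (intro tendsto_intros)
  then have e: "((\<lambda>h. exp (w * h)) \<longlongrightarrow> 1) (at_right 0)"
    by simp
  have "((\<lambda>h. exp (w * h) *\<^sub>R ((1 / h) *\<^sub>R (f h - x)) + ((exp (w * h) - 1) / h) *\<^sub>R x) \<longlongrightarrow> 1 *\<^sub>R z + w *\<^sub>R x) (at_right 0)"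
    by (intro tendsto_intros assms d e)
  moreover have "exp (w * h) *\<^sub>R ((1 / h) *\<^sub>R (f h - x)) + ((exp (w * h) - 1) / h) *\<^sub>R x
      = (1 / h) *\<^sub>R (exp (w * h) *\<^sub>R f h - x)" for h
    by (simp add: algebra_simps diff_divide_distrib)
  ultimately show ?thesis by simp
qed

context m_dissipative
begin

text \<open>Of \<open>N'\<close> only the two-sided comparison with \<open>N\<close> is available,
  no triangle inequality. Limits in \<open>N'\<close> are therefore first translated into
  convergence in the topology of the type, where the rules for sums and products apply.\<close>

lemma T_shift_semigroup_and_generator:
  assumes N'_upper: "\<And>x. x \<in> V \<Longrightarrow> N' x \<le> k1 * N x" and N'_lower: "\<And>x. x \<in> V \<Longrightarrow> N x \<le> k2 * N' x"
    and k: "0 < k1" "0 < k2"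
    and B: "fst B = D" "\<And>x. x \<in> D \<Longrightarrow> snd B x = A x + w *\<^sub>R x"
  shows "C0_semigroup V N' (\<lambda>t x. exp (w * t) *\<^sub>R T t x)" (is "C0_semigroup V N' ?S")
    and "generates V N' B (\<lambda>t x. exp (w * t) *\<^sub>R T t x)"
proof -
  have N_equiv: "((\<lambda>h. N (f h - y)) \<longlongrightarrow> 0) (at_right 0) \<longleftrightarrow> (f \<longlongrightarrow> y) (at_right 0)"
    if "\<And>h::real. 0 < h \<Longrightarrow> f h \<in> V" "y \<in> V" for f y
    using N_tendsto_zero_iff[of "\<lambda>h. f h - y"] that by (simp add: tendsto_norm_zero_iff LIM_zero_iff)
  have equiv: "((\<lambda>h. N' (f h - y)) \<longlongrightarrow> 0) (at_right 0) \<longleftrightarrow> (f \<longlongrightarrow> y) (at_right 0)"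
    if f: "\<And>h::real. 0 < h \<Longrightarrow> f h \<in> V" and y: "y \<in> V" for f y
  proof -
    have ev: "\<forall>\<^sub>F h in at_right (0::real). f h - y \<in> V"
      using f y eventually_at_right_less[of "0::real"] by (auto elim!: eventually_mono)
    have N'_nonneg: "0 \<le> N' x" if "x \<in> V" for x
      using N'_lower[OF that] k N_nonneg[of x] zero_le_mult_iff[of k2 "N' x"] by linarith
    have "((\<lambda>h. N' (f h - y)) \<longlongrightarrow> 0) (at_right 0) \<longleftrightarrow> ((\<lambda>h. N (f h - y)) \<longlongrightarrow> 0) (at_right 0)"
    proof
      assume *: "((\<lambda>h. N' (f h - y)) \<longlongrightarrow> 0) (at_right 0)"
      show "((\<lambda>h. N (f h - y)) \<longlongrightarrow> 0) (at_right 0)"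
      proof (rule tendsto_sandwich[of "\<lambda>_. 0" _ _ "\<lambda>h. k2 * N' (f h - y)"])
        show "\<forall>\<^sub>F h in at_right 0. N (f h - y) \<le> k2 * N' (f h - y)"
          using ev by eventually_elim (rule N'_lower)
      qed (auto intro: tendsto_mult_right_zero * simp: N_nonneg)
    next
      assume *: "((\<lambda>h. N (f h - y)) \<longlongrightarrow> 0) (at_right 0)"
      show "((\<lambda>h. N' (f h - y)) \<longlongrightarrow> 0) (at_right 0)"
      proof (rule tendsto_sandwich[of "\<lambda>_. 0" _ _ "\<lambda>h. k1 * N (f h - y)"])
        show "\<forall>\<^sub>F h in at_right 0. N' (f h - y) \<le> k1 * N (f h - y)"
          using ev by eventually_elim (rule N'_upper)
        show "\<forall>\<^sub>F h in at_right 0. 0 \<le> N' (f h - y)"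
          using ev by eventually_elim (rule N'_nonneg)
      qed (auto intro: tendsto_mult_right_zero *)
    qed
    then show ?thesis
      using N_equiv f y by simp
  qed
  have S_V: "?S t x \<in> V" if "0 \<le> t" "x \<in> V" for t x
    using that by auto
  show "C0_semigroup V N' ?S"
    unfolding C0_semigroup_def
  proof (intro conjI allI impI ballI)
    fix t :: real assume t: "0 \<le> t"
    show "bounded_linear_op V N' (?S t)"
      unfolding bounded_linear_op_def
    proof (intro conjI ballI allI)
      show "\<exists>K. \<forall>x\<in>V. N' (?S t x) \<le> K * N' x"
      proof (intro exI ballI)
        fix x assume x: "x \<in> V"
        have "N' (?S t x) \<le> k1 * (exp (w * t) * N (T t x))"
          using N'_upper[OF S_V[OF t x]] by (simp add: N_scale)
        also have "\<dots> \<le> k1 * (exp (w * t) * (k2 * N' x))"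
          using order_trans[OF T_contraction[OF x t] N'_lower[OF x]] k
          by (intro mult_left_mono) auto
        finally show "N' (?S t x) \<le> (k1 * exp (w * t) * k2) * N' x"
          by (simp add: mult.assoc)
      qed
    qed (use t in \<open>auto simp: T_add T_scale scaleR_right_distrib mult.commute\<close>)
  next
    fix x assume "x \<in> V" then show "?S 0 x = x" by (simp add: T_zero)
  next
    fix s t :: real and x assume "0 \<le> s" "0 \<le> t" "x \<in> V"
    then show "?S (s + t) x = ?S s (?S t x)"
      by (simp add: T_semigroup T_scale exp_add[symmetric] algebra_simps)
  next
    fix x assume x: "x \<in> V"
    have "((\<lambda>h. T h x) \<longlongrightarrow> x) (at_right 0)"
      using T_strongly_continuous[OF x] N_equiv[of "\<lambda>h. T h x" x] x by simp
    then have "((\<lambda>h. exp (w * h) *\<^sub>R T h x) \<longlongrightarrow> exp (w * 0) *\<^sub>R x) (at_right 0)"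
      by (intro tendsto_intros)
    then show "((\<lambda>t. N' (?S t x - x)) \<longlongrightarrow> 0) (at_right 0)"
      using equiv[of "\<lambda>h. ?S h x" x] x by simp
  qed
  have lim_S: "((\<lambda>h. N' ((1 / h) *\<^sub>R (?S h x - x) - y)) \<longlongrightarrow> 0) (at_right 0)
      \<longleftrightarrow> ((\<lambda>h. (1 / h) *\<^sub>R (?S h x - x)) \<longlongrightarrow> y) (at_right 0)" if "x \<in> V" "y \<in> V" for x y
    using that by (intro equiv) auto
  have lim_T: "((\<lambda>h. N ((1 / h) *\<^sub>R (T h x - x) - y)) \<longlongrightarrow> 0) (at_right 0)
      \<longleftrightarrow> ((\<lambda>h. (1 / h) *\<^sub>R (T h x - x)) \<longlongrightarrow> y) (at_right 0)" if "x \<in> V" "y \<in> V" for x y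
    using that by (intro N_equiv) auto
  have "x \<in> D" if x: "x \<in> V" and y: "y \<in> V"
    and l: "((\<lambda>h. N' ((1 / h) *\<^sub>R (?S h x - x) - y)) \<longlongrightarrow> 0) (at_right 0)" for x y
  proof -
    have "((\<lambda>h. (1 / h) *\<^sub>R (exp (- w * h) *\<^sub>R ?S h x - x)) \<longlongrightarrow> y + (- w) *\<^sub>R x) (at_right 0)"
      using l lim_S[OF x y] by (intro exp_rescaled_difference_quotient) simp
    then have "((\<lambda>h. (1 / h) *\<^sub>R (T h x - x)) \<longlongrightarrow> y + (- w) *\<^sub>R x) (at_right 0)"
      by (simp add: exp_minus)
    moreover have "y + (- w) *\<^sub>R x \<in> V"
      using x y by (intro V_intros)
    ultimately show "x \<in> D"
      using generator_domain(1)[of x "y + (- w) *\<^sub>R x"] lim_T x by blast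
  qed
  moreover have "((\<lambda>h. N' ((1 / h) *\<^sub>R (?S h x - x) - snd B x)) \<longlongrightarrow> 0) (at_right 0)" if x: "x \<in> D" for x
  proof -
    have "((\<lambda>h. (1 / h) *\<^sub>R (T h x - x)) \<longlongrightarrow> A x) (at_right 0)"
      using A_difference_quotient[OF x] lim_T[of x "A x"] x A_V by auto
    then have "((\<lambda>h. (1 / h) *\<^sub>R (?S h x - x)) \<longlongrightarrow> snd B x) (at_right 0)"
      unfolding B(2)[OF x] by (rule exp_rescaled_difference_quotient)
    then show ?thesis
      using lim_S[of x "snd B x"] x B(2)[OF x] A_V by auto
  qed
  moreover have "snd B x \<in> V" if "x \<in> D" for x
    using that B A_V by auto
  ultimately show "generates V N' B ?S"
    unfolding generates_def Let_def B(1) by blast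
qed

text \<open>With \<open>h = 1 / (\<mu> - w)\<close> one has
  \<open>\<mu> I - B = (1 / h) (I - h A)\<close>, so the resolvent of \<open>B\<close> is
  \<open>h J h\<close>.\<close>

lemma resolvent_shifted:
  assumes B: "fst B = D" "\<And>x. x \<in> D \<Longrightarrow> snd B x = A x + w *\<^sub>R x" and \<mu>: "w < \<mu>"
  shows "bij_betw (\<lambda>x. \<mu> *\<^sub>R x - snd B x) (fst B) V"
    and "\<And>y. y \<in> V \<Longrightarrow> resolvent B \<mu> y = J (1 / (\<mu> - w)) ((1 / (\<mu> - w)) *\<^sub>R y)"
    and "\<And>y. y \<in> V \<Longrightarrow> N (resolvent B \<mu> y) \<le> N y / (\<mu> - w)"
proof -
  define h where "h = 1 / (\<mu> - w)"
  have h: "0 < h" using \<mu> by (simp add: h_def)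
  have \<mu>h: "\<mu> = w + 1 / h" using \<mu> by (simp add: h_def)
  have eq: "\<mu> *\<^sub>R x - snd B x = (1 / h) *\<^sub>R (x - h *\<^sub>R A x)" if "x \<in> D" for x
    using that h by (simp add: B \<mu>h algebra_simps)
  have inj: "inj_on (\<lambda>x. \<mu> *\<^sub>R x - snd B x) D"
  proof (rule inj_onI)
    fix x y assume xy: "x \<in> D" "y \<in> D" "\<mu> *\<^sub>R x - snd B x = \<mu> *\<^sub>R y - snd B y"
    then have "x - h *\<^sub>R A x = y - h *\<^sub>R A y"
      using h by (simp only: eq) simp
    then show "x = y"
      using D_unique[OF xy(1,2) h] by blast
  qed
  have sol: "J h (h *\<^sub>R y) \<in> D" "\<mu> *\<^sub>R J h (h *\<^sub>R y) - snd B (J h (h *\<^sub>R y)) = y" if "y \<in> V" for y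
    using J_inverse[of "h *\<^sub>R y" h] that h eq[of "J h (h *\<^sub>R y)"] by auto
  have "(\<lambda>x. \<mu> *\<^sub>R x - snd B x) ` D = V"
  proof (intro equalityI subsetI)
    fix y assume y: "y \<in> V"
    show "y \<in> (\<lambda>x. \<mu> *\<^sub>R x - snd B x) ` D"
      by (rule image_eqI[where x = "J h (h *\<^sub>R y)"]) (simp_all only: sol[OF y])
  qed (auto simp: eq A_V)
  with inj show "bij_betw (\<lambda>x. \<mu> *\<^sub>R x - snd B x) (fst B) V"
    by (simp add: bij_betw_def B)
  show res: "resolvent B \<mu> y = J (1 / (\<mu> - w)) ((1 / (\<mu> - w)) *\<^sub>R y)" if "y \<in> V" for y
    unfolding resolvent_def B(1) h_def[symmetric]
    using inv_into_f_f[OF inj sol(1)[OF that]] sol(2)[OF that] by simp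
  show "N (resolvent B \<mu> y) \<le> N y / (\<mu> - w)" if "y \<in> V" for y
    using res[OF that] J_contraction[of "h *\<^sub>R y" h] that h
    by (simp add: h_def[symmetric] N_scale) (simp add: h_def)
qed

end

text \<open>Since one \<open>N\<close> serves all \<open>t\<close>, each factor contributes
  \<open>1 / (\<mu> - w)\<close> without a constant. The change of norm is paid only at the two ends
  of the product, whatever its length.\<close>

lemma stable_familyI:
  fixes V :: "'a::banach set" and A :: "real \<Rightarrow> 'a unbounded_op"
  assumes A: "\<And>t. t \<in> {0..\<tau>} \<Longrightarrow> m_dissipative V (fst (A t)) (\<lambda>x. snd (A t) x - w *\<^sub>R x) N c C"
    and N'_upper: "\<And>x. x \<in> V \<Longrightarrow> N' x \<le> c1 * norm x" and N'_lower: "\<And>x. x \<in> V \<Longrightarrow> norm x \<le> c2 * N' x"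
    and c12: "0 < c1" "0 < c2" and \<tau>: "0 < \<tau>"
  shows "stable_family V N' \<tau> A"
proof -
  interpret A0: m_dissipative V "fst (A 0)" "\<lambda>x. snd (A 0) x - w *\<^sub>R x" N c C
    using A[of 0] \<tau> by simp
  define k1 k2 where "k1 = c1 * c" and "k2 = C * c2"
  have k: "0 < k1" "0 < k2"
    using c12 A0.c_pos A0.C_pos by (auto simp: k1_def k2_def)
  have upper: "N' x \<le> k1 * N x" and lower: "N x \<le> k2 * N' x" if x: "x \<in> V" for x
  proof -
    have "c1 * norm x \<le> c1 * (c * N x)" "C * norm x \<le> C * (c2 * N' x)"
      using A0.N_lower[OF x] N'_lower[OF x] c12 A0.C_pos by (auto intro!: mult_left_mono)
    then show "N' x \<le> k1 * N x" "N x \<le> k2 * N' x"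
      using N'_upper[OF x] A0.N_upper[of x] by (auto simp: k1_def k2_def mult.assoc)
  qed
  have N'_nonneg: "0 \<le> N' x" if "x \<in> V" for x
    using lower[OF that] k A0.N_nonneg[of x] zero_le_mult_iff[of k2 "N' x"] by linarith
  have resolvent_V: "resolvent (A t) \<mu> y \<in> V"
    and resolvent_N: "N (resolvent (A t) \<mu> y) \<le> N y / (\<mu> - w)"
    and resolvent_set: "\<mu> \<in> resolvent_set V N' (A t)"
    if t: "t \<in> {0..\<tau>}" and \<mu>: "w < \<mu>" and y: "y \<in> V" for t \<mu> y
  proof -
    interpret m_dissipative V "fst (A t)" "\<lambda>x. snd (A t) x - w *\<^sub>R x" N c C
      using A[OF t] .
    have res: "bij_betw (\<lambda>x. \<mu> *\<^sub>R x - snd (A t) x) (fst (A t)) V"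
      "\<And>y. y \<in> V \<Longrightarrow> resolvent (A t) \<mu> y = J (1 / (\<mu> - w)) ((1 / (\<mu> - w)) *\<^sub>R y)"
      "\<And>y. y \<in> V \<Longrightarrow> N (resolvent (A t) \<mu> y) \<le> N y / (\<mu> - w)"
      using resolvent_shifted[of "A t" w \<mu>] \<mu> by auto
    show "resolvent (A t) \<mu> y \<in> V" using res(2) y by auto
    show "N (resolvent (A t) \<mu> y) \<le> N y / (\<mu> - w)" using res(3) y by auto
    show "\<mu> \<in> resolvent_set V N' (A t)"
      unfolding resolvent_set_def bounded_linear_op_def mem_Collect_eq
    proof (intro conjI ballI allI res(1))
      show "\<exists>K. \<forall>x\<in>V. N' (resolvent (A t) \<mu> x) \<le> K * N' x"
      proof (intro exI ballI)
        fix x assume x: "x \<in> V"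
        have "N' (resolvent (A t) \<mu> x) \<le> k1 * N (resolvent (A t) \<mu> x)"
          using x res(2) by (intro upper) auto
        also have "\<dots> \<le> k1 * (N x / (\<mu> - w))"
          using res(3)[OF x] k by (intro mult_left_mono) auto
        also have "\<dots> \<le> k1 * ((k2 * N' x) / (\<mu> - w))"
          using lower[OF x] k \<mu> by (intro mult_left_mono divide_right_mono) auto
        finally show "N' (resolvent (A t) \<mu> x) \<le> (k1 * k2 / (\<mu> - w)) * N' x"
          by (simp add: mult.assoc)
      qed
    next
      fix r x assume "x \<in> V"
      then show "resolvent (A t) \<mu> (r *\<^sub>R x) = r *\<^sub>R resolvent (A t) \<mu> x"
        by (simp add: res(2) J_scale[symmetric] mult.commute del: scaleR_scaleR)
          (simp add: mult.commute)
    qed (auto simp: res(2) J_add scaleR_right_distrib)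
  qed
  have prod: "resolvent_prod A \<mu> ts y \<in> V \<and> N (resolvent_prod A \<mu> ts y) \<le> N y / (\<mu> - w) ^ length ts"
    if "set ts \<subseteq> {0..\<tau>}" "w < \<mu>" "y \<in> V" for ts \<mu> y
    using that(1)
  proof (induction ts rule: rev_induct)
    case (snoc t ts)
    let ?z = "resolvent_prod A \<mu> ts y"
    have z: "?z \<in> V" "N ?z \<le> N y / (\<mu> - w) ^ length ts" using snoc by auto
    have "N (resolvent (A t) \<mu> ?z) \<le> N ?z / (\<mu> - w)"
      using resolvent_N[of t \<mu> ?z] snoc.prems that z by auto
    also have "\<dots> \<le> (N y / (\<mu> - w) ^ length ts) / (\<mu> - w)"
      using z that by (intro divide_right_mono) auto
    finally show ?case
      using resolvent_V[of t \<mu> ?z] snoc.prems that z by (simp add: resolvent_prod_def mult.commute)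
  qed (use that in \<open>auto simp: resolvent_prod_def\<close>)
  \<comment> \<open>\<open>k1 * k2\<close> is the cost of changing from \<open>N'\<close> to
    \<open>N\<close> and back; the maximum with 1 meets the requirement
    \<open>M \<ge> 1\<close>.\<close>
  define K where "K = max 1 (k1 * k2)"
  have op_norm: "op_norm V N' (resolvent_prod A \<mu> ts) \<le> K / (\<mu> - w) ^ length ts"
    if ts: "set ts \<subseteq> {0..\<tau>}" and \<mu>: "w < \<mu>" for ts \<mu>
    unfolding op_norm_def
  proof (rule cSUP_least)
    show "V \<noteq> {}" using A0.V_intros(1) by blast
    fix x assume x: "x \<in> V"
    let ?z = "resolvent_prod A \<mu> ts x"
    have z: "?z \<in> V" "N ?z \<le> N x / (\<mu> - w) ^ length ts" using prod[OF ts \<mu> x] by auto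
    have pos: "0 < (\<mu> - w) ^ length ts" using \<mu> by simp
    have "N' ?z \<le> k1 * N ?z"
      by (rule upper[OF z(1)])
    also have "\<dots> \<le> k1 * (N x / (\<mu> - w) ^ length ts)"
      using z(2) k by (intro mult_left_mono) auto
    also have "\<dots> \<le> k1 * ((k2 * N' x) / (\<mu> - w) ^ length ts)"
      using lower[OF x] k pos by (intro mult_left_mono divide_right_mono) auto
    also have "\<dots> = (k1 * k2) * (N' x / (\<mu> - w) ^ length ts)"
      by simp
    also have "\<dots> \<le> K * (N' x / (\<mu> - w) ^ length ts)"
      using N'_nonneg[OF x] pos by (intro mult_right_mono) (auto simp: K_def)
    finally have le: "N' ?z \<le> K / (\<mu> - w) ^ length ts * N' x" by simp
    show "N' ?z / N' x \<le> K / (\<mu> - w) ^ length ts"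
    \<comment> \<open>The supremum in \<open>op_norm\<close> also ranges over \<open>x = 0\<close>,
      where division by zero yields the quotient 0.\<close>
    proof (cases "N' x = 0")
      case True
      then show ?thesis using pos by (simp add: K_def)
    next
      case False
      then have "0 < N' x" using N'_nonneg[OF x] by simp
      then show ?thesis using le by (simp add: pos_divide_le_eq)
    qed
  qed
  show ?thesis
    unfolding stable_family_def
  proof (intro conjI ballI)
    fix t assume t: "t \<in> {0..\<tau>}"
    interpret m_dissipative V "fst (A t)" "\<lambda>x. snd (A t) x - w *\<^sub>R x" N c C
      using A[OF t] .
    have "C0_semigroup V N' (\<lambda>t x. exp (w * t) *\<^sub>R T t x)" "generates V N' (A t) (\<lambda>t x. exp (w * t) *\<^sub>R T t x)"
      using T_shift_semigroup_and_generator[OF upper lower k, of "A t" w] by auto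
    then show "\<exists>T. C0_semigroup V N' T \<and> generates V N' (A t) T" by blast
  next
    have "{w<..} \<subseteq> resolvent_set V N' (A t)" if "t \<in> {0..\<tau>}" for t
      using resolvent_set[OF that] A0.V_intros(1) by auto
    moreover have "1 \<le> K" by (simp add: K_def)
    ultimately show "\<exists>M \<omega>. M \<ge> 1 \<and> (\<forall>t\<in>{0..\<tau>}. {\<omega><..} \<subseteq> resolvent_set V N' (A t)) \<and>
        (\<forall>ts. sorted ts \<and> set ts \<subseteq> {0..\<tau>} \<longrightarrow>
          (\<forall>\<mu>>\<omega>. op_norm V N' (resolvent_prod A \<mu> ts) \<le> M / (\<mu> - \<omega>) ^ length ts))"
      using op_norm by (intro exI[of _ K] exI[of _ w]) blast
  qed
qed

section \<open>Monotone operators in Hilbert spaces\<close>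

text \<open>A minimizing sequence for the distance to \<open>C\<close> is Cauchy by the
  parallelogram identity, because midpoints of its members are no closer to \<open>x\<close> than
  the infimum. Orthogonality is the first-order condition at the minimizer.\<close>

lemma closed_subspace_orthogonal_projection:
  fixes C :: "'a::{real_inner,complete_space} set"
  assumes C: "subspace C" "closed C"
  obtains p where "p \<in> C" "\<And>c. c \<in> C \<Longrightarrow> inner (x - p) c = 0"
proof -
  define d where "d = infdist x C"
  have C0: "C \<noteq> {}" using subspace_0[OF C(1)] by auto
  have d0: "0 \<le> d" by (simp add: d_def infdist_nonneg)
  have d_le: "d\<^sup>2 \<le> (norm (x - c))\<^sup>2" if "c \<in> C" for c
    using infdist_le[OF that, of x] d0 by (intro power_mono) (auto simp: d_def dist_norm)
  have "\<exists>c\<in>C. (norm (x - c))\<^sup>2 < d\<^sup>2 + 1 / real (Suc n)" for n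
  proof -
    have "d < sqrt (d\<^sup>2 + 1 / real (Suc n))"
      using d0 by (intro real_less_rsqrt) (auto simp: power2_eq_square)
    then obtain c where c: "c \<in> C" "dist x c < sqrt (d\<^sup>2 + 1 / real (Suc n))"
      using C0 cInf_lessD[of "dist x ` C"] by (auto simp: d_def infdist_def)
    then have "(norm (x - c))\<^sup>2 < (sqrt (d\<^sup>2 + 1 / real (Suc n)))\<^sup>2"
      by (intro power_strict_mono) (auto simp: dist_norm)
    with c show ?thesis by (auto intro!: bexI[of _ c])
  qed
  then obtain s where s: "\<And>n. s n \<in> C" "\<And>n. (norm (x - s n))\<^sup>2 < d\<^sup>2 + 1 / real (Suc n)"
    by metis
  have step: "(norm (s m - s n))\<^sup>2 \<le> 4 / real (Suc k)" if "k \<le> m" "k \<le> n" for k m n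
  proof -
    have "(1/2) *\<^sub>R (s m + s n) \<in> C"
      using s C by (intro subspace_scale subspace_add) auto
    then have mid: "4 * d\<^sup>2 \<le> 4 * (norm (x - (1/2) *\<^sub>R (s m + s n)))\<^sup>2"
      using d_le by simp
    have par: "(norm (s m - s n))\<^sup>2 + 4 * (norm (x - (1/2) *\<^sub>R (s m + s n)))\<^sup>2
        = 2 * (norm (x - s m))\<^sup>2 + 2 * (norm (x - s n))\<^sup>2"
      by (simp add: power2_norm_eq_inner inner_diff_left inner_diff_right inner_add_left inner_add_right
          inner_commute algebra_simps)
    have "1 / real (Suc m) \<le> 1 / real (Suc k)" "1 / real (Suc n) \<le> 1 / real (Suc k)"
      using that by (auto intro!: divide_left_mono)
    then show ?thesis
      using mid par s(2)[of m] s(2)[of n] by simp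
  qed
  have "Cauchy s"
  proof (rule metric_CauchyI)
    fix e :: real assume e: "0 < e"
    obtain k where k: "4 / real (Suc k) < e\<^sup>2"
      using reals_Archimedean[of "e\<^sup>2 / 4"] e by (auto simp: field_simps)
    show "\<exists>M. \<forall>m\<ge>M. \<forall>n\<ge>M. dist (s m) (s n) < e"
    proof (intro exI allI impI)
      fix m n assume "k \<le> m" "k \<le> n"
      then have "(norm (s m - s n))\<^sup>2 < e\<^sup>2"
        using step[of k m n] k by simp
      then show "dist (s m) (s n) < e"
        using e by (simp add: dist_norm power_less_imp_less_base)
    qed
  qed
  then obtain p where p: "s \<longlonglongrightarrow> p"
    using Cauchy_convergent_iff convergent_def by blast
  have pC: "p \<in> C"
    using closed_sequentially[OF C(2)] s(1) p by blast
  have "(\<lambda>n. (norm (x - s n))\<^sup>2) \<longlonglongrightarrow> (norm (x - p))\<^sup>2"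
    by (intro tendsto_intros p)
  moreover have "(\<lambda>n. d\<^sup>2 + 1 / real (Suc n)) \<longlonglongrightarrow> d\<^sup>2 + 0"
    by (intro tendsto_add tendsto_const LIMSEQ_Suc[OF lim_1_over_n])
  ultimately have pd: "(norm (x - p))\<^sup>2 \<le> d\<^sup>2"
    using s(2) by (intro LIMSEQ_le[of _ _ "\<lambda>n. d\<^sup>2 + 1 / real (Suc n)"]) (auto intro: less_imp_le)
  show thesis
  proof (rule that[OF pC])
    fix c assume c: "c \<in> C"
    have quad: "2 * t * inner (x - p) c \<le> t\<^sup>2 * inner c c" for t :: real
    proof -
      have "p + t *\<^sub>R c \<in> C"
        using pC c C by (intro subspace_add subspace_scale) auto
      then have "(norm (x - p))\<^sup>2 \<le> (norm ((x - p) - t *\<^sub>R c))\<^sup>2"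
        using pd d_le[of "p + t *\<^sub>R c"] unfolding diff_diff_add by linarith
      also have "\<dots> = (norm (x - p))\<^sup>2 - 2 * t * inner (x - p) c + t\<^sup>2 * inner c c"
        unfolding power2_norm_eq_inner
        by (simp add: inner_diff_left inner_diff_right inner_commute power2_eq_square algebra_simps)
      finally show ?thesis by simp
    qed
    show "inner (x - p) c = 0"
    proof (cases "c = 0")
      case False
      then have "0 < inner c c" by simp
      then have "(inner (x - p) c)\<^sup>2 / inner c c \<le> 0"
        using quad[of "inner (x - p) c / inner c c"] by (simp add: power2_eq_square)
      then show ?thesis
        using \<open>0 < inner c c\<close> by (simp add: divide_le_0_iff)
    qed simp
  qed
qed

lemma subspace_closure:
  fixes S :: "'a::real_normed_vector set"
  assumes "subspace S"
  shows "subspace (closure S)"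
proof (rule subspaceI)
  show "0 \<in> closure S"
    using assms closure_subset subspace_0 by blast
next
  fix x y assume "x \<in> closure S" "y \<in> closure S"
  then obtain f g where "\<And>n. f n \<in> S" "f \<longlonglongrightarrow> x" "\<And>n. g n \<in> S" "g \<longlonglongrightarrow> y"
    unfolding closure_sequential by blast
  then show "x + y \<in> closure S"
    unfolding closure_sequential using assms
    by (intro exI[of _ "\<lambda>n. f n + g n"]) (auto intro: tendsto_add subspace_add)
next
  fix c x assume "x \<in> closure S"
  then obtain f where "\<And>n. f n \<in> S" "f \<longlonglongrightarrow> x"
    unfolding closure_sequential by blast
  then show "c *\<^sub>R x \<in> closure S"
    unfolding closure_sequential using assms
    by (intro exI[of _ "\<lambda>n. c *\<^sub>R f n"]) (auto intro: tendsto_intros subspace_scale)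
qed

text \<open>\<open>- J\<close> is a linear maximal monotone operator in the Hilbert space
  \<open>V\<close>. The density of \<open>E\<close> is a consequence, proved next.\<close>

locale monotone_operator =
  fixes V E :: "'a::{real_inner,banach} set" and J :: "'a \<Rightarrow> 'a"
  assumes V: "subspace V" "closed V" and E: "subspace E" "E \<subseteq> V"
    and J_add: "\<And>x y. x \<in> E \<Longrightarrow> y \<in> E \<Longrightarrow> J (x + y) = J x + J y"
    and J_scale: "\<And>r x. x \<in> E \<Longrightarrow> J (r *\<^sub>R x) = r *\<^sub>R J x"
    and J_V: "\<And>x. x \<in> E \<Longrightarrow> J x \<in> V"
    and J_diss: "\<And>x. x \<in> E \<Longrightarrow> inner (J x) x \<le> 0"
    and J_range: "\<And>c y. 0 < c \<Longrightarrow> y \<in> V \<Longrightarrow> \<exists>x\<in>E. c *\<^sub>R x - J x = y"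
begin

text \<open>For the part \<open>x - p\<close> of \<open>x\<close> that is orthogonal to
  \<open>closure E\<close>, solve \<open>e - J e = x - p\<close> with \<open>e\<close> in
  \<open>E\<close>. Testing with \<open>e\<close> gives
  \<open>inner e e = inner (J e) e \<le> 0\<close>, so \<open>e\<close>, and with it
  \<open>x - p\<close>, vanishes.\<close>

lemma dense: "V \<subseteq> closure E"
proof
  fix x assume x: "x \<in> V"
  obtain p where p: "p \<in> closure E" "\<And>c. c \<in> closure E \<Longrightarrow> inner (x - p) c = 0"
    using closed_subspace_orthogonal_projection[of "closure E" x] E(1) by (auto simp: subspace_closure)
  have "p \<in> V"
    using p(1) E(2) V(2) closure_minimal by blast
  then obtain e where e: "e \<in> E" "1 *\<^sub>R e - J e = x - p"
    using J_range[of 1 "x - p"] x V by (auto simp: subspace_diff)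
  have "inner (e - J e) e = 0"
    using p(2)[of e] e closure_subset by (auto simp del: inner_diff_left)
  then have "inner e e \<le> 0"
    using J_diss[OF e(1)] by (simp add: inner_diff_left)
  then have "e = 0"
    using inner_gt_zero_iff[of e] by linarith
  then have "x = p"
    using e J_scale[of 0 0] by simp
  then show "x \<in> closure E" using p by simp
qed

lemma J_diff: "x \<in> E \<Longrightarrow> y \<in> E \<Longrightarrow> J (x - y) = J x - J y"
  using J_add[of x "- y"] J_scale[of y "-1"] subspace_neg[OF E(1), of y] by simp

lemma expansive:
  assumes "x \<in> E" "0 < c"
  shows "c * norm x \<le> norm (c *\<^sub>R x - J x)"
proof (cases "x = 0")
  case False
  have "c * (norm x * norm x) \<le> inner (c *\<^sub>R x - J x) x"
    using J_diss[OF assms(1)] by (simp add: inner_diff_left norm_eq_sqrt_inner)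
  also have "\<dots> \<le> norm (c *\<^sub>R x - J x) * norm x"
    by (rule norm_cauchy_schwarz)
  finally show ?thesis
    using False by (simp add: mult.assoc[symmetric])
qed simp

text \<open>Writing \<open>P = c - (c - P)\<close>, the equation is a fixed point problem for the resolvent of \<open>J\<close>.\<close>

lemma perturbed_range:
  assumes c: "0 < c" and q: "0 \<le> q" "q < 1" and y: "y \<in> V"
    and P_V: "\<And>x. x \<in> V \<Longrightarrow> P x \<in> V"
    and P_diff: "\<And>x y. x \<in> V \<Longrightarrow> y \<in> V \<Longrightarrow> P (x - y) = P x - P y"
    and P: "\<And>x. x \<in> V \<Longrightarrow> norm (c *\<^sub>R x - P x) \<le> q * c * norm x"
  shows "\<exists>x\<in>E. P x - J x = y"
proof -
  define R where "R y = (SOME x. x \<in> E \<and> c *\<^sub>R x - J x = y)" for y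
  have R: "R y \<in> E" "c *\<^sub>R R y - J (R y) = y" if "y \<in> V" for y
    using someI_ex[of "\<lambda>x. x \<in> E \<and> c *\<^sub>R x - J x = y"] J_range[OF c that] unfolding R_def by blast+
  define f where "f x = R (y + (c *\<^sub>R x - P x))" for x
  have arg: "y + (c *\<^sub>R x - P x) \<in> V" if "x \<in> V" for x
    using that V y P_V by (intro subspace_add subspace_diff subspace_scale) auto
  have "\<exists>!x\<in>V. f x = x"
  proof (rule Banach_fix[OF _ _ q])
    show "complete V"
      using V by (simp add: complete_eq_closed)
    show "V \<noteq> {}" using y by auto
    show "f ` V \<subseteq> V"
      using R(1) arg E by (auto simp: f_def)
    \<comment> \<open>The resolvent \<open>R\<close> of \<open>J\<close> has Lipschitz constant
      \<open>1 / c\<close> by \<open>expansive\<close>, and \<open>c - P\<close> has norm at most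
      \<open>q c\<close>.\<close>
    show "dist (f x) (f x') \<le> q * dist x x'" if xx: "x \<in> V" "x' \<in> V" for x x'
    proof -
      have xV: "x - x' \<in> V" using xx V by (auto simp: subspace_diff)
      have fE: "f x \<in> E" "f x' \<in> E" using R(1) arg xx by (auto simp: f_def)
      have "c *\<^sub>R (f x - f x') - J (f x - f x')
          = (c *\<^sub>R f x - J (f x)) - (c *\<^sub>R f x' - J (f x'))"
        using fE by (simp add: J_diff algebra_simps)
      also have "\<dots> = (y + (c *\<^sub>R x - P x)) - (y + (c *\<^sub>R x' - P x'))"
        using R(2)[OF arg[OF xx(1)]] R(2)[OF arg[OF xx(2)]] by (simp only: f_def)
      also have "\<dots> = c *\<^sub>R (x - x') - P (x - x')"
        using xx by (simp add: P_diff algebra_simps)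
      finally have "c * norm (f x - f x') \<le> norm (c *\<^sub>R (x - x') - P (x - x'))"
        using expansive[of "f x - f x'" c] fE c E by (simp add: subspace_diff)
      also have "\<dots> \<le> c * (q * norm (x - x'))"
        using P[OF xV] by (simp add: mult.assoc mult.left_commute)
      finally show ?thesis
        using c by (simp add: dist_norm)
    qed
  qed
  then obtain x where x: "x \<in> V" "f x = x" by blast
  then have "x \<in> E" "c *\<^sub>R x - J x = y + (c *\<^sub>R x - P x)"
    using R[OF arg[OF x(1)]] by (auto simp: f_def)
  then show ?thesis
    by (auto intro!: bexI[of _ x] simp: algebra_simps)
qed

end

context monotone_operator
begin

text \<open>With \<open>e = Q x\<close> and \<open>\<mu> = 1 / h + w\<close> the equation
  \<open>x - h (J Q x - w x) = y\<close> becomes \<open>\<mu> P e - J e = y / h\<close>. This is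
  covered by \<open>perturbed_range\<close> for every \<open>h\<close>, because the closeness of
  \<open>P\<close> to a scalar is a relative condition and survives scaling by \<open>\<mu>\<close>.
  The norm enters through \<open>S\<close> so that it comes from an inner product.\<close>

lemma m_dissipative_compose:
  assumes Q: "bounded_linear Q" "\<And>x. x \<in> V \<Longrightarrow> Q x \<in> V" and P: "bounded_linear P" "\<And>x. x \<in> V \<Longrightarrow> P x \<in> V"
    and PQ: "\<And>x. x \<in> V \<Longrightarrow> P (Q x) = x" and QP: "\<And>x. x \<in> V \<Longrightarrow> Q (P x) = x"
    and near: "0 < c0" "0 \<le> q" "q < 1" "\<And>x. x \<in> V \<Longrightarrow> norm (c0 *\<^sub>R x - P x) \<le> q * c0 * norm x"
    and S: "bounded_linear S" "\<And>x. x \<in> V \<Longrightarrow> norm x \<le> c * norm (S x)" "\<And>x. norm (S x) \<le> C * norm x"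
    and cC: "0 < c" "0 < C" and w: "0 \<le> w"
    and diss: "\<And>x. x \<in> V \<Longrightarrow> Q x \<in> E \<Longrightarrow> inner (S (J (Q x))) (S x) \<le> w * (norm (S x))\<^sup>2"
  shows "m_dissipative V {x \<in> V. Q x \<in> E} (\<lambda>x. J (Q x) - w *\<^sub>R x) (\<lambda>x. norm (S x)) c C"
proof
  interpret Q: bounded_linear Q by (rule Q)
  interpret P: bounded_linear P by (rule P)
  interpret S: bounded_linear S by (rule S)
  show "subspace V" "closed V" "{x \<in> V. Q x \<in> E} \<subseteq> V" "0 < c" "0 < C"
    using V cC by auto
  show "subspace {x \<in> V. Q x \<in> E}"
    using V(1) E(1) by (auto simp: subspace_def Q.add Q.scaleR Q.zero)
  show "V \<subseteq> closure {x \<in> V. Q x \<in> E}"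
  proof
    fix x assume x: "x \<in> V"
    then have "Q x \<in> closure E" using Q(2) dense by blast
    then obtain f where f: "\<And>n. f n \<in> E" "f \<longlonglongrightarrow> Q x"
      unfolding closure_sequential by blast
    have "(\<lambda>n. P (f n)) \<longlonglongrightarrow> P (Q x)"
      by (rule P.tendsto[OF f(2)])
    moreover have "P (f n) \<in> {x \<in> V. Q x \<in> E}" for n
      using f(1)[of n] E(2) P(2) QP by auto
    ultimately show "x \<in> closure {x \<in> V. Q x \<in> E}"
      unfolding closure_sequential using PQ[OF x] by (intro exI[of _ "\<lambda>n. P (f n)"]) simp
  qed
  fix x y and r :: real
  show "norm (S (x + y)) \<le> norm (S x) + norm (S y)"
    by (simp add: S.add norm_triangle_ineq)
  show "norm (S (r *\<^sub>R x)) = \<bar>r\<bar> * norm (S x)"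
    by (simp add: S.scaleR)
  show "norm (S x) \<le> C * norm x" by (rule S)
  show "x \<in> V \<Longrightarrow> norm x \<le> c * norm (S x)" by (rule S)
  show "J (Q (x + y)) - w *\<^sub>R (x + y) = J (Q x) - w *\<^sub>R x + (J (Q y) - w *\<^sub>R y)"
    if "x \<in> {x \<in> V. Q x \<in> E}" "y \<in> {x \<in> V. Q x \<in> E}"
    using that by (simp add: Q.add J_add algebra_simps)
  show "J (Q (r *\<^sub>R x)) - w *\<^sub>R r *\<^sub>R x = r *\<^sub>R (J (Q x) - w *\<^sub>R x)" if "x \<in> {x \<in> V. Q x \<in> E}"
    using that by (simp add: Q.scaleR J_scale algebra_simps)
  show "J (Q x) - w *\<^sub>R x \<in> V" if "x \<in> {x \<in> V. Q x \<in> E}"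
    using that V(1) J_V by (auto intro: subspace_diff subspace_scale)
  fix h :: real
  show "norm (S x) \<le> norm (S (x - h *\<^sub>R (J (Q x) - w *\<^sub>R x)))" if x: "x \<in> {x \<in> V. Q x \<in> E}" and h: "0 < h"
  proof (cases "norm (S x) = 0")
    case False
    let ?y = "x - h *\<^sub>R (J (Q x) - w *\<^sub>R x)"
    have "norm (S x) * norm (S x) = inner (S x) (S x)"
      by (simp add: power2_norm_eq_inner[symmetric] power2_eq_square)
    also have "\<dots> \<le> inner (S x) (S x) + h * (w * (norm (S x))\<^sup>2 - inner (S (J (Q x))) (S x))"
      using diss[of x] x h by simp
    also have "\<dots> = inner (S ?y) (S x)"
      by (simp only: S.diff S.scaleR)
        (simp add: inner_diff_left power2_norm_eq_inner algebra_simps)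
    also have "\<dots> \<le> norm (S ?y) * norm (S x)"
      by (rule norm_cauchy_schwarz)
    finally show ?thesis
      using False by simp
  qed simp
  show "\<exists>x\<in>{x \<in> V. Q x \<in> E}. x - h *\<^sub>R (J (Q x) - w *\<^sub>R x) = y" if y: "y \<in> V" and h: "0 < h"
  proof -
    define \<mu> where "\<mu> = 1 / h + w"
    have \<mu>: "0 < \<mu>" using h w by (simp add: \<mu>_def add_pos_nonneg)
    have "\<exists>e\<in>E. \<mu> *\<^sub>R P e - J e = (1 / h) *\<^sub>R y"
    proof (rule perturbed_range[of "\<mu> * c0" q])
      show "norm ((\<mu> * c0) *\<^sub>R x - \<mu> *\<^sub>R P x) \<le> q * (\<mu> * c0) * norm x" if "x \<in> V" for x
      proof -
        have "(\<mu> * c0) *\<^sub>R x - \<mu> *\<^sub>R P x = \<mu> *\<^sub>R (c0 *\<^sub>R x - P x)"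
          by (simp add: scaleR_diff_right)
        then have "norm ((\<mu> * c0) *\<^sub>R x - \<mu> *\<^sub>R P x) = \<mu> * norm (c0 *\<^sub>R x - P x)"
          using \<mu> by simp
        also have "\<dots> \<le> \<mu> * (q * c0 * norm x)"
          using near(4)[OF that] \<mu> by (intro mult_left_mono) auto
        finally show ?thesis by (simp add: mult_ac)
      qed
    qed (use \<mu> near y V P(2) in \<open>auto simp: subspace_scale P.diff scaleR_diff_right\<close>)
    then obtain e where e: "e \<in> E" "\<mu> *\<^sub>R P e - J e = (1 / h) *\<^sub>R y" by blast
    have x: "P e \<in> {x \<in> V. Q x \<in> E}" "Q (P e) = e"
      using e(1) E(2) P(2) QP by auto
    have "P e - h *\<^sub>R (J (Q (P e)) - w *\<^sub>R P e) = h *\<^sub>R (\<mu> *\<^sub>R P e - J e)"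
      using h unfolding x(2) by (simp add: \<mu>_def algebra_simps)
    also have "\<dots> = y" using h unfolding e(2) by simp
    finally show ?thesis using x(1) by blast
  qed
qed

end

section \<open>The Hilbert space structure and multiplication operators\<close>

lemma sq_integrable_rep [simp, intro]: "sq_integrable (rep_l2 x)"
  using Quotient3_rep_reflp[OF Quotient3_l2, of x] by (simp add: l2_rel_def)

lemma rep_l2_measurable [measurable]: "rep_l2 x \<in> borel_measurable borel"
  using sq_integrable_rep[of x] by (simp add: sq_integrable_def)

lemma rep_abs_l2: "sq_integrable f \<Longrightarrow> AE z in lborel. rep_l2 (abs_l2 f) z = f z"
  using Quotient3_rep_abs[OF Quotient3_l2, of f] by (simp add: l2_rel_def)

lemma l2_eqI: "AE z in lborel. rep_l2 x z = rep_l2 y z \<Longrightarrow> x = y"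
  using Quotient3_rel_rep[OF Quotient3_l2, of x y] by (simp add: l2_rel_def)

lemma rep_zero: "AE z in lborel. rep_l2 0 z = 0"
  unfolding zero_l2_def by (rule rep_abs_l2[OF sq_integrable_zero])

lemma rep_add: "AE z in lborel. rep_l2 (x + y) z = rep_l2 x z + rep_l2 y z"
  unfolding plus_l2_def by (simp add: rep_abs_l2 sq_integrable_add)

lemma rep_scaleR: "AE z in lborel. rep_l2 (r *\<^sub>R x) z = r *\<^sub>R rep_l2 x z"
  unfolding scaleR_l2_def by (simp add: rep_abs_l2 sq_integrable_scaleR)

lemma rep_diff: "AE z in lborel. rep_l2 (x - y) z = rep_l2 x z - rep_l2 y z"
  using rep_add[of x "- y"] rep_scaleR[of "-1" y]
  unfolding minus_l2_def uminus_l2_def by eventually_elim simp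

lemma sq_integrable_inner:
  assumes "sq_integrable f" "sq_integrable g"
  shows "integrable lborel (\<lambda>z. f z \<bullet> g z)"
proof (rule Bochner_Integration.integrable_bound)
  show "integrable lborel (\<lambda>z. (norm (f z))\<^sup>2 + (norm (g z))\<^sup>2)"
    using assms by (auto simp: sq_integrable_def)
  show "(\<lambda>z. f z \<bullet> g z) \<in> borel_measurable lborel"
    using assms by (auto simp: sq_integrable_def)
  show "AE z in lborel. norm (f z \<bullet> g z) \<le> norm ((norm (f z))\<^sup>2 + (norm (g z))\<^sup>2)"
  proof (rule AE_I2)
    fix z
    have "norm (f z \<bullet> g z) \<le> norm (f z) * norm (g z)"
      using Cauchy_Schwarz_ineq2[of "f z" "g z"] by simp
    also have "\<dots> \<le> (norm (f z))\<^sup>2 + (norm (g z))\<^sup>2"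
      using sum_squares_bound[of "norm (f z)" "norm (g z)"]
        mult_nonneg_nonneg[OF norm_ge_zero[of "f z"] norm_ge_zero[of "g z"]] by linarith
    finally show "norm (f z \<bullet> g z) \<le> norm ((norm (f z))\<^sup>2 + (norm (g z))\<^sup>2)"
      by simp
  qed
qed

text \<open>This is the unweighted inner product, in which \<open>J_map\<close> is dissipative; its
  norm also provides the topology, and the weighted norms on \<open>X_space a b\<close> are compared
  with it.\<close>

instantiation l2 :: real_inner
begin

definition inner_l2 :: "l2 \<Rightarrow> l2 \<Rightarrow> real" where
  "inner_l2 x y = (LBINT z. rep_l2 x z \<bullet> rep_l2 y z)"

definition norm_l2 :: "l2 \<Rightarrow> real" where
  "norm_l2 x = sqrt (inner x x)"

definition dist_l2 :: "l2 \<Rightarrow> l2 \<Rightarrow> real" where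
  "dist_l2 x y = norm (x - y)"

definition sgn_l2 :: "l2 \<Rightarrow> l2" where
  "sgn_l2 x = inverse (norm x) *\<^sub>R x"

definition uniformity_l2 :: "(l2 \<times> l2) filter" where
  "uniformity_l2 = (INF e\<in>{0 <..}. principal {(x, y). dist x y < e})"

definition open_l2 :: "l2 set \<Rightarrow> bool" where
  "open_l2 U = (\<forall>x\<in>U. eventually (\<lambda>(x', y). x' = x \<longrightarrow> y \<in> U) uniformity)"

instance
proof
  fix x y z :: l2 and r :: real
  show "dist x y = norm (x - y)" by (rule dist_l2_def)
  show "sgn x = x /\<^sub>R norm x" by (rule sgn_l2_def)
  show "uniformity = (INF e\<in>{0<..}. principal {(x::l2, y). dist x y < e})"
    by (rule uniformity_l2_def)
  show "open U = (\<forall>x\<in>U. \<forall>\<^sub>F (x', y) in uniformity. x' = x \<longrightarrow> y \<in> U)" for U :: "l2 set"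
    by (rule open_l2_def)
  show "norm x = sqrt (inner x x)" by (rule norm_l2_def)
  show "inner x y = inner y x" by (simp add: inner_l2_def inner_commute)
  show "inner (x + y) z = inner x z + inner y z"
  proof -
    have "inner (x + y) z = (LBINT t. rep_l2 x t \<bullet> rep_l2 z t + rep_l2 y t \<bullet> rep_l2 z t)"
      unfolding inner_l2_def using rep_add[of x y]
      by (intro integral_cong_AE) (auto elim!: eventually_mono simp: inner_add_left)
    then show ?thesis
      by (simp add: inner_l2_def sq_integrable_inner)
  qed
  show "inner (r *\<^sub>R x) y = r * inner x y"
  proof -
    have "inner (r *\<^sub>R x) y = (LBINT t. r * (rep_l2 x t \<bullet> rep_l2 y t))"
      unfolding inner_l2_def using rep_scaleR[of r x]
      by (intro integral_cong_AE) (auto elim!: eventually_mono)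
    then show ?thesis
      by (simp add: inner_l2_def)
  qed
  show "0 \<le> inner x x"
    by (simp add: inner_l2_def)
  show "(inner x x = 0) = (x = 0)"
  proof
    assume "inner x x = 0"
    then have "AE z in lborel. rep_l2 x z \<bullet> rep_l2 x z = 0"
      unfolding inner_l2_def using sq_integrable_inner[of "rep_l2 x" "rep_l2 x"]
      by (subst (asm) integral_nonneg_eq_0_iff_AE) auto
    then show "x = 0"
      using rep_zero by (intro l2_eqI) (auto elim: eventually_elim2)
  next
    assume x: "x = 0"
    have "inner x x = (LBINT z::real. 0)"
      unfolding inner_l2_def x using rep_zero
      by (intro integral_cong_AE) (auto elim!: eventually_mono)
    then show "inner x x = 0" by simp
  qed
qed

end

lemma norm_l2_sq: "(norm x)\<^sup>2 = (LBINT z. (norm (rep_l2 x z))\<^sup>2)" for x :: l2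
  by (simp add: power2_norm_eq_inner inner_l2_def)

lemma nn_integral_norm_l2:
  "(\<integral>\<^sup>+z. ennreal ((norm (rep_l2 x z))\<^sup>2) \<partial>lborel) = ennreal ((norm x)\<^sup>2)"
  unfolding norm_l2_sq using sq_integrable_rep[of x]
  by (intro nn_integral_eq_integral) (auto simp: sq_integrable_def)

lemma nn_integral_norm_l2_diff:
  "(\<integral>\<^sup>+z. ennreal ((norm (rep_l2 x z - rep_l2 y z))\<^sup>2) \<partial>lborel) = ennreal ((dist x y)\<^sup>2)"
proof -
  have "(\<integral>\<^sup>+z. ennreal ((norm (rep_l2 x z - rep_l2 y z))\<^sup>2) \<partial>lborel)
      = (\<integral>\<^sup>+z. ennreal ((norm (rep_l2 (x - y) z))\<^sup>2) \<partial>lborel)"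
    using rep_diff[of x y] by (intro nn_integral_cong_AE) (auto elim!: eventually_mono)
  then show ?thesis
    by (simp add: nn_integral_norm_l2 dist_norm)
qed

text \<open>Almost everywhere \<open>\<Sum> 2 ^ n |X (n + 1) - X n|\<^sup>2 < \<infinity>\<close>, so the increments decay geometrically; this
  avoids Minkowski's inequality.\<close>

lemma rapidly_Cauchy_AE_convergent:
  fixes X :: "nat \<Rightarrow> l2"
  assumes "\<And>n. dist (X (Suc n)) (X n) \<le> (1/2) ^ n"
  shows "AE z in lborel. convergent (\<lambda>n. rep_l2 (X n) z)"
proof -
  define d where "d n z = (norm (rep_l2 (X (Suc n)) z - rep_l2 (X n) z))\<^sup>2" for n z
  have [measurable]: "d n \<in> borel_measurable borel" for n
    unfolding d_def by measurable
  have "(\<integral>\<^sup>+z. (\<Sum>n. ennreal (2 ^ n * d n z)) \<partial>lborel)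
      = (\<Sum>n. \<integral>\<^sup>+z. ennreal (2 ^ n * d n z) \<partial>lborel)"
    by (intro nn_integral_suminf) auto
  also have "\<dots> \<le> (\<Sum>n. ennreal ((1/2) ^ n))"
  proof (intro suminf_le)
    fix n
    have "(\<integral>\<^sup>+z. ennreal (2 ^ n * d n z) \<partial>lborel) = ennreal (2 ^ n) * (\<integral>\<^sup>+z. ennreal (d n z) \<partial>lborel)"
      by (subst nn_integral_cmult[symmetric]) (auto simp: ennreal_mult' d_def)
    also have "(\<integral>\<^sup>+z. ennreal (d n z) \<partial>lborel) = ennreal ((dist (X (Suc n)) (X n))\<^sup>2)"
      unfolding d_def by (rule nn_integral_norm_l2_diff)
    also have "ennreal (2 ^ n) * \<dots> = ennreal (2 ^ n * (dist (X (Suc n)) (X n))\<^sup>2)"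
      by (simp add: ennreal_mult')
    also have "2 ^ n * (dist (X (Suc n)) (X n))\<^sup>2 \<le> 2 ^ n * ((1/2) ^ n)\<^sup>2"
      using assms[of n] by (intro mult_left_mono power_mono) auto
    also have "2 ^ n * ((1/2) ^ n)\<^sup>2 = (1/2 :: real) ^ n"
      by (simp add: power2_eq_square power_divide)
    finally show "(\<integral>\<^sup>+z. ennreal (2 ^ n * d n z) \<partial>lborel) \<le> ennreal ((1/2) ^ n)"
      by (simp add: ennreal_leI)
  qed auto
  also have "\<dots> = ennreal (\<Sum>n. (1/2) ^ n)"
    by (intro suminf_ennreal2) (auto intro: summable_geometric)
  finally have "(\<integral>\<^sup>+z. (\<Sum>n. ennreal (2 ^ n * d n z)) \<partial>lborel) \<noteq> \<infinity>"
    by (auto simp: top_unique)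
  then have "AE z in lborel. (\<Sum>n. ennreal (2 ^ n * d n z)) \<noteq> \<infinity>"
    by (intro nn_integral_PInf_AE) auto
  then show ?thesis
  proof eventually_elim
    case (elim z)
    have "summable (\<lambda>n. 2 ^ n * d n z)"
      using elim by (intro summable_suminf_not_top) (auto simp: d_def)
    then have "Bseq (\<lambda>n. 2 ^ n * d n z)"
      by (intro convergent_imp_Bseq) (auto simp: convergent_def dest: summable_LIMSEQ_zero)
    then obtain K where K: "0 < K" "\<And>n. norm (2 ^ n * d n z) \<le> K"
      by (auto simp: Bseq_def)
    have "summable (\<lambda>n. rep_l2 (X (Suc n)) z - rep_l2 (X n) z)"
    proof (rule summable_comparison_test)
      show "\<exists>N. \<forall>n\<ge>N. norm (rep_l2 (X (Suc n)) z - rep_l2 (X n) z) \<le> sqrt K * (sqrt (1/2)) ^ n"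
      proof (intro exI allI impI)
        fix n
        have "d n z \<le> K * (1/2) ^ n"
          using K(2)[of n] by (simp add: d_def field_simps power_divide)
        then have "sqrt (d n z) \<le> sqrt (K * (1/2) ^ n)"
          by (rule real_sqrt_le_mono)
        then show "norm (rep_l2 (X (Suc n)) z - rep_l2 (X n) z) \<le> sqrt K * (sqrt (1/2)) ^ n"
          by (simp add: d_def real_sqrt_mult real_sqrt_power)
      qed
      show "summable (\<lambda>n. sqrt K * (sqrt (1/2)) ^ n)"
        by (intro summable_mult summable_geometric) simp
    qed
    then have "convergent (\<lambda>n. (rep_l2 (X n) z - rep_l2 (X 0) z))"
      unfolding summable_iff_convergent sum_lessThan_telescope[of "\<lambda>n. rep_l2 (X n) z"] .
    then show ?case
      by (simp add: convergent_diff_const_right_iff)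
  qed
qed

text \<open>Riesz-Fischer: Fatou's lemma turns the pointwise limit into a limit in
  \<open>L\<^sup>2\<close>, preserving the bound on the distance from the \<open>k\<close>-th
  term.\<close>

lemma rapidly_Cauchy_convergent:
  fixes X :: "nat \<Rightarrow> l2"
  assumes X: "\<And>m n. n \<le> m \<Longrightarrow> dist (X m) (X n) \<le> (1/2) ^ n"
  shows "convergent X"
proof -
  define F where "F z = lim (\<lambda>n. rep_l2 (X n) z)" for z
  have [measurable]: "F \<in> borel_measurable borel"
    unfolding F_def by measurable
  have conv: "AE z in lborel. (\<lambda>n. rep_l2 (X n) z) \<longlonglongrightarrow> F z"
    using rapidly_Cauchy_AE_convergent[of X] X
    by (auto simp: F_def convergent_LIMSEQ_iff elim!: eventually_mono)
  have bound: "(\<integral>\<^sup>+z. ennreal ((norm (F z - rep_l2 (X k) z))\<^sup>2) \<partial>lborel) \<le> ennreal (((1/2) ^ k)\<^sup>2)" for k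
  proof -
    have "(\<integral>\<^sup>+z. ennreal ((norm (F z - rep_l2 (X k) z))\<^sup>2) \<partial>lborel)
        = (\<integral>\<^sup>+z. liminf (\<lambda>n. ennreal ((norm (rep_l2 (X n) z - rep_l2 (X k) z))\<^sup>2)) \<partial>lborel)"
    proof (rule nn_integral_cong_AE)
      show "AE z in lborel. ennreal ((norm (F z - rep_l2 (X k) z))\<^sup>2)
          = liminf (\<lambda>n. ennreal ((norm (rep_l2 (X n) z - rep_l2 (X k) z))\<^sup>2))"
        using conv
      proof eventually_elim
        case (elim z)
        then have "(\<lambda>n. ennreal ((norm (rep_l2 (X n) z - rep_l2 (X k) z))\<^sup>2))
            \<longlonglongrightarrow> ennreal ((norm (F z - rep_l2 (X k) z))\<^sup>2)"
          by (intro tendsto_intros)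
        then show ?case
          by (intro lim_imp_Liminf[symmetric]) auto
      qed
    qed
    also have "\<dots> \<le> liminf (\<lambda>n. \<integral>\<^sup>+z. ennreal ((norm (rep_l2 (X n) z - rep_l2 (X k) z))\<^sup>2) \<partial>lborel)"
      by (intro nn_integral_liminf) auto
    also have "\<dots> = liminf (\<lambda>n. ennreal ((dist (X n) (X k))\<^sup>2))"
      by (simp add: nn_integral_norm_l2_diff)
    also have "\<dots> \<le> liminf (\<lambda>n. ennreal (((1/2) ^ k)\<^sup>2))"
    proof (rule Liminf_mono)
      show "\<forall>\<^sub>F n in sequentially. ennreal ((dist (X n) (X k))\<^sup>2) \<le> ennreal (((1/2) ^ k)\<^sup>2)"
        using eventually_ge_at_top[of k]
        by eventually_elim (intro ennreal_leI power_mono X, auto)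
    qed
    finally show ?thesis by (simp add: Liminf_const)
  qed
  have sq_diff: "sq_integrable (\<lambda>z. F z - rep_l2 (X k) z)" for k
    using bound[of k] le_less_trans[OF bound[of k] ennreal_less_top]
    by (auto simp: sq_integrable_def integrable_iff_bounded)
  have "sq_integrable F"
    using sq_integrable_add[OF sq_diff[of 0] sq_integrable_rep[of "X 0"]] by simp
  then have repF: "AE z in lborel. rep_l2 (abs_l2 F) z = F z"
    by (rule rep_abs_l2)
  have dist_le: "dist (abs_l2 F) (X k) \<le> (1/2) ^ k" for k
  proof -
    have "ennreal ((dist (abs_l2 F) (X k))\<^sup>2) \<le> ennreal (((1/2) ^ k)\<^sup>2)"
      unfolding nn_integral_norm_l2_diff[symmetric] using repF
      by (intro order_trans[OF nn_integral_mono_AE bound[of k]]) (auto elim!: eventually_mono)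
    then have "(dist (abs_l2 F) (X k))\<^sup>2 \<le> ((1/2) ^ k)\<^sup>2"
      by (subst (asm) ennreal_le_iff) auto
    then show ?thesis
      by (rule power2_le_imp_le) simp
  qed
  have "X \<longlonglongrightarrow> abs_l2 F"
  proof (rule metric_tendsto_imp_tendsto)
    show "(\<lambda>k. (1/2 :: real) ^ k) \<longlonglongrightarrow> 0"
      by (intro LIMSEQ_power_zero) auto
    show "\<forall>\<^sub>F k in sequentially. dist (X k) (abs_l2 F) \<le> dist ((1/2 :: real) ^ k) 0"
      using dist_le by (auto simp: dist_commute intro!: always_eventually)
  qed
  then show ?thesis
    by (rule convergentI)
qed

instance l2 :: banach
proof
  fix X :: "nat \<Rightarrow> l2"
  assume X: "Cauchy X"
  have "\<exists>M. \<forall>m\<ge>M. \<forall>n\<ge>M. dist (X m) (X n) < (1/2) ^ k" for k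
    using X by (intro metric_CauchyD) auto
  then obtain K where K: "\<And>k m n. K k \<le> m \<Longrightarrow> K k \<le> n \<Longrightarrow> dist (X m) (X n) < (1/2) ^ k"
    by metis
  \<comment> \<open>The summand \<open>n\<close> makes \<open>r\<close> strictly increasing, and the
    sum of all thresholds so far makes it dominate \<open>K\<close>.\<close>
  define r where "r n = (\<Sum>i\<le>n. K i) + n" for n
  have "strict_mono r"
    by (auto simp: strict_mono_Suc_iff r_def)
  have r: "K n \<le> r m" if "n \<le> m" for n m
    using that member_le_sum[of n "{..m}" K] by (simp add: r_def)
  have "dist ((X \<circ> r) m) ((X \<circ> r) n) \<le> (1/2) ^ n" if "n \<le> m" for m n
    unfolding o_def using that by (intro less_imp_le[OF K] r) auto
  then obtain x where "(X \<circ> r) \<longlonglongrightarrow> x"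
    using rapidly_Cauchy_convergent[of "X \<circ> r"] by (auto simp: convergent_def)
  then have "X \<longlonglongrightarrow> x"
    using X \<open>strict_mono r\<close> by (rule_tac Cauchy_converges_subseq)
  then show "convergent X"
    by (rule convergentI)
qed

section \<open>The subspace of functions on the interval and diagonal multipliers\<close>

lemma subspace_X: "subspace (X_space a b)"
proof (rule subspaceI)
  show "0 \<in> X_space a b"
    using rep_zero by (auto simp: X_space_def elim: eventually_mono)
next
  fix x y assume "x \<in> X_space a b" "y \<in> X_space a b"
  then show "x + y \<in> X_space a b"
    using rep_add[of x y] by (auto simp: X_space_def elim: eventually_elim2)
next
  fix c x assume "x \<in> X_space a b"
  then show "c *\<^sub>R x \<in> X_space a b"
    using rep_scaleR[of c x] by (auto simp: X_space_def elim: eventually_elim2)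
qed

text \<open>A vector field stands for the diagonal matrix with these entries; the entrywise bound
  \<open>K\<close> is then a bound for the operator norm as well.\<close>

definition multiplier :: "real \<Rightarrow> (real \<Rightarrow> real^2) \<Rightarrow> bool" where
  "multiplier K w \<longleftrightarrow> w \<in> borel_measurable borel \<and> (\<forall>z i. \<bar>w z $ i\<bar> \<le> K)"

definition dmul :: "(real \<Rightarrow> real^2) \<Rightarrow> l2 \<Rightarrow> l2" where
  "dmul w x = abs_l2 (\<lambda>z. \<chi> i. w z $ i * rep_l2 x z $ i)"

lemma multiplier_bound_nonneg: "multiplier K w \<Longrightarrow> 0 \<le> K"
  using abs_ge_zero order_trans unfolding multiplier_def by blast

lemma borel_measurable_vec_lambda:
  fixes f :: "'a \<Rightarrow> 'n::finite \<Rightarrow> real"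
  assumes "\<And>i. (\<lambda>z. f z i) \<in> borel_measurable M"
  shows "(\<lambda>z. \<chi> i. f z i) \<in> borel_measurable M"
proof -
  have "(\<lambda>z. \<chi> i. f z i) = (\<lambda>z. \<Sum>i\<in>UNIV. f z i *\<^sub>R axis i 1)"
    by (auto simp: vec_eq_iff axis_def if_distrib cong: if_cong)
  then show ?thesis
    using assms by (simp only:) (intro borel_measurable_sum borel_measurable_scaleR, auto)
qed

lemma measurable_vec_nth [measurable (raw)]:
  fixes f :: "'a \<Rightarrow> real^'n"
  assumes "f \<in> borel_measurable M"
  shows "(\<lambda>z. f z $ i) \<in> borel_measurable M"
  by (rule borel_measurable_continuous_on[OF _ assms]) (intro continuous_intros)

lemma norm_vec_mult_le:
  fixes v w :: "real^'n"
  assumes "\<And>i. \<bar>w $ i\<bar> \<le> K"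
  shows "norm (\<chi> i. w $ i * v $ i) \<le> K * norm v"
proof -
  have K: "0 \<le> K" using assms abs_ge_zero order_trans by blast
  have "norm (\<chi> i. w $ i * v $ i) \<le> norm (K *\<^sub>R v)"
    using assms K by (intro norm_le_componentwise_cart) (auto simp: abs_mult intro!: mult_right_mono)
  then show ?thesis using K by simp
qed

lemma sq_integrable_mult:
  assumes "multiplier K w" "sq_integrable f"
  shows "sq_integrable (\<lambda>z. \<chi> i. w z $ i * f z $ i)"
proof -
  have [measurable]: "w \<in> borel_measurable borel" "f \<in> borel_measurable borel"
    using assms by (auto simp: multiplier_def sq_integrable_def)
  have meas[measurable]: "(\<lambda>z. \<chi> i. w z $ i * f z $ i) \<in> borel_measurable borel"
    by (intro borel_measurable_vec_lambda) measurable
  have "integrable lborel (\<lambda>z. (norm (\<chi> i. w z $ i * f z $ i))\<^sup>2)"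
  proof (rule Bochner_Integration.integrable_bound)
    show "integrable lborel (\<lambda>z. (K * norm (f z))\<^sup>2)"
      using assms by (simp add: power_mult_distrib sq_integrable_def)
    have "(norm (\<chi> i. w z $ i * f z $ i))\<^sup>2 \<le> (K * norm (f z))\<^sup>2" for z
      using assms by (intro power_mono norm_vec_mult_le) (auto simp: multiplier_def)
    then show "AE z in lborel. norm ((norm (\<chi> i. w z $ i * f z $ i))\<^sup>2) \<le> norm ((K * norm (f z))\<^sup>2)"
      by auto
  qed measurable
  then show ?thesis
    by (simp add: sq_integrable_def)
qed

lemma rep_dmul: "multiplier K w \<Longrightarrow> AE z in lborel. rep_l2 (dmul w x) z = (\<chi> i. w z $ i * rep_l2 x z $ i)"
  unfolding dmul_def by (intro rep_abs_l2 sq_integrable_mult) auto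

lemma dmul_add: "multiplier K w \<Longrightarrow> dmul w (x + y) = dmul w x + dmul w y"
proof (rule l2_eqI)
  assume w: "multiplier K w"
  show "AE z in lborel. rep_l2 (dmul w (x + y)) z = rep_l2 (dmul w x + dmul w y) z"
    using rep_dmul[OF w, of x] rep_dmul[OF w, of y] rep_dmul[OF w, of "x + y"]
      rep_add[of x y] rep_add[of "dmul w x" "dmul w y"]
    by eventually_elim (simp add: vec_eq_iff algebra_simps)
qed

lemma dmul_scaleR: "multiplier K w \<Longrightarrow> dmul w (r *\<^sub>R x) = r *\<^sub>R dmul w x"
proof (rule l2_eqI)
  assume w: "multiplier K w"
  show "AE z in lborel. rep_l2 (dmul w (r *\<^sub>R x)) z = rep_l2 (r *\<^sub>R dmul w x) z"
    using rep_dmul[OF w, of x] rep_dmul[OF w, of "r *\<^sub>R x"] rep_scaleR[of r x] rep_scaleR[of r "dmul w x"]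
    by eventually_elim (simp add: vec_eq_iff algebra_simps)
qed

lemma norm_dmul_le:
  assumes w: "multiplier K w"
  shows "norm (dmul w x) \<le> K * norm x"
proof (rule power2_le_imp_le)
  have "(norm (dmul w x))\<^sup>2 \<le> (LBINT z. K\<^sup>2 * (norm (rep_l2 x z))\<^sup>2)"
    unfolding norm_l2_sq
  proof (rule integral_mono_AE)
    show "AE z in lborel. (norm (rep_l2 (dmul w x) z))\<^sup>2 \<le> K\<^sup>2 * (norm (rep_l2 x z))\<^sup>2"
      using rep_dmul[OF w, of x]
    proof eventually_elim
      case (elim z)
      have "(norm (\<chi> i. w z $ i * rep_l2 x z $ i))\<^sup>2 \<le> (K * norm (rep_l2 x z))\<^sup>2"
        using w by (intro power_mono norm_vec_mult_le) (auto simp: multiplier_def)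
      then show ?case by (simp add: elim power_mult_distrib)
    qed
  qed (use sq_integrable_rep in \<open>auto simp: sq_integrable_def\<close>)
  then show "(norm (dmul w x))\<^sup>2 \<le> (K * norm x)\<^sup>2"
    by (simp add: norm_l2_sq power_mult_distrib)
  show "0 \<le> K * norm x"
    using multiplier_bound_nonneg[OF w] by simp
qed

lemma bounded_linear_dmul: "multiplier K w \<Longrightarrow> bounded_linear (dmul w)"
  using norm_dmul_le[of K w]
  by (intro bounded_linear_intro[where K = K]) (auto simp: dmul_add dmul_scaleR mult.commute)

lemma dmul_X: "multiplier K w \<Longrightarrow> x \<in> X_space a b \<Longrightarrow> dmul w x \<in> X_space a b"
  using rep_dmul[of K w x] unfolding X_space_def mem_Collect_eq
  by (auto elim!: eventually_elim2 simp: vec_eq_iff)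

lemma dmul_cong_X:
  assumes "multiplier K w" "multiplier L v" "x \<in> X_space a b" "AE z in lborel. z \<in> {a..b} \<longrightarrow> w z = v z"
  shows "dmul w x = dmul v x"
proof (rule l2_eqI)
  have "AE z in lborel. z \<notin> {a..b} \<longrightarrow> rep_l2 x z = 0"
    using assms by (simp add: X_space_def)
  with rep_dmul[OF assms(1), of x] rep_dmul[OF assms(2), of x] assms(4)
  show "AE z in lborel. rep_l2 (dmul w x) z = rep_l2 (dmul v x) z"
    by eventually_elim (auto simp: vec_eq_iff)
qed

lemma multiplier_mult:
  assumes "multiplier K w" "multiplier L v"
  shows "multiplier (K * L) (\<lambda>z. \<chi> i. w z $ i * v z $ i)"
proof -
  have [measurable]: "w \<in> borel_measurable borel" "v \<in> borel_measurable borel"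
    using assms by (auto simp: multiplier_def)
  have "\<bar>w z $ i * v z $ i\<bar> \<le> K * L" for z i
    using assms multiplier_bound_nonneg[OF assms(1)]
    unfolding abs_mult multiplier_def by (intro mult_mono) auto
  then show ?thesis
    unfolding multiplier_def by (auto intro!: borel_measurable_vec_lambda)
qed

lemma dmul_dmul:
  assumes "multiplier K w" "multiplier L v"
  shows "dmul w (dmul v x) = dmul (\<lambda>z. \<chi> i. w z $ i * v z $ i) x"
proof (rule l2_eqI)
  show "AE z in lborel. rep_l2 (dmul w (dmul v x)) z = rep_l2 (dmul (\<lambda>z. \<chi> i. w z $ i * v z $ i) x) z"
    using rep_dmul[OF assms(1), of "dmul v x"] rep_dmul[OF assms(2), of x]
      rep_dmul[OF multiplier_mult[OF assms], of x]
    by eventually_elim (simp add: vec_eq_iff)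
qed

lemma multiplier_const: "multiplier \<bar>r\<bar> (\<lambda>_. \<chi> i. r)"
  by (auto simp: multiplier_def)

lemma dmul_const: "dmul (\<lambda>_. \<chi> i. r) x = r *\<^sub>R x"
proof (rule l2_eqI)
  show "AE z in lborel. rep_l2 (dmul (\<lambda>_. \<chi> i. r) x) z = rep_l2 (r *\<^sub>R x) z"
    using rep_dmul[OF multiplier_const, of r x] rep_scaleR[of r x]
    by eventually_elim (auto simp: vec_eq_iff)
qed

text \<open>Lets a sup bound on \<open>r - w\<close> estimate the distance of a multiplication
  operator from a scalar, the quantity in the contraction argument.\<close>

lemma dmul_sub_const:
  assumes "multiplier K w" "multiplier L (\<lambda>z. \<chi> i. r - w z $ i)"
  shows "dmul (\<lambda>z. \<chi> i. r - w z $ i) x = r *\<^sub>R x - dmul w x"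
proof (rule l2_eqI)
  show "AE z in lborel. rep_l2 (dmul (\<lambda>z. \<chi> i. r - w z $ i) x) z = rep_l2 (r *\<^sub>R x - dmul w x) z"
    using rep_dmul[OF assms(1), of x] rep_dmul[OF assms(2), of x] rep_scaleR[of r x]
      rep_diff[of "r *\<^sub>R x" "dmul w x"]
    by eventually_elim (simp add: vec_eq_iff left_diff_distrib)
qed

text \<open>The subspace is the fixed point set of a bounded operator, multiplication by the
  indicator of \<open>{a..b}\<close>.\<close>

lemma closed_X: "closed (X_space a b)"
proof -
  define w :: "real \<Rightarrow> real^2" where "w z = (\<chi> i. indicator {a..b} z)" for z
  have w: "multiplier 1 w"
    unfolding multiplier_def w_def[abs_def]
    by (auto simp: indicator_def intro!: borel_measurable_vec_lambda)
  have "x \<in> X_space a b \<longleftrightarrow> dmul w x = x" for x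
  proof
    assume x: "x \<in> X_space a b"
    show "dmul w x = x"
    proof (rule l2_eqI)
      have "AE z in lborel. z \<notin> {a..b} \<longrightarrow> rep_l2 x z = 0"
        using x by (simp add: X_space_def)
      with rep_dmul[OF w, of x] show "AE z in lborel. rep_l2 (dmul w x) z = rep_l2 x z"
        by eventually_elim (auto simp: vec_eq_iff w_def indicator_def)
    qed
  next
    assume "dmul w x = x"
    with rep_dmul[OF w, of x] have "AE z in lborel. rep_l2 x z = (\<chi> i. w z $ i * rep_l2 x z $ i)"
      by simp
    then show "x \<in> X_space a b"
      unfolding X_space_def by (auto elim!: eventually_mono simp: w_def vec_eq_iff)
  qed
  then have "X_space a b = {x. dmul w x = x}" by auto
  moreover have "closed {x. dmul w x = x}"
    by (intro closed_Collect_eq linear_continuous_on bounded_linear_dmul[OF w] continuous_on_id)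
  ultimately show ?thesis by simp
qed

lemma inner_X:
  assumes "x \<in> X_space a b"
  shows "inner x y = (LBINT z:{a..b}. rep_l2 x z \<bullet> rep_l2 y z)"
  unfolding inner_l2_def set_lebesgue_integral_def
proof (rule integral_cong_AE)
  have "AE z in lborel. z \<notin> {a..b} \<longrightarrow> rep_l2 x z = 0"
    using assms by (simp add: X_space_def)
  then show "AE z in lborel. rep_l2 x z \<bullet> rep_l2 y z = indicat_real {a..b} z *\<^sub>R (rep_l2 x z \<bullet> rep_l2 y z)"
    by eventually_elim (auto simp: indicator_def)
qed auto

lemma multiplier_inverse:
  assumes "w \<in> borel_measurable borel" "0 < \<delta>" "\<And>z i. \<delta> \<le> w z $ i" "\<And>z i. w z $ i \<le> K"
  shows "multiplier K w" "multiplier (1 / \<delta>) (\<lambda>z. \<chi> i. 1 / w z $ i)"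
    "dmul (\<lambda>z. \<chi> i. 1 / w z $ i) (dmul w x) = x" "dmul w (dmul (\<lambda>z. \<chi> i. 1 / w z $ i) x) = x"
proof -
  have pos: "0 < w z $ i" for z i
    using assms(2,3) less_le_trans by blast
  have [measurable]: "w \<in> borel_measurable borel" by fact
  show 1: "multiplier K w"
    unfolding multiplier_def using assms(1,4) pos by (auto simp: abs_of_pos)
  show 2: "multiplier (1 / \<delta>) (\<lambda>z. \<chi> i. 1 / w z $ i)"
    unfolding multiplier_def
  proof (intro conjI allI)
    show "(\<lambda>z. \<chi> i. 1 / w z $ i) \<in> borel_measurable borel"
      by (intro borel_measurable_vec_lambda) measurable
    show "\<bar>(\<chi> i. 1 / w z $ i) $ i\<bar> \<le> 1 / \<delta>" for z i
      using pos[of z i] assms(2,3) by (simp add: divide_left_mono)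
  qed
  have ne: "w z $ i \<noteq> 0" for z i using pos[of z i] by simp
  show "dmul (\<lambda>z. \<chi> i. 1 / w z $ i) (dmul w x) = x"
    using dmul_dmul[OF 2 1, of x] dmul_const[of 1 x] ne by simp
  show "dmul w (dmul (\<lambda>z. \<chi> i. 1 / w z $ i) x) = x"
    using dmul_dmul[OF 1 2, of x] dmul_const[of 1 x] ne by simp
qed

lemma inner_dmul_lower:
  assumes w: "multiplier K w" and lower: "\<And>z i. \<delta> \<le> w z $ i"
  shows "\<delta> * (norm x)\<^sup>2 \<le> inner x (dmul w x)"
proof -
  have "\<delta> * (norm x)\<^sup>2 = (LBINT z. \<delta> * (norm (rep_l2 x z))\<^sup>2)"
    by (simp add: norm_l2_sq)
  also have "\<dots> \<le> (LBINT z. rep_l2 x z \<bullet> rep_l2 (dmul w x) z)"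
  proof (rule integral_mono_AE)
    show "integrable lborel (\<lambda>z. \<delta> * (norm (rep_l2 x z))\<^sup>2)"
      using sq_integrable_rep[of x] by (simp add: sq_integrable_def)
    show "AE z in lborel. \<delta> * (norm (rep_l2 x z))\<^sup>2 \<le> rep_l2 x z \<bullet> rep_l2 (dmul w x) z"
      using rep_dmul[OF w, of x]
    proof eventually_elim
      case (elim z)
      have "\<delta> * (norm (rep_l2 x z))\<^sup>2 = (\<Sum>i\<in>UNIV. \<delta> * (rep_l2 x z $ i)\<^sup>2)"
        unfolding power2_norm_eq_inner by (simp add: inner_vec_def sum_distrib_left power2_eq_square)
      also have "\<dots> \<le> (\<Sum>i\<in>UNIV. w z $ i * (rep_l2 x z $ i)\<^sup>2)"
        using lower by (intro sum_mono mult_right_mono) auto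
      also have "\<dots> = rep_l2 x z \<bullet> rep_l2 (dmul w x) z"
        unfolding elim by (simp add: inner_vec_def power2_eq_square mult_ac)
      finally show ?case .
    qed
  qed (rule sq_integrable_inner; simp)
  finally show ?thesis by (simp add: inner_l2_def)
qed

section \<open>Absolutely continuous functions\<close>

text \<open>The plane is cut along the diagonal \<open>s = t\<close>: the two terms on the left are
  the integrals of \<open>f s * g t\<close> over the two halves. \<open>h2\<close> omits the
  diagonal so that the halves are disjoint; restoring it in the inner integral changes a single
  point.\<close>

lemma integral_parts_Fubini:
  fixes f g :: "real \<Rightarrow> real"
  assumes f: "integrable lborel f" and g: "integrable lborel g"
  shows "(LBINT t. g t * (LBINT s:{..t}. f s)) + (LBINT s. f s * (LBINT t:{..s}. g t))
      = (LBINT s. f s) * (LBINT t. g t)"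
proof -
  have [measurable]: "f \<in> borel_measurable borel" "g \<in> borel_measurable borel"
    using f g by auto
  define h1 where "h1 s t = indicat_real {..t} s * (f s * g t)" for s t :: real
  define h2 where "h2 s t = indicat_real {..<s} t * (f s * g t)" for s t :: real
  have [measurable]: "(\<lambda>x::real \<times> real. indicat_real {..snd x} (fst x)) \<in> borel_measurable (borel \<Otimes>\<^sub>M borel)"
    "(\<lambda>x::real \<times> real. indicat_real {..<fst x} (snd x)) \<in> borel_measurable (borel \<Otimes>\<^sub>M borel)"
    unfolding indicator_def atMost_iff lessThan_iff by measurable
  have int: "integrable (lborel \<Otimes>\<^sub>M lborel) (\<lambda>(s, t). f s * g t)"
  proof (rule lborel_pair.Fubini_integrable)
    show "integrable lborel (\<lambda>x. LBINT y. norm (case (x, y) of (s, t) \<Rightarrow> f s * g t))"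
      using f by (simp add: abs_mult)
    show "AE x in lborel. integrable lborel (\<lambda>y. case (x, y) of (s, t) \<Rightarrow> f s * g t)"
      using g by simp
  qed measurable
  have int1: "integrable (lborel \<Otimes>\<^sub>M lborel) (case_prod h1)"
    by (rule Bochner_Integration.integrable_bound[OF int])
      (auto simp: h1_def case_prod_beta' indicator_def)
  have int2: "integrable (lborel \<Otimes>\<^sub>M lborel) (case_prod h2)"
    by (rule Bochner_Integration.integrable_bound[OF int])
      (auto simp: h2_def case_prod_beta' indicator_def)
  have "h1 s t + h2 s t = f s * g t" for s t
    by (auto simp: h1_def h2_def indicator_def)
  then have "(\<integral>(s, t). f s * g t \<partial>(lborel \<Otimes>\<^sub>M lborel))
      = (\<integral>x. case_prod h1 x + case_prod h2 x \<partial>(lborel \<Otimes>\<^sub>M lborel))"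
    by (intro Bochner_Integration.integral_cong) auto
  also have "\<dots> = (\<integral>x. case_prod h1 x \<partial>(lborel \<Otimes>\<^sub>M lborel)) + (\<integral>x. case_prod h2 x \<partial>(lborel \<Otimes>\<^sub>M lborel))"
    by (intro Bochner_Integration.integral_add int1 int2)
  also have "(\<integral>x. case_prod h1 x \<partial>(lborel \<Otimes>\<^sub>M lborel)) = (LBINT t. LBINT s. h1 s t)"
    using lborel_pair.integral_snd[OF int1] by simp
  also have "\<dots> = (LBINT t. g t * (LBINT s:{..t}. f s))"
  proof (intro Bochner_Integration.integral_cong refl)
    fix t
    have "h1 s t = g t * (indicator {..t} s *\<^sub>R f s)" for s
      by (simp add: h1_def)
    then show "(LBINT s. h1 s t) = g t * (LBINT s:{..t}. f s)"
      by (simp add: set_lebesgue_integral_def)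
  qed
  also have "(\<integral>x. case_prod h2 x \<partial>(lborel \<Otimes>\<^sub>M lborel)) = (LBINT s. LBINT t. h2 s t)"
    using lborel_pair.integral_fst[OF int2] by simp
  also have "\<dots> = (LBINT s. f s * (LBINT t:{..s}. g t))"
  proof (intro Bochner_Integration.integral_cong refl)
    fix s
    have "(LBINT t. h2 s t) = (LBINT t. f s * (indicator {..s} t *\<^sub>R g t))"
    proof (rule integral_cong_AE)
      show "AE t in lborel. h2 s t = f s * (indicator {..s} t *\<^sub>R g t)"
        using AE_lborel_singleton[of s] by eventually_elim (auto simp: h2_def indicator_def)
    qed (auto simp: h2_def)
    then show "(LBINT t. h2 s t) = f s * (LBINT t:{..s}. g t)"
      by (simp add: set_lebesgue_integral_def)
  qed
  finally have "(LBINT t. g t * (LBINT s:{..t}. f s)) + (LBINT s. f s * (LBINT t:{..s}. g t))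
      = (\<integral>(s, t). f s * g t \<partial>(lborel \<Otimes>\<^sub>M lborel))"
    by simp
  also have "\<dots> = (LBINT s. LBINT t. f s * g t)"
    using lborel_pair.integral_fst[OF int] by simp
  finally show ?thesis by simp
qed

text \<open>Absolute continuity as a relation between \<open>F\<close> and an integrable density
  \<open>f\<close>: no pointwise derivative occurs, \<open>f\<close> may be altered measurably on
  null sets, and \<open>F\<close> matters only on \<open>{c..d}\<close>.\<close>

definition ac_on :: "real \<Rightarrow> real \<Rightarrow> (real \<Rightarrow> real) \<Rightarrow> (real \<Rightarrow> real) \<Rightarrow> bool" where
  "ac_on c d F f \<longleftrightarrow> set_integrable lborel {c..d} f \<and>
     (\<forall>p q. c \<le> p \<longrightarrow> p \<le> q \<longrightarrow> q \<le> d \<longrightarrow> (LBINT s:{p..q}. f s) = F q - F p)"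

lemma ac_on_integrable: "ac_on c d F f \<Longrightarrow> set_integrable lborel {c..d} f"
  by (simp add: ac_on_def)

lemma ac_on_integral: "ac_on c d F f \<Longrightarrow> c \<le> p \<Longrightarrow> p \<le> q \<Longrightarrow> q \<le> d \<Longrightarrow> (LBINT s:{p..q}. f s) = F q - F p"
  by (simp add: ac_on_def)

lemma set_integrable_subinterval:
  fixes f :: "real \<Rightarrow> real"
  shows "set_integrable lborel {c..d} f \<Longrightarrow> c \<le> p \<Longrightarrow> q \<le> d \<Longrightarrow> set_integrable lborel {p..q} f"
  by (rule set_integrable_subset) auto

lemma LBINT_combine:
  fixes f :: "real \<Rightarrow> real"
  assumes "set_integrable lborel {p..r} f" "p \<le> q" "q \<le> r"
  shows "(LBINT s:{p..r}. f s) = (LBINT s:{p..q}. f s) + (LBINT s:{q..r}. f s)"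
proof -
  have "set_integrable lborel {p..q} f" "set_integrable lborel {q..r} f"
    using assms by (auto intro: set_integrable_subinterval)
  then show ?thesis
    using assms Henstock_Kurzweil_Integration.integral_combine[of p q r f]
    by (simp add: set_borel_integral_eq_integral)
qed

lemma ac_on_subset: "ac_on c d F f \<Longrightarrow> c \<le> c' \<Longrightarrow> d' \<le> d \<Longrightarrow> ac_on c' d' F f"
  unfolding ac_on_def by (auto intro: set_integrable_subinterval)

lemma ac_on_primitive:
  assumes "set_integrable lborel {c..d} f"
  shows "ac_on c d (\<lambda>z. K + (LBINT s:{c..z}. f s)) f"
  unfolding ac_on_def
proof (intro conjI allI impI assms)
  fix p q assume "c \<le> p" "p \<le> q" "q \<le> d"
  then show "(LBINT s:{p..q}. f s) = K + (LBINT s:{c..q}. f s) - (K + (LBINT s:{c..p}. f s))"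
    using LBINT_combine[of c q f p] assms by (simp add: set_integrable_subinterval)
qed

lemma ac_on_glue:
  assumes "ac_on c l F f" "ac_on l d F f" "c \<le> l" "l \<le> d"
  shows "ac_on c d F f"
  unfolding ac_on_def
proof (intro conjI allI impI)
  have "{c..d} = {c..l} \<union> {l..d}" using assms by auto
  then show int: "set_integrable lborel {c..d} f"
    using assms by (auto simp: ac_on_def intro!: set_integrable_Un)
  fix p q assume pq: "c \<le> p" "p \<le> q" "q \<le> d"
  consider "q \<le> l" | "l \<le> p" | "p \<le> l" "l \<le> q" by linarith
  then show "(LBINT s:{p..q}. f s) = F q - F p"
  proof cases
    case 3
    have "set_integrable lborel {p..q} f"
      using int pq by (rule_tac set_integrable_subinterval[of c d]) auto
    then show ?thesis
      using LBINT_combine[of p q f l] 3 assms pq by (simp add: ac_on_integral)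
  qed (use assms pq in \<open>auto intro: ac_on_integral\<close>)
qed

lemma LBINT_cong_AE_on:
  fixes f g :: "real \<Rightarrow> real"
  assumes "set_borel_measurable lborel S f" "set_borel_measurable lborel S g" "AE s in lborel. s \<in> S \<longrightarrow> f s = g s"
  shows "(LBINT s:S. f s) = (LBINT s:S. g s)"
  using assms unfolding set_lebesgue_integral_def set_borel_measurable_def
  by (intro integral_cong_AE) (auto elim!: eventually_mono simp: indicator_def)

text \<open>Measurability of \<open>g\<close> is a separate hypothesis because \<open>lborel\<close>
  is not complete: equality almost everywhere does not transfer it.\<close>

lemma ac_on_cong:
  assumes ac: "ac_on c d F f" and F: "\<And>z. c \<le> z \<Longrightarrow> z \<le> d \<Longrightarrow> F z = G z"
    and meas: "set_borel_measurable lborel {c..d} g"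
    and ae: "AE s in lborel. s \<in> {c<..<d} \<longrightarrow> f s = g s"
  shows "ac_on c d G g"
  unfolding ac_on_def
proof (intro conjI allI impI)
  have ae': "AE s in lborel. s \<in> {c..d} \<longrightarrow> f s = g s"
    using ae AE_lborel_singleton[of c] AE_lborel_singleton[of d]
    by eventually_elim auto
  have f: "set_integrable lborel {c..d} f"
    using ac by (simp add: ac_on_def)
  have fm: "set_borel_measurable lborel {c..d} f"
    using f unfolding set_integrable_def set_borel_measurable_def by auto
  have "integrable lborel (\<lambda>s. indicator {c..d} s *\<^sub>R g s)"
  proof (rule integrable_cong_AE_imp)
    show "integrable lborel (\<lambda>s. indicator {c..d} s *\<^sub>R f s)"
      using f by (simp add: set_integrable_def)
    show "(\<lambda>s. indicator {c..d} s *\<^sub>R g s) \<in> borel_measurable lborel"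
      using meas by (simp add: set_borel_measurable_def)
    show "AE s in lborel. indicat_real {c..d} s *\<^sub>R f s = indicat_real {c..d} s *\<^sub>R g s"
      using ae' by eventually_elim (auto simp: indicator_def)
  qed
  then show gi: "set_integrable lborel {c..d} g"
    by (simp add: set_integrable_def)
  fix p q assume pq: "c \<le> p" "p \<le> q" "q \<le> d"
  have "(LBINT s:{p..q}. g s) = (LBINT s:{p..q}. f s)"
  proof (rule LBINT_cong_AE_on)
    show "set_borel_measurable lborel {p..q} g" "set_borel_measurable lborel {p..q} f"
      using set_integrable_subinterval[OF gi, of p q] set_integrable_subinterval[OF f, of p q] pq
      unfolding set_integrable_def set_borel_measurable_def by auto
    show "AE s in lborel. s \<in> {p..q} \<longrightarrow> g s = f s"
      using ae' pq by (auto elim!: eventually_mono)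
  qed
  then show "(LBINT s:{p..q}. g s) = G q - G p"
    using ac F pq by (simp add: ac_on_integral)
qed

lemma ac_on_continuous:
  assumes "ac_on c d F f"
  shows "continuous_on {c..d} F"
proof -
  have "f integrable_on {c..d}"
    using assms by (auto simp: ac_on_def intro: set_borel_integral_eq_integral)
  then have "continuous_on {c..d} (\<lambda>z. F c + integral {c..z} f)"
    by (intro continuous_intros indefinite_integral_continuous_1)
  moreover have "F c + integral {c..z} f = F z" if "z \<in> {c..d}" for z
    using that assms ac_on_integral[OF assms, of c z]
    by (auto simp: ac_on_def set_borel_integral_eq_integral set_integrable_subinterval[of c d])
  ultimately show ?thesis
    by (rule continuous_on_eq)
qed

lemma ac_on_C1:
  assumes "\<And>z. z \<in> {c..d} \<Longrightarrow> (F has_real_derivative f z) (at z within {c..d})" "continuous_on {c..d} f"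
  shows "ac_on c d F f"
  unfolding ac_on_def
proof (intro conjI allI impI)
  show int: "set_integrable lborel {c..d} f"
    unfolding set_integrable_def using assms(2) by (intro borel_integrable_compact) auto
  fix p q assume pq: "c \<le> p" "p \<le> q" "q \<le> d"
  have "(f has_integral (F q - F p)) {p..q}"
  proof (rule fundamental_theorem_of_calculus)
    fix z assume "z \<in> {p..q}"
    then show "(F has_vector_derivative f z) (at z within {p..q})"
      unfolding has_real_derivative_iff_has_vector_derivative[symmetric]
      using pq by (intro DERIV_subset[OF assms(1)]) auto
  qed (use pq in auto)
  then show "(LBINT s:{p..q}. f s) = F q - F p"
    using set_integrable_subinterval[OF int, of p q] pq
    by (simp add: set_borel_integral_eq_integral integral_unique)
qed

lemma ac_on_add: "ac_on c d F f \<Longrightarrow> ac_on c d G g \<Longrightarrow> ac_on c d (\<lambda>z. F z + G z) (\<lambda>z. f z + g z)"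
  unfolding ac_on_def by (auto simp: set_integrable_subinterval[of c d])

lemma ac_on_cmult: "ac_on c d F f \<Longrightarrow> ac_on c d (\<lambda>z. r * F z) (\<lambda>z. r * f z)"
  unfolding ac_on_def by (auto simp: right_diff_distrib)

lemma ac_on_diff: "ac_on c d F f \<Longrightarrow> ac_on c d G g \<Longrightarrow> ac_on c d (\<lambda>z. F z - G z) (\<lambda>z. f z - g z)"
  using ac_on_add[OF _ ac_on_cmult[of c d G g "-1"], of F f] by simp

lemma set_integrable_mult_continuous:
  fixes f G :: "real \<Rightarrow> real"
  assumes f: "set_integrable lborel {c..d} f" and G: "continuous_on {c..d} G"
  shows "set_integrable lborel {c..d} (\<lambda>z. f z * G z)"
proof -
  have "bounded (G ` {c..d})"
    using G by (intro compact_imp_bounded compact_continuous_image) auto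
  then obtain K where "\<forall>y\<in>G ` {c..d}. norm y \<le> K"
    unfolding bounded_iff by blast
  then have K: "\<bar>G z\<bar> \<le> K" if "z \<in> {c..d}" for z
    using that by auto
  have [measurable]: "(\<lambda>z. indicator {c..d} z *\<^sub>R G z) \<in> borel_measurable borel"
    using G by (intro borel_measurable_continuous_on_indicator) auto
  have [measurable]: "(\<lambda>z. indicator {c..d} z *\<^sub>R f z) \<in> borel_measurable borel"
    using f by (auto simp: set_integrable_def)
  have *: "indicator {c..d} z *\<^sub>R (f z * G z) = (indicator {c..d} z *\<^sub>R f z) * (indicator {c..d} z *\<^sub>R G z)" for z
    by (simp add: indicator_def)
  show ?thesis
    unfolding set_integrable_def
  proof (rule Bochner_Integration.integrable_bound)
    show "integrable lborel (\<lambda>z. K * (indicator {c..d} z *\<^sub>R f z))"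
      using f by (simp add: set_integrable_def)
    show "(\<lambda>z. indicator {c..d} z *\<^sub>R (f z * G z)) \<in> borel_measurable lborel"
      unfolding * by measurable
    show "AE z in lborel. norm (indicat_real {c..d} z *\<^sub>R (f z * G z)) \<le> norm (K * (indicat_real {c..d} z *\<^sub>R f z))"
    proof (rule AE_I2)
      fix z
      show "norm (indicat_real {c..d} z *\<^sub>R (f z * G z)) \<le> norm (K * (indicat_real {c..d} z *\<^sub>R f z))"
      proof (cases "z \<in> {c..d}")
        case True
        have "\<bar>G z\<bar> * \<bar>f z\<bar> \<le> \<bar>K\<bar> * \<bar>f z\<bar>"
          using K[OF True] by (intro mult_right_mono) auto
        with True show ?thesis
          by (simp add: abs_mult mult.commute)
      qed simp
    qed
  qed
qed

text \<open>Once \<open>f\<close> and \<open>g\<close> are cut to \<open>{p..q}\<close>, their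
  primitives from the left are \<open>F t - F p\<close> and \<open>G t - G p\<close>, so
  \<open>integral_parts_Fubini\<close> becomes integration by parts.\<close>

lemma ac_on_mult:
  assumes F: "ac_on c d F f" and G: "ac_on c d G g"
  shows "ac_on c d (\<lambda>z. F z * G z) (\<lambda>z. f z * G z + F z * g z)"
  unfolding ac_on_def
proof (intro conjI allI impI)
  have int1: "set_integrable lborel {c..d} (\<lambda>z. f z * G z)"
    using F G by (intro set_integrable_mult_continuous ac_on_continuous[OF G]) (auto simp: ac_on_def)
  have int2: "set_integrable lborel {c..d} (\<lambda>z. F z * g z)"
    using set_integrable_mult_continuous[of c d g F] ac_on_continuous[OF F] G
    by (auto simp: ac_on_def mult.commute)
  show "set_integrable lborel {c..d} (\<lambda>z. f z * G z + F z * g z)"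
    using int1 int2 by auto
  fix p q assume pq: "c \<le> p" "p \<le> q" "q \<le> d"
  define f0 g0 where "f0 z = indicator {p..q} z *\<^sub>R f z" and "g0 z = indicator {p..q} z *\<^sub>R g z" for z
  have fi: "set_integrable lborel {p..q} f" and gi: "set_integrable lborel {p..q} g"
    using F G pq by (auto simp: ac_on_def intro: set_integrable_subinterval)
  have int0: "integrable lborel f0" "integrable lborel g0"
    using fi gi by (auto simp: f0_def[abs_def] g0_def[abs_def] set_integrable_def)
  have F0: "(LBINT s:{..t}. f0 s) = F t - F p" and G0: "(LBINT s:{..t}. g0 s) = G t - G p" if "t \<in> {p..q}" for t
  proof -
    have *: "indicat_real {..t} s * (indicat_real {p..q} s * k) = indicat_real {p..t} s * k" for s k :: real
      using that by (auto simp: indicator_def)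
    show "(LBINT s:{..t}. f0 s) = F t - F p" "(LBINT s:{..t}. g0 s) = G t - G p"
      using ac_on_integral[OF F, of p t] ac_on_integral[OF G, of p t] that pq
      by (auto simp: set_lebesgue_integral_def f0_def g0_def *)
  qed
  have "(LBINT t. g0 t * (LBINT s:{..t}. f0 s)) = (LBINT t:{p..q}. g t * (F t - F p))"
    unfolding set_lebesgue_integral_def[of _ "{p..q}"]
    using F0 by (intro Bochner_Integration.integral_cong) (auto simp: g0_def indicator_def)
  also have "\<dots> = (LBINT t:{p..q}. F t * g t) - F p * (LBINT t:{p..q}. g t)"
    using set_integrable_subinterval[OF int2, of p q] gi pq
    by (simp add: right_diff_distrib mult.commute)
  finally have 1: "(LBINT t. g0 t * (LBINT s:{..t}. f0 s))
      = (LBINT t:{p..q}. F t * g t) - F p * (G q - G p)"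
    using ac_on_integral[OF G, of p q] pq by simp
  have "(LBINT t. f0 t * (LBINT s:{..t}. g0 s)) = (LBINT t:{p..q}. f t * (G t - G p))"
    unfolding set_lebesgue_integral_def[of _ "{p..q}"]
    using G0 by (intro Bochner_Integration.integral_cong) (auto simp: f0_def indicator_def)
  also have "\<dots> = (LBINT t:{p..q}. f t * G t) - (LBINT t:{p..q}. f t) * G p"
    using set_integrable_subinterval[OF int1, of p q] fi pq
    by (simp add: right_diff_distrib)
  finally have 2: "(LBINT t. f0 t * (LBINT s:{..t}. g0 s))
      = (LBINT t:{p..q}. f t * G t) - (F q - F p) * G p"
    using ac_on_integral[OF F, of p q] pq by simp
  have 3: "(LBINT t. f0 t) = F q - F p" "(LBINT t. g0 t) = G q - G p"
    using ac_on_integral[OF F, of p q] ac_on_integral[OF G, of p q] pq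
    by (auto simp: f0_def g0_def set_lebesgue_integral_def)
  have "(LBINT t:{p..q}. f t * G t + F t * g t) = (LBINT t:{p..q}. f t * G t) + (LBINT t:{p..q}. F t * g t)"
    using set_integrable_subinterval[OF int1, of p q] set_integrable_subinterval[OF int2, of p q] pq
    by (intro set_integral_add) auto
  then show "(LBINT t:{p..q}. f t * G t + F t * g t) = F q * G q - F p * G p"
    using integral_parts_Fubini[OF int0] unfolding 1 2 3 by (simp add: algebra_simps)
qed

text \<open>The Borel sets over which the integral vanishes are closed under complements and
  countable disjoint unions, so intervals suffice.\<close>

lemma AE_zero_of_interval_integrals:
  fixes f :: "real \<Rightarrow> real"
  assumes int: "set_integrable lborel {c..d} f"
    and zero: "\<And>p q. c < p \<Longrightarrow> p < q \<Longrightarrow> q < d \<Longrightarrow> (LBINT s:{p..q}. f s) = 0"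
  shows "AE s in lborel. s \<in> {c<..<d} \<longrightarrow> f s = 0"
proof (cases "c < d")
  case True
  \<comment> \<open>The hypothesis reaches only intervals strictly inside; continuity of the
    primitive extends it to those that touch \<open>c\<close> or \<open>d\<close>.\<close>
  define F where "F z = (LBINT s:{c..z}. f s)" for z
  have ac: "ac_on c d F f"
    using ac_on_primitive[OF int, of 0] by (simp add: F_def[abs_def])
  have Fc: "F c = 0"
    using ac_on_integral[OF ac, of c c] True by (simp add: F_def)
  have const: "F z = F ((c + d) / 2)" if "z \<in> {c<..<d}" for z
  proof (cases z "(c + d) / 2" rule: linorder_cases)
    case less
    then show ?thesis
      using that True zero[of z "(c + d) / 2"] ac_on_integral[OF ac, of z "(c + d) / 2"] by auto
  next
    case greater
    then show ?thesis
      using that True zero[of "(c + d) / 2" z] ac_on_integral[OF ac, of "(c + d) / 2" z] by auto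
  next
    case equal
    then show ?thesis by (rule arg_cong)
  qed
  have closure: "closure {c<..<d} = {c..d}"
    using True by simp
  have mid: "F z = F ((c + d) / 2)" if z: "z \<in> {c..d}" for z
  proof (rule continuous_constant_on_closure[of "{c<..<d}" F])
    show "continuous_on (closure {c<..<d}) F"
      unfolding closure by (rule ac_on_continuous[OF ac])
    show "z \<in> closure {c<..<d}"
      unfolding closure by (rule z)
  qed (rule const)
  have F0: "F z = 0" if "z \<in> {c..d}" for z
    using mid[OF that] mid[of c] Fc True by simp
  define f0 where "f0 s = indicator {c..d} s *\<^sub>R f s" for s
  have f0: "integrable lborel f0"
    using int by (simp add: f0_def[abs_def] set_integrable_def)
  have f0_int: "set_integrable lborel A f0" if "A \<in> sets borel" for A
    using f0 that unfolding set_integrable_def by (intro integrable_mult_indicator) auto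
  have total: "(LBINT s. f0 s) = 0"
    using ac_on_integral[OF ac, of c d] F0 True by (simp add: f0_def[abs_def] set_lebesgue_integral_def)
  have "(LBINT s:A. f0 s) = 0" if "A \<in> sets borel" for A
    using that
  proof (induction A rule: borel_set_induct)
    case empty
    then show ?case by (simp add: set_lebesgue_integral_def)
  next
    case (interval p q)
    have "(LBINT s:{p..q}. f0 s) = (LBINT s:{max c p..min d q}. f s)"
      unfolding set_lebesgue_integral_def f0_def
      by (intro Bochner_Integration.integral_cong) (auto simp: indicator_def)
    also have "\<dots> = 0"
    proof (cases "max c p \<le> min d q")
      case True
      then show ?thesis
        using ac_on_integral[OF ac, of "max c p" "min d q"] F0 by simp
    qed (simp add: set_lebesgue_integral_def)
    finally show ?case .
  next
    case (compl A)
    have "(LBINT s. f0 s) = (LBINT s:A \<union> - A. f0 s)"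
      by (simp add: set_lebesgue_integral_def)
    also have "\<dots> = (LBINT s:A. f0 s) + (LBINT s:-A. f0 s)"
      using compl by (intro set_integral_Un f0_int) auto
    finally show ?case
      using compl total by simp
  next
    case (union A)
    have "(LBINT s:(\<Union>i. A i). f0 s) = (\<Sum>i. LBINT s:A i. f0 s)"
      using union by (intro lebesgue_integral_countable_add f0_int) (auto simp: disjoint_family_on_def)
    then show ?case
      using union by simp
  qed
  then have "AE s in lborel. f0 s = 0"
    by (intro density_unique_real f0) (auto simp: set_lebesgue_integral_def)
  then show ?thesis
    by eventually_elim (auto simp: f0_def)
qed auto

section \<open>Weak derivatives\<close>

lemma countable_endpoints:
  fixes c d :: real
  shows "({c..d} - {c<..<d}) \<union> ({c<..<d} - {c..d}) \<subseteq> {c, d}"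
  by auto

lemma LBINT_open_interval:
  fixes f :: "real \<Rightarrow> real"
  shows "(LBINT s:{c<..<d}. f s) = (LBINT s:{c..d}. f s)"
  using countable_endpoints[of c d]
  by (intro set_integral_discrete_difference[where X = "{c, d}"]) auto

lemma set_integrable_open_interval:
  fixes f :: "real \<Rightarrow> real"
  shows "set_integrable lborel {c<..<d} f \<longleftrightarrow> set_integrable lborel {c..d} f"
  using countable_endpoints[of c d]
  by (intro set_integrable_discrete_difference[where X = "{c, d}"]) auto

lemma sq_integrable_on_integrable:
  assumes "sq_integrable_on {c<..<d} f"
  shows "set_integrable lborel {c..d} f"
proof -
  have "set_integrable lborel {c<..<d} (\<lambda>z. 1 + (f z)\<^sup>2)"
  proof (rule set_integral_add)
    have "set_integrable lborel {c..d} (\<lambda>_. 1 :: real)"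
      unfolding set_integrable_def by (intro borel_integrable_compact) auto
    then show "set_integrable lborel {c<..<d} (\<lambda>_. 1 :: real)"
      by (simp add: set_integrable_open_interval)
  qed (use assms in \<open>simp add: sq_integrable_on_def\<close>)
  then have "set_integrable lborel {c<..<d} f"
  proof (rule set_integrable_bound)
    show "set_borel_measurable lborel {c<..<d} f"
      using assms by (simp add: sq_integrable_on_def)
    have "norm (f z) \<le> norm (1 + (f z)\<^sup>2)" for z
      using sum_squares_bound[of "1" "\<bar>f z\<bar>"] by simp
    then show "AE z in lborel. z \<in> {c<..<d} \<longrightarrow> norm (f z) \<le> norm (1 + (f z)\<^sup>2)"
      by simp
  qed
  then show ?thesis
    by (simp add: set_integrable_open_interval)
qed

lemma test_fun_deriv:
  assumes "test_fun c d \<phi>"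
  shows "(\<phi> has_real_derivative deriv \<phi> z) (at z)" "continuous_on UNIV (deriv \<phi>)"
proof -
  obtain D where D: "\<And>x. (\<phi> has_vector_derivative D x) (at x)" "continuous_on UNIV D"
    using assms by (auto simp: test_fun_def C1_differentiable_on_def)
  have "(\<phi> has_real_derivative D x) (at x)" for x
    using D(1)[of x] by (simp add: has_real_derivative_iff_has_vector_derivative)
  then have "deriv \<phi> = D" by (auto intro: DERIV_imp_deriv)
  with D show "(\<phi> has_real_derivative deriv \<phi> z) (at z)" "continuous_on UNIV (deriv \<phi>)"
    by (auto simp: has_real_derivative_iff_has_vector_derivative)
qed

lemma test_fun_zero: "test_fun c d \<phi> \<Longrightarrow> z \<notin> {c<..<d} \<Longrightarrow> \<phi> z = 0"
  using closure_subset[of "{z. \<phi> z \<noteq> 0}"] by (auto simp: test_fun_def)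

lemma test_fun_ac: "test_fun c d \<phi> \<Longrightarrow> ac_on c d \<phi> (deriv \<phi>)"
  by (intro ac_on_C1)
    (auto intro: has_field_derivative_at_within test_fun_deriv continuous_on_subset)

lemma ac_on_test_fun:
  assumes "ac_on c d F g" "test_fun c d \<phi>" "c \<le> d"
  shows "(LBINT z:{c<..<d}. F z * deriv \<phi> z) = - (LBINT z:{c<..<d}. g z * \<phi> z)"
proof -
  note \<phi> = test_fun_ac[OF assms(2)]
  have "(LBINT z:{c..d}. g z * \<phi> z + F z * deriv \<phi> z) = 0"
    using ac_on_integral[OF ac_on_mult[OF assms(1) \<phi>], of c d] assms(3) test_fun_zero[OF assms(2)] by simp
  moreover have "(LBINT z:{c..d}. g z * \<phi> z + F z * deriv \<phi> z)
      = (LBINT z:{c..d}. g z * \<phi> z) + (LBINT z:{c..d}. F z * deriv \<phi> z)"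
    using set_integrable_mult_continuous[OF ac_on_integrable[OF assms(1)] ac_on_continuous[OF \<phi>]]
      set_integrable_mult_continuous[OF ac_on_integrable[OF \<phi>] ac_on_continuous[OF assms(1)]]
    by (intro set_integral_add) (auto simp: mult.commute)
  ultimately show ?thesis
    by (simp add: LBINT_open_interval)
qed

lemma ac_imp_weak_deriv:
  assumes "ac_on c d F g" "c \<le> d" "sq_integrable_on {c<..<d} g"
    and "sq_integrable_on {c<..<d} f" "AE z in lborel. z \<in> {c<..<d} \<longrightarrow> F z = f z"
  shows "weak_deriv c d f g"
  unfolding weak_deriv_def
proof (intro conjI allI impI assms)
  fix \<phi> assume \<phi>: "test_fun c d \<phi>"
  have m: "set_borel_measurable lborel {c<..<d} f" "set_borel_measurable lborel {c<..<d} F"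
    using assms(4) set_integrable_open_interval[of c d F]
      borel_integrable_compact[OF _ ac_on_continuous[OF assms(1)]]
    by (auto simp: sq_integrable_on_def set_borel_measurable_def set_integrable_def)
  have [measurable]: "deriv \<phi> \<in> borel_measurable borel"
    using test_fun_deriv(2)[OF \<phi>] by (rule borel_measurable_continuous_onI)
  have "(LBINT z:{c<..<d}. f z * deriv \<phi> z) = (LBINT z:{c<..<d}. F z * deriv \<phi> z)"
  proof (rule LBINT_cong_AE_on)
    have *: "indicator {c<..<d} z *\<^sub>R (h z * deriv \<phi> z) = (indicator {c<..<d} z *\<^sub>R h z) * deriv \<phi> z" for h z
      by simp
    show "set_borel_measurable lborel {c<..<d} (\<lambda>z. f z * deriv \<phi> z)"
      "set_borel_measurable lborel {c<..<d} (\<lambda>z. F z * deriv \<phi> z)"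
      using m unfolding set_borel_measurable_def * by measurable
    show "AE s in lborel. s \<in> {c<..<d} \<longrightarrow> f s * deriv \<phi> s = F s * deriv \<phi> s"
      using assms(5) by eventually_elim auto
  qed
  then show "(LBINT z:{c<..<d}. f z * deriv \<phi> z) = - (LBINT z:{c<..<d}. g z * \<phi> z)"
    using ac_on_test_fun[OF assms(1) \<phi> assms(2)] by simp
qed

text \<open>Ramps of slope \<open>n\<close> at \<open>p\<close> and \<open>q\<close>, cut off at 1,
  approximate the indicator of the interval. As test functions are only \<open>C\<^sup>1\<close>,
  their derivatives may be piecewise linear.\<close>

definition trapezoid :: "real \<Rightarrow> real \<Rightarrow> nat \<Rightarrow> real \<Rightarrow> real" where
  "trapezoid p q n z = max 0 (min 1 (real n * min (z - p) (q - z)))"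

lemma trapezoid_bounds: "0 \<le> trapezoid p q n z" "trapezoid p q n z \<le> 1"
  by (auto simp: trapezoid_def)

lemma trapezoid_outside: "z \<notin> {p<..<q} \<Longrightarrow> trapezoid p q n z = 0"
proof -
  assume "z \<notin> {p<..<q}"
  then have "real n * min (z - p) (q - z) \<le> 0"
    by (intro mult_nonneg_nonpos) auto
  then show ?thesis by (simp add: trapezoid_def)
qed

lemma continuous_trapezoid: "continuous_on S (trapezoid p q n)"
  unfolding trapezoid_def[abs_def] by (intro continuous_intros)

lemma trapezoid_tendsto: "(\<lambda>n. trapezoid p q n z) \<longlonglongrightarrow> indicator {p<..<q} z"
proof (cases "z \<in> {p<..<q}")
  case True
  define e where "e = min (z - p) (q - z)"
  have e: "0 < e" using True by (auto simp: e_def)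
  obtain N :: nat where N: "1 / e < real N"
    using reals_Archimedean2 by blast
  have "trapezoid p q n z = 1" if "N \<le> n" for n
  proof -
    have "1 / e < real n" using N that by simp
    then have "1 < real n * e"
      using e by (simp add: field_simps)
    then show ?thesis by (simp add: trapezoid_def e_def[symmetric])
  qed
  then have "\<forall>\<^sub>F n in sequentially. trapezoid p q n z = 1"
    unfolding eventually_sequentially by blast
  then show ?thesis
    using True by (simp add: tendsto_eventually)
qed (simp add: trapezoid_outside)

lemma trapezoid_integral_tendsto:
  fixes v :: "real \<Rightarrow> real"
  assumes v: "set_integrable lborel {c..d} v" and pq: "c \<le> p" "q \<le> d"
  shows "(\<lambda>n. LBINT z:{c..d}. v z * trapezoid p q n z) \<longlonglongrightarrow> (LBINT z:{p..q}. v z)"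
proof -
  have m: "(\<lambda>z. indicat_real {c..d} z * v z) \<in> borel_measurable borel"
    using v by (auto simp: set_integrable_def)
  have t: "trapezoid p q n \<in> borel_measurable borel" for n
    by (intro borel_measurable_continuous_onI continuous_trapezoid)
  have meas: "(\<lambda>z. indicat_real {c..d} z *\<^sub>R (v z * trapezoid p q n z)) \<in> borel_measurable borel" for n
    using borel_measurable_times[OF m t[of n]] by (simp add: mult.assoc)
  have "(\<lambda>n. LBINT z. indicator {c..d} z *\<^sub>R (v z * trapezoid p q n z)) \<longlonglongrightarrow> (LBINT z. indicator {p<..<q} z *\<^sub>R v z)"
  proof (rule integral_dominated_convergence[where w = "\<lambda>z. \<bar>indicator {c..d} z *\<^sub>R v z\<bar>"])
    show "(\<lambda>z. indicat_real {p<..<q} z *\<^sub>R v z) \<in> borel_measurable lborel"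
    proof -
      have "{p<..<q} \<subseteq> {c..d}" using pq by auto
      then have "set_integrable lborel {p<..<q} v"
        by (intro set_integrable_subset[OF v]) auto
      then show ?thesis by (auto simp: set_integrable_def)
    qed
    show "integrable lborel (\<lambda>z. \<bar>indicator {c..d} z *\<^sub>R v z\<bar>)"
      using v by (intro integrable_abs) (simp add: set_integrable_def)
    show "AE z in lborel. (\<lambda>n. indicat_real {c..d} z *\<^sub>R (v z * trapezoid p q n z)) \<longlonglongrightarrow> indicat_real {p<..<q} z *\<^sub>R v z"
    proof (rule AE_I2)
      fix z
      have "(\<lambda>n. indicat_real {c..d} z *\<^sub>R (v z * trapezoid p q n z))
          \<longlonglongrightarrow> indicat_real {c..d} z *\<^sub>R (v z * indicator {p<..<q} z)"
        by (intro tendsto_intros trapezoid_tendsto)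
      also have "indicat_real {c..d} z *\<^sub>R (v z * indicator {p<..<q} z) = indicat_real {p<..<q} z *\<^sub>R v z"
        using pq by (auto simp: indicator_def)
      finally show "(\<lambda>n. indicat_real {c..d} z *\<^sub>R (v z * trapezoid p q n z)) \<longlonglongrightarrow> indicat_real {p<..<q} z *\<^sub>R v z" .
    qed
    fix n
    show "AE z in lborel. norm (indicat_real {c..d} z *\<^sub>R (v z * trapezoid p q n z)) \<le> \<bar>indicat_real {c..d} z *\<^sub>R v z\<bar>"
    proof (rule AE_I2)
      fix z
      have "\<bar>v z\<bar> * \<bar>trapezoid p q n z\<bar> \<le> \<bar>v z\<bar> * 1"
        using trapezoid_bounds[of p q n z] by (intro mult_left_mono) auto
      then show "norm (indicat_real {c..d} z *\<^sub>R (v z * trapezoid p q n z)) \<le> \<bar>indicat_real {c..d} z *\<^sub>R v z\<bar>"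
        by (auto simp: indicator_def abs_mult)
    qed
  next
    show "(\<lambda>z. indicat_real {c..d} z *\<^sub>R (v z * trapezoid p q n z)) \<in> borel_measurable lborel" for n
      using meas by simp
  qed
  then show ?thesis
    unfolding set_lebesgue_integral_def[symmetric] LBINT_open_interval .
qed

text \<open>A primitive of \<open>\<psi>\<close> is constant to the left of \<open>p\<close> and to
  the right of \<open>q\<close>; zero mean says that the two constants agree.\<close>

lemma zero_mean_test_fun:
  assumes \<psi>: "continuous_on UNIV \<psi>" "\<And>z. z \<notin> {p<..<q} \<Longrightarrow> \<psi> z = 0" "(LBINT z:{c..d}. \<psi> z) = 0"
    and pq: "c < p" "q < d" "c < d"
  obtains \<phi> where "test_fun c d \<phi>" "deriv \<phi> = \<psi>"
proof -
  have "\<exists>\<Psi>. \<forall>x::real. -\<infinity> < ereal x \<longrightarrow> ereal x < \<infinity> \<longrightarrow> (\<Psi> has_vector_derivative \<psi> x) (at x)"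
    using \<psi>(1) by (intro einterval_antiderivative) (auto simp: continuous_on_eq_continuous_at)
  then obtain \<Psi> where \<Psi>: "\<And>x. (\<Psi> has_real_derivative \<psi> x) (at x)"
    by (auto simp: has_real_derivative_iff_has_vector_derivative)
  have ac: "ac_on A B \<Psi> \<psi>" for A B
    using \<psi>(1) by (intro ac_on_C1) (auto intro: has_field_derivative_at_within \<Psi> continuous_on_subset)
  have const: "\<Psi> B = \<Psi> A" if "A \<le> B" "\<And>z. z \<in> {A..B} \<Longrightarrow> \<psi> z = 0" for A B
  proof -
    have "(LBINT s:{A..B}. \<psi> s) = (LBINT s:{A..B}. 0)"
      using that by (intro set_lebesgue_integral_cong) auto
    then show ?thesis
      using ac_on_integral[OF ac, of A A B B] that(1) by (simp add: set_lebesgue_integral_def)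
  qed
  have cd: "\<Psi> d = \<Psi> c"
    using ac_on_integral[OF ac, of c c d d] \<psi>(3) pq by simp
  define \<phi> where "\<phi> z = \<Psi> z - \<Psi> c" for z
  have D: "(\<phi> has_real_derivative \<psi> z) (at z)" for z
    unfolding \<phi>_def[abs_def] by (auto intro!: derivative_eq_intros \<Psi>)
  have zero: "\<phi> z = 0" if "z \<notin> {p..q}" for z
  proof (cases "z < p")
    case True
    then show ?thesis
      using const[of z c] const[of c z] \<psi>(2) pq by (cases "z \<le> c") (auto simp: \<phi>_def)
  next
    case False
    with that have "q < z" by auto
    then show ?thesis
      using const[of z d] const[of d z] \<psi>(2) pq cd by (cases "z \<le> d") (auto simp: \<phi>_def)
  qed
  have "test_fun c d \<phi>"
    unfolding test_fun_def C1_differentiable_on_def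
  proof (intro conjI exI[of _ \<psi>] ballI \<psi>)
    show "(\<phi> has_vector_derivative \<psi> x) (at x)" for x
      using D by (simp add: has_real_derivative_iff_has_vector_derivative)
    have "closure {z. \<phi> z \<noteq> 0} \<subseteq> {p..q}"
    proof (rule closure_minimal)
      show "{z. \<phi> z \<noteq> 0} \<subseteq> {p..q}" using zero by blast
    qed simp
    then show "closure {z. \<phi> z \<noteq> 0} \<subseteq> {c<..<d}"
      using pq by auto
  qed
  moreover have "deriv \<phi> = \<psi>"
    using D by (auto intro: DERIV_imp_deriv)
  ultimately show thesis
    by (rule that)
qed

text \<open>Subtracting a multiple of one fixed bump from an arbitrary trapezoid makes its mean
  zero, so the difference is the derivative of a test function. Hence \<open>u - K\<close>
  annihilates every trapezoid and, in the limit, has integral zero over every interval.\<close>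

lemma du_Bois_Reymond:
  assumes u: "set_integrable lborel {c..d} u" and cd: "c < d"
    and zero: "\<And>\<phi>. test_fun c d \<phi> \<Longrightarrow> (LBINT z:{c..d}. u z * deriv \<phi> z) = 0"
  obtains K where "AE z in lborel. z \<in> {c<..<d} \<longrightarrow> u z = K"
proof -
  define p0 q0 where "p0 = (2 * c + d) / 3" and "q0 = (c + 2 * d) / 3"
  have pq0: "c < p0" "p0 < q0" "q0 < d"
    using cd by (auto simp: p0_def q0_def)
  have one: "set_integrable lborel {c..d} (\<lambda>_. 1 :: real)"
    unfolding set_integrable_def by (intro borel_integrable_compact) auto
  have "(\<lambda>n. LBINT z:{c..d}. 1 * trapezoid p0 q0 n z) \<longlonglongrightarrow> (LBINT z:{p0..q0}. 1)"
    using pq0 by (intro trapezoid_integral_tendsto one) auto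
  moreover have "(LBINT z:{p0..q0}. 1) = q0 - p0"
    using pq0 by (simp add: set_lebesgue_integral_def)
  ultimately have "\<forall>\<^sub>F n in sequentially. 0 < (LBINT z:{c..d}. 1 * trapezoid p0 q0 n z)"
    using pq0 by (intro order_tendstoD(1)) auto
  then obtain n0 where n0: "0 < (LBINT z:{c..d}. trapezoid p0 q0 n0 z)"
    by (auto simp: eventually_sequentially)
  define m0 where "m0 = (LBINT z:{c..d}. trapezoid p0 q0 n0 z)"
  \<comment> \<open>The mean of \<open>u\<close> against the bump, the only value the constant can
    have.\<close>
  define K where "K = (LBINT z:{c..d}. u z * trapezoid p0 q0 n0 z) / m0"
  have trapezoid_int: "set_integrable lborel {c..d} (trapezoid p q n)" for p q n
    unfolding set_integrable_def by (intro borel_integrable_compact continuous_trapezoid) auto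
  have utrap_int: "set_integrable lborel {c..d} (\<lambda>z. u z * trapezoid p q n z)" for p q n
    by (intro set_integrable_mult_continuous u continuous_trapezoid)
  have test: "(LBINT z:{c..d}. (u z - K) * trapezoid p q n z) = 0" if pq: "c < p" "q < d" for p q n
  proof -
    define r where "r = (LBINT z:{c..d}. trapezoid p q n z) / m0"
    define \<psi> where "\<psi> z = trapezoid p q n z - r * trapezoid p0 q0 n0 z" for z
    have "(LBINT z:{c..d}. \<psi> z) = (LBINT z:{c..d}. trapezoid p q n z) - r * m0"
      unfolding \<psi>_def m0_def by (subst set_integral_diff) (auto simp: trapezoid_int)
    then have mean: "(LBINT z:{c..d}. \<psi> z) = 0"
      using n0 by (simp add: r_def m0_def)
    have \<psi>_cont: "continuous_on UNIV \<psi>"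
      unfolding \<psi>_def[abs_def] by (intro continuous_intros continuous_trapezoid)
    have \<psi>_zero: "\<psi> z = 0" if "z \<notin> {min p p0<..<max q q0}" for z
    proof -
      have "z \<notin> {p<..<q}" "z \<notin> {p0<..<q0}" using that by auto
      then show ?thesis by (simp add: \<psi>_def trapezoid_outside)
    qed
    have "c < min p p0" "max q q0 < d" using pq pq0 by auto
    then obtain \<phi> where \<phi>: "test_fun c d \<phi>" "deriv \<phi> = \<psi>"
      using zero_mean_test_fun[OF \<psi>_cont \<psi>_zero mean _ _ cd] by metis
    have "(LBINT z:{c..d}. u z * \<psi> z) = (LBINT z:{c..d}. u z * trapezoid p q n z - r * (u z * trapezoid p0 q0 n0 z))"
      unfolding \<psi>_def right_diff_distrib by (simp only: mult.left_commute)
    also have "\<dots> = (LBINT z:{c..d}. u z * trapezoid p q n z) - (LBINT z:{c..d}. r * (u z * trapezoid p0 q0 n0 z))"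
      by (intro set_integral_diff utrap_int set_integrable_mult_right)
    also have "(LBINT z:{c..d}. r * (u z * trapezoid p0 q0 n0 z)) = r * (K * m0)"
      using n0 by (simp add: K_def m0_def)
    also have "r * (K * m0) = (LBINT z:{c..d}. K * trapezoid p q n z)"
      using n0 by (simp add: r_def m0_def)
    also have "(LBINT z:{c..d}. u z * trapezoid p q n z) - \<dots> = (LBINT z:{c..d}. u z * trapezoid p q n z - K * trapezoid p q n z)"
      by (intro set_integral_diff(2)[symmetric] utrap_int trapezoid_int set_integrable_mult_right)
    finally show ?thesis
      using zero[OF \<phi>(1)] \<phi>(2) by (simp add: left_diff_distrib)
  qed
  have uK: "set_integrable lborel {c..d} (\<lambda>z. u z - K)"
    using u one set_integrable_mult_right[of K lborel "{c..d}" "\<lambda>_. 1"] by (intro set_integral_diff) auto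
  have "AE z in lborel. z \<in> {c<..<d} \<longrightarrow> u z - K = 0"
  proof (rule AE_zero_of_interval_integrals[OF uK])
    fix p q assume pq: "c < p" "p < q" "q < d"
    have "(\<lambda>n. LBINT z:{c..d}. (u z - K) * trapezoid p q n z) \<longlonglongrightarrow> (LBINT z:{p..q}. u z - K)"
      using pq by (intro trapezoid_integral_tendsto uK) auto
    then show "(LBINT z:{p..q}. u z - K) = 0"
      using pq by (simp add: test LIMSEQ_const_iff)
  qed
  then have "AE z in lborel. z \<in> {c<..<d} \<longrightarrow> u z = K"
    by eventually_elim auto
  then show thesis by (rule that)
qed

text \<open>Subtracting a primitive of \<open>g\<close> from \<open>f\<close> leaves a function with
  weak derivative zero, which is constant by \<open>du_Bois_Reymond\<close>.\<close>

lemma weak_deriv_imp_ac: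
  assumes w: "weak_deriv c d f g" and f: "sq_integrable_on {c<..<d} f" and cd: "c < d"
  obtains F where "ac_on c d F g" "AE z in lborel. z \<in> {c<..<d} \<longrightarrow> F z = f z"
proof -
  have gi: "set_integrable lborel {c..d} g" and fi: "set_integrable lborel {c..d} f"
    using w f by (auto simp: weak_deriv_def intro: sq_integrable_on_integrable)
  define G where "G z = (LBINT s:{c..z}. g s)" for z
  have G: "ac_on c d G g"
    using ac_on_primitive[OF gi, of 0] by (simp add: G_def[abs_def])
  have Gi: "set_integrable lborel {c..d} G"
    unfolding set_integrable_def using ac_on_continuous[OF G] by (intro borel_integrable_compact) auto
  have "(LBINT z:{c..d}. (f z - G z) * deriv \<phi> z) = 0" if \<phi>: "test_fun c d \<phi>" for \<phi>
  proof -
    have c: "continuous_on {c..d} (deriv \<phi>)"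
      using test_fun_deriv(2)[OF \<phi>] continuous_on_subset by blast
    have "(LBINT z:{c..d}. (f z - G z) * deriv \<phi> z)
        = (LBINT z:{c..d}. f z * deriv \<phi> z) - (LBINT z:{c..d}. G z * deriv \<phi> z)"
      unfolding left_diff_distrib by (intro set_integral_diff set_integrable_mult_continuous fi Gi c)
    then show ?thesis
      using w ac_on_test_fun[OF G \<phi>] cd \<phi> by (simp add: weak_deriv_def LBINT_open_interval)
  qed
  then obtain K where K: "AE z in lborel. z \<in> {c<..<d} \<longrightarrow> f z - G z = K"
    using du_Bois_Reymond[of c d "\<lambda>z. f z - G z"] fi Gi cd by auto
  show thesis
  proof (rule that)
    show "ac_on c d (\<lambda>z. K + G z) g"
      using ac_on_primitive[OF gi, of K] by (simp add: G_def[abs_def])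
    show "AE z in lborel. z \<in> {c<..<d} \<longrightarrow> K + G z = f z"
      using K by eventually_elim auto
  qed
qed

text \<open>The part of the open interval where \<open>F\<close> and \<open>G\<close> differ is open
  and null, hence empty; the end points follow by continuity. This makes the description in
  \<open>pt_value\<close> unique.\<close>

lemma continuous_AE_eq:
  fixes F G :: "real \<Rightarrow> real"
  assumes "continuous_on {c..d} F" "continuous_on {c..d} G" "c < d"
    and ae: "AE z in lborel. z \<in> {c<..<d} \<longrightarrow> F z = G z" and z: "z \<in> {c..d}"
  shows "F z = G z"
proof -
  define S where "S = {z \<in> {c<..<d}. F z - G z \<in> - {0}}"
  have "open S"
    unfolding S_def using assms(1,2)
    by (intro continuous_open_preimage[unfolded vimage_def Int_def, simplified] continuous_intros)
      (auto intro: continuous_on_subset)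
  have "S \<in> null_sets lborel"
  proof (rule AE_iff_null_sets[THEN iffD2])
    show "S \<in> sets lborel" using \<open>open S\<close> by simp
    show "AE x in lborel. x \<notin> S"
      using ae by eventually_elim (auto simp: S_def)
  qed
  then have "negligible S"
    by (simp add: negligible_iff_null_sets null_sets_completionI)
  then have "S = {}"
    using open_not_negligible[OF \<open>open S\<close>] by auto
  then have eq: "F x - G x = 0" if "x \<in> {c<..<d}" for x
    using that by (auto simp: S_def)
  have closure: "closure {c<..<d} = {c..d}"
    using assms by simp
  have "(\<lambda>x. F x - G x) z = 0"
  proof (rule continuous_constant_on_closure[of "{c<..<d}" "\<lambda>x. F x - G x"])
    show "continuous_on (closure {c<..<d}) (\<lambda>x. F x - G x)"
      unfolding closure using assms by (intro continuous_intros)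
    show "z \<in> closure {c<..<d}"
      unfolding closure by (rule z)
  qed (rule eq)
  then show ?thesis by simp
qed

lemma pt_value_eq:
  assumes "continuous_on {c..d} F" "c < d" "AE z in lborel. z \<in> {c<..<d} \<longrightarrow> F z = f z" "p \<in> {c..d}"
  shows "pt_value c d f p = F p"
  unfolding pt_value_def
proof (rule the_equality)
  show "\<exists>G. continuous_on {c..d} G \<and> (AE z in lborel. z \<in> {c<..<d} \<longrightarrow> G z = f z) \<and> G p = F p"
    using assms by auto
  fix v assume "\<exists>G. continuous_on {c..d} G \<and> (AE z in lborel. z \<in> {c<..<d} \<longrightarrow> G z = f z) \<and> G p = v"
  then obtain G where G: "continuous_on {c..d} G" "AE z in lborel. z \<in> {c<..<d} \<longrightarrow> G z = f z" "G p = v"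
    by auto
  have "AE z in lborel. z \<in> {c<..<d} \<longrightarrow> G z = F z"
    using G(2) assms(3) by eventually_elim auto
  with G assms show "v = F p"
    using continuous_AE_eq[of c d G F p] by auto
qed

lemma ac_on_deriv_unique:
  assumes F: "ac_on c d F f" and G: "ac_on c d G g" and "c < d"
    and "AE z in lborel. z \<in> {c<..<d} \<longrightarrow> F z = G z"
  shows "AE z in lborel. z \<in> {c<..<d} \<longrightarrow> f z = g z"
proof -
  have eq: "F z = G z" if "z \<in> {c..d}" for z
    by (rule continuous_AE_eq[OF ac_on_continuous[OF F] ac_on_continuous[OF G] assms(3,4) that])
  note D = ac_on_diff[OF F G]
  have "AE z in lborel. z \<in> {c<..<d} \<longrightarrow> f z - g z = 0"
  proof (rule AE_zero_of_interval_integrals[OF ac_on_integrable[OF D]])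
    fix p q assume "c < p" "p < q" "q < d"
    then show "(LBINT s:{p..q}. f s - g s) = 0"
      using ac_on_integral[OF D, of p q] eq by simp
  qed
  then show ?thesis by eventually_elim auto
qed

text \<open>\<open>wderiv\<close> is an arbitrary choice; the continuous representatives show that
  any two weak derivatives agree almost everywhere.\<close>

lemma wderiv_ae:
  assumes ac: "ac_on c d F g" and "c < d" "sq_integrable_on {c<..<d} g"
    and f: "sq_integrable_on {c<..<d} f" and "AE z in lborel. z \<in> {c<..<d} \<longrightarrow> F z = f z"
  shows "AE z in lborel. z \<in> {c<..<d} \<longrightarrow> wderiv c d f z = g z"
proof -
  have "weak_deriv c d f g"
    using assms by (intro ac_imp_weak_deriv[OF ac]) auto
  then have "weak_deriv c d f (wderiv c d f)"
    unfolding wderiv_def by (rule someI[of "weak_deriv c d f" g])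
  then obtain G where G: "ac_on c d G (wderiv c d f)" "AE z in lborel. z \<in> {c<..<d} \<longrightarrow> G z = f z"
    using weak_deriv_imp_ac f \<open>c < d\<close> by metis
  show ?thesis
  proof (rule ac_on_deriv_unique[OF G(1) ac \<open>c < d\<close>])
    show "AE z in lborel. z \<in> {c<..<d} \<longrightarrow> G z = F z"
      using G(2) assms(5) by eventually_elim auto
  qed
qed

section \<open>The boundary form\<close>

lemma vector_4:
  "(vector [x, y, z, w] :: 'a::zero^4) $ 1 = x" "(vector [x, y, z, w] :: 'a^4) $ 2 = y"
  "(vector [x, y, z, w] :: 'a^4) $ 3 = z" "(vector [x, y, z, w] :: 'a^4) $ 4 = w"
  unfolding vector_def by simp_all

lemma P1_mult: "P1 *v v = vector [- v $ 2, - v $ 1]"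
  by (simp add: P1_def vec_eq_iff forall_2 matrix_vector_mult_def sum_2)

lemma Sigma_mult: "Sigma_mat *v v = vector [v $ 3, v $ 4, v $ 1, v $ 2]"
  by (simp add: Sigma_mat_def vec_eq_iff forall_4 matrix_vector_mult_def sum_4 vector_4)

text \<open>If \<open>W x = 0\<close>, choose \<open>w\<close> in the range of \<open>W\<^sup>T\<close> such that \<open>\<Sigma> x + w\<close> has the form \<open>(p, - p)\<close>,
  where \<open>\<Sigma>\<close> is negative; the mixed term vanishes as \<open>w\<close> is orthogonal to \<open>x\<close>.\<close>

lemma kernel_Sigma_nonpos:
  fixes W :: "real^4^2"
  assumes rank: "rank W = 2" and psd: "pos_semidef (W ** Sigma_mat ** transpose W)" and x: "W *v x = 0"
  shows "x $ 1 * x $ 3 + x $ 2 * x $ 4 \<le> 0"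
proof -
  define w where "w c = transpose W *v c" for c
  have w_lin: "linear w"
    unfolding w_def[abs_def] by (rule matrix_vector_mul_linear)
  have w_inner: "w c \<bullet> y = c \<bullet> (W *v y)" for c y
    unfolding w_def by (simp add: dot_lmul_matrix[symmetric])
  have w_nonneg: "0 \<le> w c $ 1 * w c $ 3 + w c $ 2 * w c $ 4" for c
  proof -
    have "0 \<le> c \<bullet> ((W ** Sigma_mat ** transpose W) *v c)"
      using psd by (simp add: pos_semidef_def)
    also have "(W ** Sigma_mat ** transpose W) *v c = W *v (Sigma_mat *v w c)"
      by (simp only: w_def matrix_vector_mul_assoc matrix_mul_assoc)
    also have "c \<bullet> \<dots> = w c \<bullet> (Sigma_mat *v w c)"
      by (simp add: w_inner)
    also have "\<dots> = 2 * (w c $ 1 * w c $ 3 + w c $ 2 * w c $ 4)"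
      by (simp add: Sigma_mult inner_vec_def sum_4 vector_4)
    finally show ?thesis by simp
  qed
  have w_inj: "c = 0" if "w c = 0" for c
  proof -
    have "inj ((*v) (transpose W))"
      using rank by (simp add: full_rank_injective[symmetric] rank_transpose)
    then show ?thesis
      using that by (metis w_def injD matrix_vector_mult_0_right)
  qed
  \<comment> \<open>\<open>L c = 0\<close> means that \<open>w c\<close> has the form
    \<open>(p, - p)\<close>, where \<open>v\<^sub>1 v\<^sub>3 + v\<^sub>2 v\<^sub>4\<close> equals
    \<open>- |p|\<^sup>2\<close>. As this form is nonnegative on the range of
    \<open>W\<^sup>T\<close>, \<open>L\<close> is injective, and its surjectivity provides the
    vector sought.\<close>
  define L :: "real^2 \<Rightarrow> real^2" where "L c = vector [w c $ 1 + w c $ 3, w c $ 2 + w c $ 4]" for c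
  have L_lin: "linear L"
    using linear_add[OF w_lin] linear_scale[OF w_lin]
    by (intro linearI) (auto simp: L_def vec_eq_iff forall_2 algebra_simps)
  have "c = 0" if "L c = 0" for c
  proof -
    have s: "w c $ 3 = - w c $ 1" "w c $ 4 = - w c $ 2"
      using that by (auto simp: L_def vec_eq_iff forall_2)
    then have "w c $ 1 * w c $ 1 + w c $ 2 * w c $ 2 \<le> 0"
      using w_nonneg[of c] by simp
    then have "w c $ 1 = 0" "w c $ 2 = 0"
      by (simp_all add: sum_squares_le_zero_iff)
    with s have "w c = 0"
      by (simp add: vec_eq_iff forall_4)
    then show ?thesis by (rule w_inj)
  qed
  then have "inj L"
    by (simp add: linear_injective_0[OF L_lin])
  then have "surj L"
    using L_lin linear_injective_imp_surjective by blast
  then obtain c where c: "L c = vector [- (x $ 1 + x $ 3), - (x $ 2 + x $ 4)]"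
    by (metis surjD)
  have s: "w c $ 3 = - w c $ 1 - x $ 1 - x $ 3" "w c $ 4 = - w c $ 2 - x $ 2 - x $ 4"
    using c by (auto simp: L_def vec_eq_iff forall_2)
  have orth: "w c $ 1 * x $ 1 + w c $ 2 * x $ 2 + w c $ 3 * x $ 3 + w c $ 4 * x $ 4 = 0"
    using w_inner[of c x] x by (simp add: inner_vec_def sum_4)
  \<comment> \<open>With \<open>q v = v\<^sub>1 v\<^sub>3 + v\<^sub>2 v\<^sub>4\<close> this is
    \<open>q (\<Sigma> x + w) = q x + x \<bullet> w + q w\<close>, whose left side is minus a sum of
    two squares.\<close>
  have "x $ 1 * x $ 3 + x $ 2 * x $ 4
      = - (x $ 3 + w c $ 1)\<^sup>2 - (x $ 4 + w c $ 2)\<^sup>2 - (w c $ 1 * w c $ 3 + w c $ 2 * w c $ 4)"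
    using orth unfolding s by (simp add: power2_eq_square algebra_simps)
  also have "\<dots> \<le> 0"
    using w_nonneg[of c] zero_le_power2[of "x $ 3 + w c $ 1"] zero_le_power2[of "x $ 4 + w c $ 2"] by linarith
  finally show ?thesis .
qed

text \<open>The ports \<open>f_bd\<close> and \<open>e_bd\<close> depend on \<open>e\<close> only
  through its end values, so the boundary condition is a linear equation in these.\<close>

definition boundary_map :: "real^4^2 \<Rightarrow> real^2 \<Rightarrow> real^2 \<Rightarrow> real^2" where
  "boundary_map W va vb = W *v stack ((1 / sqrt 2) *\<^sub>R (P1 *v vb - P1 *v va)) ((1 / sqrt 2) *\<^sub>R (vb + va))"

lemma stack_add: "stack (f + f') (e + e') = stack f e + stack f' e'"
  by (simp add: stack_def vec_eq_iff forall_4 vector_4)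

lemma stack_scaleR: "stack (r *\<^sub>R f) (r *\<^sub>R e) = r *\<^sub>R stack f e"
  by (simp add: stack_def vec_eq_iff forall_4 vector_4)

lemma boundary_map_add:
  "boundary_map W (va + va') (vb + vb') = boundary_map W va vb + boundary_map W va' vb'"
proof -
  have "(1 / sqrt 2) *\<^sub>R (P1 *v (vb + vb') - P1 *v (va + va'))
      = (1 / sqrt 2) *\<^sub>R (P1 *v vb - P1 *v va) + (1 / sqrt 2) *\<^sub>R (P1 *v vb' - P1 *v va')"
    by (simp add: matrix_vector_right_distrib algebra_simps)
  moreover have "(1 / sqrt 2) *\<^sub>R ((vb + vb') + (va + va'))
      = (1 / sqrt 2) *\<^sub>R (vb + va) + (1 / sqrt 2) *\<^sub>R (vb' + va')"
    by (simp add: algebra_simps)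
  ultimately show ?thesis
    unfolding boundary_map_def by (simp only: stack_add matrix_vector_right_distrib)
qed

lemma boundary_map_scaleR: "boundary_map W (r *\<^sub>R va) (r *\<^sub>R vb) = r *\<^sub>R boundary_map W va vb"
proof -
  have "(1 / sqrt 2) *\<^sub>R (P1 *v (r *\<^sub>R vb) - P1 *v (r *\<^sub>R va)) = r *\<^sub>R ((1 / sqrt 2) *\<^sub>R (P1 *v vb - P1 *v va))"
    by (simp add: matrix_vector_mult_scaleR algebra_simps)
  moreover have "(1 / sqrt 2) *\<^sub>R (r *\<^sub>R vb + r *\<^sub>R va) = r *\<^sub>R ((1 / sqrt 2) *\<^sub>R (vb + va))"
    by (simp add: algebra_simps)
  ultimately show ?thesis
    unfolding boundary_map_def by (simp only: stack_scaleR matrix_vector_mult_scaleR)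
qed

text \<open>The pairing of the two ports is
  \<open>va\<^sub>1 va\<^sub>2 - vb\<^sub>1 vb\<^sub>2\<close>, the cross terms cancelling because
  \<open>P1\<close> is symmetric; its sign is \<open>kernel_Sigma_nonpos\<close>.\<close>

lemma boundary_form_nonpos:
  assumes "rank W = 2" "pos_semidef (W ** Sigma_mat ** transpose W)" "boundary_map W va vb = 0"
  shows "va $ 1 * va $ 2 \<le> vb $ 1 * vb $ 2"
proof -
  define x where "x = stack ((1 / sqrt 2) *\<^sub>R (P1 *v vb - P1 *v va)) ((1 / sqrt 2) *\<^sub>R (vb + va))"
  have "x $ 1 * x $ 3 + x $ 2 * x $ 4 \<le> 0"
    using kernel_Sigma_nonpos[OF assms(1,2)] assms(3) by (simp add: x_def boundary_map_def)
  moreover have "x $ 1 * x $ 3 + x $ 2 * x $ 4 = va $ 1 * va $ 2 - vb $ 1 * vb $ 2"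
    by (simp add: x_def stack_def vector_4 P1_mult field_simps)
  ultimately show ?thesis by simp
qed

section \<open>The operator $\mathcal{J}_l$\<close>

lemma component_measurable [measurable]: "component i x \<in> borel_measurable borel"
  unfolding component_def by measurable

lemma component_sq_integrable_on:
  assumes "S \<in> sets borel"
  shows "sq_integrable_on S (component i x)"
proof -
  have "integrable lborel (\<lambda>z. (component i x z)\<^sup>2)"
  proof (rule Bochner_Integration.integrable_bound)
    show "integrable lborel (\<lambda>z. (norm (rep_l2 x z))\<^sup>2)"
      using sq_integrable_rep[of x] by (simp add: sq_integrable_def)
    have "\<bar>component i x z\<bar>\<^sup>2 \<le> (norm (rep_l2 x z))\<^sup>2" for z
      unfolding component_def by (intro power_mono component_le_norm_cart) auto
    then show "AE z in lborel. norm ((component i x z)\<^sup>2) \<le> norm ((norm (rep_l2 x z))\<^sup>2)"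
      by simp
  qed measurable
  then show ?thesis
    using assms unfolding sq_integrable_on_def set_borel_measurable_def set_integrable_def
    by (auto intro!: integrable_mult_indicator[where 'b = real, simplified])
qed

lemma component_integrable: "set_integrable lborel {c..d} (component i x)"
  by (intro sq_integrable_on_integrable component_sq_integrable_on) auto

lemma sq_integrable_on_uminus: "sq_integrable_on S f \<Longrightarrow> sq_integrable_on S (\<lambda>z. - f z)"
  by (auto simp: sq_integrable_on_def set_borel_measurable_def)

lemma borel_measurable_vec_if:
  fixes f g :: "'a \<Rightarrow> real"
  assumes "f \<in> borel_measurable M" "g \<in> borel_measurable M"
  shows "(\<lambda>z. \<chi> i. if i = j then f z else g z) \<in> borel_measurable M"
proof (rule borel_measurable_vec_lambda)
  show "(\<lambda>z. if i = j then f z else g z) \<in> borel_measurable M" for i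
    using assms by (cases "i = j") auto
qed

lemma norm_vec2_sq: "(norm (v :: real^2))\<^sup>2 = (v $ 1)\<^sup>2 + (v $ 2)\<^sup>2"
  unfolding power2_norm_eq_inner by (simp add: inner_vec_def sum_2 power2_eq_square)

text \<open>The graph of \<open>J\<close>: \<open>y = J e\<close>, witnessed by the absolutely continuous representatives of the
  components of \<open>e\<close>. The derivatives are those prescribed by \<open>y = P\<^sub>1 e'\<close>.\<close>

definition J_graph :: "real \<Rightarrow> real \<Rightarrow> real \<Rightarrow> l2 \<Rightarrow> l2 \<Rightarrow> (real \<Rightarrow> real) \<Rightarrow> (real \<Rightarrow> real) \<Rightarrow> (real \<Rightarrow> real) \<Rightarrow> bool"
  where
  "J_graph a b l e y E1 F1 E2 \<longleftrightarrow> e \<in> X_space a b \<and> y \<in> X_space a b \<and>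
     ac_on a l E1 (\<lambda>z. - component 2 y z) \<and> ac_on l b F1 (\<lambda>z. - component 2 y z) \<and>
     ac_on a b E2 (\<lambda>z. - component 1 y z) \<and>
     (AE z in lborel. z \<in> {a<..<l} \<longrightarrow> E1 z = component 1 e z) \<and>
     (AE z in lborel. z \<in> {l<..<b} \<longrightarrow> F1 z = component 1 e z) \<and>
     (AE z in lborel. z \<in> {a<..<b} \<longrightarrow> E2 z = component 2 e z)"

lemma J_map_integrand:
  assumes "AE z in lborel. z \<in> {a<..<l} \<longrightarrow> u1 z = - component 2 y z \<and> u2 z = - component 1 y z"
    and "AE z in lborel. z \<in> {l<..<b} \<longrightarrow> v1 z = - component 2 y z \<and> v2 z = - component 1 y z"
    and meas: "set_borel_measurable lborel {a<..<l} u1" "set_borel_measurable lborel {a<..<l} u2"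
      "set_borel_measurable lborel {l<..<b} v1" "set_borel_measurable lborel {l<..<b} v2"
    and y: "y \<in> X_space a b"
  shows "abs_l2 (\<lambda>z. if z \<in> {a<..<l} then P1 *v vector [u1 z, u2 z]
     else if z \<in> {l<..<b} then P1 *v vector [v1 z, v2 z] else 0) = y"
proof -
  define f :: "real \<Rightarrow> real^2" where "f z = (if z \<in> {a<..<l} then P1 *v vector [u1 z, u2 z]
     else if z \<in> {l<..<b} then P1 *v vector [v1 z, v2 z] else 0)" for z
  have P1: "P1 *v vector [s, t] = vector [- t, - s]" for s t
    by (simp add: P1_def vec_eq_iff forall_2 matrix_vector_mult_def sum_2)
  \<comment> \<open>In the use with \<open>wderiv\<close>, measurability is known only on the open
    intervals, so it is derived from products with their indicators.\<close>
  have f_eq: "f z = (\<chi> i. if i = 1 then - (indicator {a<..<l} z *\<^sub>R u2 z) - indicator {l<..<b} z *\<^sub>R v2 z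
      else - (indicator {a<..<l} z *\<^sub>R u1 z) - indicator {l<..<b} z *\<^sub>R v1 z)" for z
    by (auto simp: f_def P1 vec_eq_iff forall_2)
  have [measurable]: "f \<in> borel_measurable borel"
    unfolding f_eq[abs_def] using meas unfolding set_borel_measurable_def
    by (intro borel_measurable_vec_if borel_measurable_diff borel_measurable_uminus) auto
  have yX: "AE z in lborel. z \<notin> {a..b} \<longrightarrow> rep_l2 y z = 0"
    using y by (simp add: X_space_def)
  have ae: "AE z in lborel. f z = rep_l2 y z"
    using assms(1,2) yX AE_lborel_singleton[of a] AE_lborel_singleton[of b] AE_lborel_singleton[of l]
  proof eventually_elim
    case (elim z)
    then consider "z \<in> {a<..<l}" | "z \<in> {l<..<b}" "z \<notin> {a<..<l}" | "z \<notin> {a..b}" "z \<notin> {a<..<l}" "z \<notin> {l<..<b}"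
      by force
    then show ?case
      by cases (use elim in \<open>auto simp: f_def P1 vec_eq_iff forall_2 component_def\<close>)
  qed
  have "sq_integrable f"
    unfolding sq_integrable_def
  proof
    show "integrable lborel (\<lambda>z. (norm (f z))\<^sup>2)"
    proof (rule integrable_cong_AE_imp)
      show "integrable lborel (\<lambda>z. (norm (rep_l2 y z))\<^sup>2)"
        using sq_integrable_rep[of y] by (simp add: sq_integrable_def)
      show "AE z in lborel. (norm (rep_l2 y z))\<^sup>2 = (norm (f z))\<^sup>2"
        using ae by eventually_elim simp
    qed measurable
  qed measurable
  then have "AE z in lborel. rep_l2 (abs_l2 f) z = rep_l2 y z"
    using rep_abs_l2[of f] ae by (auto elim: eventually_elim2)
  then show ?thesis
    unfolding f_def[abs_def, symmetric] by (rule l2_eqI)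
qed

lemma J_graph_imp_J:
  assumes G: "J_graph a b l e y E1 F1 E2" and l: "a < l" "l < b"
  shows "e \<in> J_dom a b l" "J_map a b l e = y"
proof -
  have ac: "ac_on a l E1 (\<lambda>z. - component 2 y z)" "ac_on l b F1 (\<lambda>z. - component 2 y z)"
      "ac_on a b E2 (\<lambda>z. - component 1 y z)"
    and ae: "AE z in lborel. z \<in> {a<..<l} \<longrightarrow> E1 z = component 1 e z"
      "AE z in lborel. z \<in> {l<..<b} \<longrightarrow> F1 z = component 1 e z"
      "AE z in lborel. z \<in> {a<..<b} \<longrightarrow> E2 z = component 2 e z"
    and X: "e \<in> X_space a b" "y \<in> X_space a b"
    using G by (auto simp: J_graph_def)
  \<comment> \<open>\<open>J_map\<close> differentiates the second component on each side of
    \<open>l\<close> separately, whereas \<open>J_dom\<close> asks for \<open>H1\<close> on the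
    whole interval.\<close>
  have ac': "ac_on a l E2 (\<lambda>z. - component 1 y z)" "ac_on l b E2 (\<lambda>z. - component 1 y z)"
    using l by (auto intro: ac_on_subset[OF ac(3)])
  have ae': "AE z in lborel. z \<in> {a<..<l} \<longrightarrow> E2 z = component 2 e z"
      "AE z in lborel. z \<in> {l<..<b} \<longrightarrow> E2 z = component 2 e z"
    using ae(3) l by (auto elim!: eventually_mono)
  have sq: "sq_integrable_on {c<..<d} (component i x)" "sq_integrable_on {c<..<d} (\<lambda>z. - component i x z)" for c d i x
    by (intro sq_integrable_on_uminus component_sq_integrable_on; simp)+
  have W: "weak_deriv a l (component 1 e) (\<lambda>z. - component 2 y z)" "weak_deriv l b (component 1 e) (\<lambda>z. - component 2 y z)"
    "weak_deriv a b (component 2 e) (\<lambda>z. - component 1 y z)"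
    "weak_deriv a l (component 2 e) (\<lambda>z. - component 1 y z)" "weak_deriv l b (component 2 e) (\<lambda>z. - component 1 y z)"
    using l ac ac' ae ae' sq by (auto intro: ac_imp_weak_deriv)
  then show "e \<in> J_dom a b l"
    using X sq by (auto simp: J_dom_def H1_def)
  have meas: "set_borel_measurable lborel {c<..<d} (wderiv c d f)" if "weak_deriv c d f g" for c d f g
  proof -
    have "weak_deriv c d f (wderiv c d f)"
      unfolding wderiv_def by (rule someI[of "weak_deriv c d f", OF that])
    then show ?thesis
      by (simp add: weak_deriv_def sq_integrable_on_def)
  qed
  show "J_map a b l e = y"
    unfolding J_map_def
  proof (rule J_map_integrand)
    show "AE z in lborel. z \<in> {a<..<l} \<longrightarrow>
        wderiv a l (component 1 e) z = - component 2 y z \<and> wderiv a l (component 2 e) z = - component 1 y z"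
      using wderiv_ae[OF ac(1) l(1) sq(2) sq(1) ae(1)] wderiv_ae[OF ac'(1) l(1) sq(2) sq(1) ae'(1)]
      by eventually_elim auto
    show "AE z in lborel. z \<in> {l<..<b} \<longrightarrow>
        wderiv l b (component 1 e) z = - component 2 y z \<and> wderiv l b (component 2 e) z = - component 1 y z"
      using wderiv_ae[OF ac(2) l(2) sq(2) sq(1) ae(2)] wderiv_ae[OF ac'(2) l(2) sq(2) sq(1) ae'(2)]
      by eventually_elim auto
  qed (use W X meas in auto)
qed

lemma sq_integrable_piecewise:
  fixes j :: 2
  assumes "sq_integrable_on {a<..<l} f" "sq_integrable_on {l<..<b} g" "sq_integrable_on {a<..<b} h"
  shows "sq_integrable (\<lambda>z. \<chi> i. if i = j then indicator {a<..<b} z *\<^sub>R h z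
      else indicator {a<..<l} z *\<^sub>R f z + indicator {l<..<b} z *\<^sub>R g z)" (is "sq_integrable ?F")
proof -
  have m: "(\<lambda>z. indicator {a<..<l} z *\<^sub>R f z) \<in> borel_measurable borel"
    "(\<lambda>z. indicator {l<..<b} z *\<^sub>R g z) \<in> borel_measurable borel"
    "(\<lambda>z. indicator {a<..<b} z *\<^sub>R h z) \<in> borel_measurable borel"
    using assms by (auto simp: sq_integrable_on_def set_borel_measurable_def)
  have "j = 1 \<or> j = 2" by (rule exhaust_2)
  then have sq: "(norm (?F z))\<^sup>2 = indicator {a<..<b} z *\<^sub>R (h z)\<^sup>2
      + (indicator {a<..<l} z *\<^sub>R (f z)\<^sup>2 + indicator {l<..<b} z *\<^sub>R (g z)\<^sup>2)" for z
    unfolding norm_vec2_sq by (auto simp: indicator_def)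
  have "integrable lborel (\<lambda>z. (norm (?F z))\<^sup>2)"
    unfolding sq using assms
    by (intro Bochner_Integration.integrable_add) (auto simp: sq_integrable_on_def set_integrable_def)
  moreover have "?F \<in> borel_measurable borel"
    by (intro borel_measurable_vec_if borel_measurable_add m)
  ultimately show ?thesis
    by (simp add: sq_integrable_def)
qed

lemma J_dom_imp_J_graph:
  assumes e: "e \<in> J_dom a b l" and l: "a < l" "l < b"
  obtains E1 F1 E2 where "J_graph a b l e (J_map a b l e) E1 F1 E2"
proof -
  obtain g1 k1 g2 where W: "weak_deriv a l (component 1 e) g1" "weak_deriv l b (component 1 e) k1"
      "weak_deriv a b (component 2 e) g2"
    using e by (auto simp: J_dom_def H1_def)
  have sq: "sq_integrable_on {a<..<l} g1" "sq_integrable_on {l<..<b} k1" "sq_integrable_on {a<..<b} g2"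
    using W by (auto simp: weak_deriv_def)
  have sqc: "sq_integrable_on {c<..<d} (component i x)" for c d i x
    by (auto intro: component_sq_integrable_on)
  obtain E1 where E1: "ac_on a l E1 g1" "AE z in lborel. z \<in> {a<..<l} \<longrightarrow> E1 z = component 1 e z"
    using weak_deriv_imp_ac[OF W(1) sqc l(1)] by blast
  obtain F1 where F1: "ac_on l b F1 k1" "AE z in lborel. z \<in> {l<..<b} \<longrightarrow> F1 z = component 1 e z"
    using weak_deriv_imp_ac[OF W(2) sqc l(2)] by blast
  obtain E2 where E2: "ac_on a b E2 g2" "AE z in lborel. z \<in> {a<..<b} \<longrightarrow> E2 z = component 2 e z"
    using weak_deriv_imp_ac[OF W(3) sqc less_trans[OF l]] by blast
  \<comment> \<open>\<open>P1 e'\<close> in components: first minus the derivative of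
    \<open>e\<^sub>2\<close> on the whole interval, then minus the piecewise derivative of
    \<open>e\<^sub>1\<close>.\<close>
  define f :: "real \<Rightarrow> real^2" where "f z = (\<chi> i. if i = 1 then indicator {a<..<b} z *\<^sub>R (- g2 z)
      else indicator {a<..<l} z *\<^sub>R (- g1 z) + indicator {l<..<b} z *\<^sub>R (- k1 z))" for z
  define y where "y = abs_l2 f"
  have "sq_integrable f"
    unfolding f_def[abs_def] by (intro sq_integrable_piecewise sq_integrable_on_uminus sq)
  then have y: "AE z in lborel. rep_l2 y z = f z"
    unfolding y_def by (rule rep_abs_l2)
  have yX: "y \<in> X_space a b"
    unfolding X_space_def mem_Collect_eq using y
    by eventually_elim (use l in \<open>auto simp: f_def vec_eq_iff\<close>)
  have meas: "set_borel_measurable lborel {c..d} (\<lambda>z. - component i y z)" for c d i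
    unfolding set_borel_measurable_def by measurable
  have "ac_on a l E1 (\<lambda>z. - component 2 y z)"
  proof (rule ac_on_cong[OF E1(1) refl meas])
    show "AE s in lborel. s \<in> {a<..<l} \<longrightarrow> g1 s = - component 2 y s"
      using y by eventually_elim (auto simp: component_def f_def)
  qed
  moreover have "ac_on l b F1 (\<lambda>z. - component 2 y z)"
  proof (rule ac_on_cong[OF F1(1) refl meas])
    show "AE s in lborel. s \<in> {l<..<b} \<longrightarrow> k1 s = - component 2 y s"
      using y by eventually_elim (auto simp: component_def f_def)
  qed
  moreover have "ac_on a b E2 (\<lambda>z. - component 1 y z)"
  proof (rule ac_on_cong[OF E2(1) refl meas])
    show "AE s in lborel. s \<in> {a<..<b} \<longrightarrow> g2 s = - component 1 y s"
      using y by eventually_elim (auto simp: component_def f_def)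
  qed
  ultimately have G: "J_graph a b l e y E1 F1 E2"
    using E1(2) F1(2) E2(2) yX e by (simp add: J_graph_def J_dom_def)
  then show thesis
    using J_graph_imp_J(2)[OF G l] that by simp
qed

lemma J_graph_values:
  assumes G: "J_graph a b l e y E1 F1 E2" and l: "a < l" "l < b"
  shows "val_a a b l e = vector [E1 a, E2 a]" "val_b a b l e = vector [F1 b, E2 b]" "f_I a b l e = E2 l"
proof -
  have "continuous_on {a..l} E1" "continuous_on {l..b} F1" "continuous_on {a..b} E2"
    using G by (auto simp: J_graph_def intro: ac_on_continuous)
  then have "pt_value a l (component 1 e) a = E1 a" "pt_value l b (component 1 e) b = F1 b"
    "p \<in> {a..b} \<Longrightarrow> pt_value a b (component 2 e) p = E2 p" for p
    using G l by (auto simp: J_graph_def intro!: pt_value_eq)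
  then show "val_a a b l e = vector [E1 a, E2 a]" "val_b a b l e = vector [F1 b, E2 b]" "f_I a b l e = E2 l"
    using l by (simp_all add: val_a_def val_b_def f_I_def)
qed

lemma J_graph_add:
  assumes "J_graph a b l e y E1 F1 E2" "J_graph a b l e' y' E1' F1' E2'"
  shows "J_graph a b l (e + e') (y + y') (\<lambda>z. E1 z + E1' z) (\<lambda>z. F1 z + F1' z) (\<lambda>z. E2 z + E2' z)"
proof -
  have comp: "AE z in lborel. component i (x + x') z = component i x z + component i x' z" for i x x'
    using rep_add[of x x'] by eventually_elim (simp add: component_def)
  have meas: "set_borel_measurable lborel {c..d} (\<lambda>z. - component i x z)" for c d i x
    unfolding set_borel_measurable_def by measurable
  have ac: "ac_on c d (\<lambda>z. F z + F' z) (\<lambda>z. - component i (y + y') z)"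
    if "ac_on c d F (\<lambda>z. - component i y z)" "ac_on c d F' (\<lambda>z. - component i y' z)" for c d F F' i
  proof (rule ac_on_cong[OF ac_on_add[OF that] refl meas])
    show "AE s in lborel. s \<in> {c<..<d} \<longrightarrow> - component i y s + - component i y' s = - component i (y + y') s"
      using comp[of i y y'] by eventually_elim simp
  qed
  have ae: "AE z in lborel. z \<in> S \<longrightarrow> F z + F' z = component i (e + e') z"
    if "AE z in lborel. z \<in> S \<longrightarrow> F z = component i e z" "AE z in lborel. z \<in> S \<longrightarrow> F' z = component i e' z"
    for S F F' i
    using that comp[of i e e'] by eventually_elim simp
  show ?thesis
    using assms unfolding J_graph_def by (intro conjI ac ae) (auto simp: subspace_add[OF subspace_X])
qed

lemma J_graph_scaleR:
  assumes "J_graph a b l e y E1 F1 E2"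
  shows "J_graph a b l (r *\<^sub>R e) (r *\<^sub>R y) (\<lambda>z. r * E1 z) (\<lambda>z. r * F1 z) (\<lambda>z. r * E2 z)"
proof -
  have comp: "AE z in lborel. component i (r *\<^sub>R x) z = r * component i x z" for i x
    using rep_scaleR[of r x] by eventually_elim (simp add: component_def)
  have meas: "set_borel_measurable lborel {c..d} (\<lambda>z. - component i x z)" for c d i x
    unfolding set_borel_measurable_def by measurable
  have ac: "ac_on c d (\<lambda>z. r * F z) (\<lambda>z. - component i (r *\<^sub>R y) z)"
    if "ac_on c d F (\<lambda>z. - component i y z)" for c d F i
  proof (rule ac_on_cong[OF ac_on_cmult[OF that, of r] refl meas])
    show "AE s in lborel. s \<in> {c<..<d} \<longrightarrow> r * - component i y s = - component i (r *\<^sub>R y) s"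
      using comp[of i y] by eventually_elim simp
  qed
  have ae: "AE z in lborel. z \<in> S \<longrightarrow> r * F z = component i (r *\<^sub>R e) z"
    if "AE z in lborel. z \<in> S \<longrightarrow> F z = component i e z" for S F i
    using that comp[of i e] by eventually_elim simp
  show ?thesis
    using assms unfolding J_graph_def by (intro conjI ac ae) (auto simp: subspace_scale[OF subspace_X])
qed

text \<open>The domain conditions in terms of \<open>e = Q_l x\<close>, hence free of the
  coefficients. For \<open>r = 0\<close> the interface condition is \<open>e\<^sub>2 (l) = 0\<close>
  and leaves the jump of \<open>e\<^sub>1\<close> free.\<close>

definition E_dom :: "real \<Rightarrow> real \<Rightarrow> real \<Rightarrow> real^4^2 \<Rightarrow> l2 set" where
  "E_dom a b l W = {e. \<exists>y E1 F1 E2. J_graph a b l e y E1 F1 E2 \<and> E2 l = 0 \<and>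
     boundary_map W (vector [E1 a, E2 a]) (vector [F1 b, E2 b]) = 0}"

lemma E_domE:
  assumes "e \<in> E_dom a b l W" "a < l" "l < b"
  obtains E1 F1 E2 where "J_graph a b l e (J_map a b l e) E1 F1 E2" "E2 l = 0"
    "boundary_map W (vector [E1 a, E2 a]) (vector [F1 b, E2 b]) = 0"
  using assms J_graph_imp_J(2) unfolding E_dom_def by blast

lemma pH_op_domain:
  assumes l: "a < l" "l < b"
  shows "fst (pH_op a b Qm Qp 0 W l) = {x \<in> X_space a b. mult_op (Q_l a b Qm Qp l) x \<in> E_dom a b l W}"
proof -
  have "e \<in> E_dom a b l W \<longleftrightarrow> e \<in> J_dom a b l \<and> f_I a b l e = 0 \<and> W *v stack (f_bd a b l e) (e_bd a b l e) = 0" for e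
  proof
    assume "e \<in> E_dom a b l W"
    then obtain E1 F1 E2 where G: "J_graph a b l e (J_map a b l e) E1 F1 E2" "E2 l = 0"
      "boundary_map W (vector [E1 a, E2 a]) (vector [F1 b, E2 b]) = 0"
      using l by (elim E_domE)
    then show "e \<in> J_dom a b l \<and> f_I a b l e = 0 \<and> W *v stack (f_bd a b l e) (e_bd a b l e) = 0"
      using J_graph_imp_J(1)[OF G(1) l] J_graph_values[OF G(1) l]
      by (simp add: boundary_map_def f_bd_def e_bd_def)
  next
    assume *: "e \<in> J_dom a b l \<and> f_I a b l e = 0 \<and> W *v stack (f_bd a b l e) (e_bd a b l e) = 0"
    then obtain E1 F1 E2 where G: "J_graph a b l e (J_map a b l e) E1 F1 E2"
      using J_dom_imp_J_graph[OF _ l] by blast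
    then show "e \<in> E_dom a b l W"
      using * J_graph_values[OF G l] unfolding E_dom_def boundary_map_def f_bd_def e_bd_def by auto
  qed
  then show ?thesis
    by (auto simp: pH_op_def Let_def)
qed

lemma vector_2_add: "vector [x + x', y + y'] = (vector [x, y] + vector [x', y'] :: real^2)"
  by (simp add: vec_eq_iff forall_2)

lemma vector_2_scaleR: "vector [r * x, r * y] = (r *\<^sub>R vector [x, y] :: real^2)"
  by (simp add: vec_eq_iff forall_2)

lemma J_graph_zero: "J_graph a b l 0 0 (\<lambda>_. 0) (\<lambda>_. 0) (\<lambda>_. 0)"
proof -
  have comp: "AE z in lborel. component i 0 z = 0" for i
    using rep_zero by eventually_elim (simp add: component_def)
  have ac: "ac_on c d (\<lambda>_. 0) (\<lambda>z. - component i 0 z)" for c d i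
  proof (rule ac_on_cong[where f = "\<lambda>_. 0"])
    show "ac_on c d (\<lambda>_. 0) (\<lambda>_. 0)"
      by (simp add: ac_on_def set_integrable_def set_lebesgue_integral_def)
    show "set_borel_measurable lborel {c..d} (\<lambda>z. - component i 0 z)"
      unfolding set_borel_measurable_def by measurable
    show "AE s in lborel. s \<in> {c<..<d} \<longrightarrow> 0 = - component i 0 s"
      using comp[of i] by eventually_elim simp
  qed simp
  have "AE z in lborel. z \<in> S \<longrightarrow> 0 = component i 0 z" for S i
    using comp[of i] by eventually_elim simp
  then show ?thesis
    unfolding J_graph_def by (intro conjI ac subspace_0[OF subspace_X])
qed

text \<open>\<open>J_map\<close> goes through the choice in \<open>wderiv\<close>, which is not
  linear by construction. Linearity comes from the relation \<open>J_graph\<close>, which is linear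
  and determines \<open>J_map\<close>.\<close>

lemma E_dom_linear:
  assumes l: "a < l" "l < b"
  shows "subspace (E_dom a b l W)"
    and "\<And>e e'. e \<in> E_dom a b l W \<Longrightarrow> e' \<in> E_dom a b l W \<Longrightarrow> J_map a b l (e + e') = J_map a b l e + J_map a b l e'"
    and "\<And>r e. e \<in> E_dom a b l W \<Longrightarrow> J_map a b l (r *\<^sub>R e) = r *\<^sub>R J_map a b l e"
proof -
  have add: "e + e' \<in> E_dom a b l W \<and> J_map a b l (e + e') = J_map a b l e + J_map a b l e'"
    if "e \<in> E_dom a b l W" "e' \<in> E_dom a b l W" for e e'
  proof -
    from that(1) l obtain E1 F1 E2 where G: "J_graph a b l e (J_map a b l e) E1 F1 E2" "E2 l = 0"
      "boundary_map W (vector [E1 a, E2 a]) (vector [F1 b, E2 b]) = 0" by (elim E_domE)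
    from that(2) l obtain E1' F1' E2' where G': "J_graph a b l e' (J_map a b l e') E1' F1' E2'" "E2' l = 0"
      "boundary_map W (vector [E1' a, E2' a]) (vector [F1' b, E2' b]) = 0" by (elim E_domE)
    note S = J_graph_add[OF G(1) G'(1)]
    have "boundary_map W (vector [E1 a + E1' a, E2 a + E2' a]) (vector [F1 b + F1' b, E2 b + E2' b]) = 0"
      using G(3) G'(3) by (simp add: vector_2_add boundary_map_add)
    then have "e + e' \<in> E_dom a b l W"
      unfolding E_dom_def mem_Collect_eq
      by (intro exI conjI) (rule S, use G(2) G'(2) in auto)
    then show ?thesis
      using J_graph_imp_J(2)[OF S l] by simp
  qed
  have scale: "r *\<^sub>R e \<in> E_dom a b l W \<and> J_map a b l (r *\<^sub>R e) = r *\<^sub>R J_map a b l e"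
    if "e \<in> E_dom a b l W" for e r
  proof -
    from that l obtain E1 F1 E2 where G: "J_graph a b l e (J_map a b l e) E1 F1 E2" "E2 l = 0"
      "boundary_map W (vector [E1 a, E2 a]) (vector [F1 b, E2 b]) = 0" by (elim E_domE)
    note S = J_graph_scaleR[OF G(1), of r]
    have "boundary_map W (vector [r * E1 a, r * E2 a]) (vector [r * F1 b, r * E2 b]) = 0"
      using G(3) by (simp add: vector_2_scaleR boundary_map_scaleR)
    then have "r *\<^sub>R e \<in> E_dom a b l W"
      unfolding E_dom_def mem_Collect_eq
      by (intro exI conjI) (rule S, use G(2) in auto)
    then show ?thesis
      using J_graph_imp_J(2)[OF S l] by simp
  qed
  have zero: "0 \<in> E_dom a b l W"
  proof -
    have "boundary_map W (vector [0, 0]) (vector [0, 0]) = 0"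
      using vector_2_scaleR[of 0 0 0] boundary_map_scaleR[of W 0 0 0] by simp
    then show ?thesis
      unfolding E_dom_def mem_Collect_eq by (intro exI conjI) (rule J_graph_zero, auto)
  qed
  show "subspace (E_dom a b l W)"
    using add scale zero by (auto intro: subspaceI)
  show "J_map a b l (e + e') = J_map a b l e + J_map a b l e'"
    if "e \<in> E_dom a b l W" "e' \<in> E_dom a b l W" for e e'
    using add that by blast
  show "J_map a b l (r *\<^sub>R e) = r *\<^sub>R J_map a b l e" if "e \<in> E_dom a b l W" for r e
    using scale that by blast
qed

text \<open>Integrate the derivative of \<open>h F G\<close>. In the application \<open>p\<close>
  and \<open>q\<close> are the second and first components of \<open>y = J e\<close>, so the
  integrand on the left is \<open>h (y \<bullet> e)\<close>.\<close>

lemma ac_weighted_energy: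
  assumes F: "ac_on c d F (\<lambda>z. - p z)" and G: "ac_on c d G (\<lambda>z. - q z)" and h: "ac_on c d h h'" and "c \<le> d"
  shows "(LBINT z:{c..d}. h z * (q z * F z + p z * G z))
      = h c * (F c * G c) - h d * (F d * G d) + (LBINT z:{c..d}. h' z * (F z * G z))"
proof -
  note FG = ac_on_mult[OF F G]
  note hFG = ac_on_mult[OF h FG]
  have i1: "set_integrable lborel {c..d} (\<lambda>z. h' z * (F z * G z))"
    by (intro set_integrable_mult_continuous ac_on_integrable[OF h] ac_on_continuous[OF FG])
  have "set_integrable lborel {c..d} (\<lambda>z. (- p z * G z + F z * - q z) * h z)"
    by (intro set_integrable_mult_continuous ac_on_integrable[OF FG] ac_on_continuous[OF h])
  then have i2: "set_integrable lborel {c..d} (\<lambda>z. h z * (- p z * G z + F z * - q z))"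
    by (simp only: mult.commute)
  have "h d * (F d * G d) - h c * (F c * G c)
      = (LBINT z:{c..d}. h' z * (F z * G z) + h z * (- p z * G z + F z * - q z))"
    using ac_on_integral[OF hFG, of c d] \<open>c \<le> d\<close> by simp
  also have "\<dots> = (LBINT z:{c..d}. h' z * (F z * G z)) + (LBINT z:{c..d}. h z * (- p z * G z + F z * - q z))"
    by (rule set_integral_add(2)[OF i1 i2])
  also have "(LBINT z:{c..d}. h z * (- p z * G z + F z * - q z)) = (LBINT z:{c..d}. - (h z * (q z * F z + p z * G z)))"
    by (intro set_lebesgue_integral_cong) (auto simp: algebra_simps)
  also have "\<dots> = - (LBINT z:{c..d}. h z * (q z * F z + p z * G z))"
    by (simp add: set_lebesgue_integral_def)
  finally show ?thesis by simp
qed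

text \<open>As \<open>e\<^sub>2 (l) = 0\<close>, the weight may jump at \<open>l\<close>; only its values at the two ends matter.\<close>

lemma J_weighted_dissipative:
  assumes W: "rank W = 2" "pos_semidef (W ** Sigma_mat ** transpose W)" and l: "a < l" "l < b"
    and e: "e \<in> E_dom a b l W" and h: "ac_on a l h h'" "h a = 1" and k: "ac_on l b k k'" "k b = 1"
  shows "(LBINT z:{a..l}. h z * (rep_l2 (J_map a b l e) z \<bullet> rep_l2 e z))
        + (LBINT z:{l..b}. k z * (rep_l2 (J_map a b l e) z \<bullet> rep_l2 e z))
      \<le> (LBINT z:{a..l}. h' z * (component 1 e z * component 2 e z))
        + (LBINT z:{l..b}. k' z * (component 1 e z * component 2 e z))"
proof -
  define y where "y = J_map a b l e"
  from e l obtain E1 F1 E2 where G: "J_graph a b l e (J_map a b l e) E1 F1 E2" "E2 l = 0"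
      "boundary_map W (vector [E1 a, E2 a]) (vector [F1 b, E2 b]) = 0" by (elim E_domE)
  have ac: "ac_on a l E1 (\<lambda>z. - component 2 y z)" "ac_on l b F1 (\<lambda>z. - component 2 y z)"
      "ac_on a b E2 (\<lambda>z. - component 1 y z)"
    and ae: "AE z in lborel. z \<in> {a<..<l} \<longrightarrow> E1 z = component 1 e z"
      "AE z in lborel. z \<in> {l<..<b} \<longrightarrow> F1 z = component 1 e z"
      "AE z in lborel. z \<in> {a<..<b} \<longrightarrow> E2 z = component 2 e z"
    using G(1) by (auto simp: J_graph_def y_def)
  have ac': "ac_on a l E2 (\<lambda>z. - component 1 y z)" "ac_on l b E2 (\<lambda>z. - component 1 y z)"
    using l by (auto intro: ac_on_subset[OF ac(3)])
  have replace:
    "(LBINT z:{c..d}. w z * (component 1 y z * F z + component 2 y z * H z))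
        = (LBINT z:{c..d}. w z * (rep_l2 y z \<bullet> rep_l2 e z))" (is ?A)
    "(LBINT z:{c..d}. w' z * (F z * H z)) = (LBINT z:{c..d}. w' z * (component 1 e z * component 2 e z))" (is ?B)
    if F: "continuous_on {c..d} F" "AE z in lborel. z \<in> {c<..<d} \<longrightarrow> F z = component 1 e z"
      and H: "continuous_on {c..d} H" "AE z in lborel. z \<in> {c<..<d} \<longrightarrow> H z = component 2 e z"
      and w: "ac_on c d w w'" for c d F H w w'
  proof -
    have meas: "(\<lambda>z. indicator {c..d} z *\<^sub>R F z) \<in> borel_measurable borel"
      "(\<lambda>z. indicator {c..d} z *\<^sub>R H z) \<in> borel_measurable borel"
      "(\<lambda>z. indicator {c..d} z *\<^sub>R w z) \<in> borel_measurable borel"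
      "(\<lambda>z. indicator {c..d} z *\<^sub>R w' z) \<in> borel_measurable borel"
    proof -
      have "(\<lambda>z. indicator {c..d} z *\<^sub>R K z) \<in> borel_measurable borel"
        if "continuous_on {c..d} K" for K :: "real \<Rightarrow> real"
        using that by (intro borel_measurable_continuous_on_indicator) simp
      then show "(\<lambda>z. indicator {c..d} z *\<^sub>R F z) \<in> borel_measurable borel"
        "(\<lambda>z. indicator {c..d} z *\<^sub>R H z) \<in> borel_measurable borel"
        "(\<lambda>z. indicator {c..d} z *\<^sub>R w z) \<in> borel_measurable borel"
        using F(1) H(1) ac_on_continuous[OF w] by blast+
      show "(\<lambda>z. indicator {c..d} z *\<^sub>R w' z) \<in> borel_measurable borel"
        using ac_on_integrable[OF w] by (auto simp: set_integrable_def)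
    qed
    have ae_closed: "AE z in lborel. z \<in> {c..d} \<longrightarrow> F z = component 1 e z \<and> H z = component 2 e z"
      using F(2) H(2) AE_lborel_singleton[of c] AE_lborel_singleton[of d] by eventually_elim auto
    have eq1: "indicator {c..d} z *\<^sub>R (w z * (component 1 y z * F z + component 2 y z * H z))
        = (indicator {c..d} z *\<^sub>R w z) * (component 1 y z * (indicator {c..d} z *\<^sub>R F z)
            + component 2 y z * (indicator {c..d} z *\<^sub>R H z))" for z
      by (simp add: indicator_def)
    have eq2: "indicator {c..d} z *\<^sub>R (w z * (rep_l2 y z \<bullet> rep_l2 e z))
        = (indicator {c..d} z *\<^sub>R w z) * (rep_l2 y z \<bullet> rep_l2 e z)" for z
      by simp
    have eq3: "indicator {c..d} z *\<^sub>R (w' z * (F z * H z))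
        = (indicator {c..d} z *\<^sub>R w' z) * ((indicator {c..d} z *\<^sub>R F z) * (indicator {c..d} z *\<^sub>R H z))" for z
      by (simp add: indicator_def)
    have eq4: "indicator {c..d} z *\<^sub>R (w' z * (component 1 e z * component 2 e z))
        = (indicator {c..d} z *\<^sub>R w' z) * (component 1 e z * component 2 e z)" for z
      by simp
    show ?A
    proof (rule LBINT_cong_AE_on)
      show "set_borel_measurable lborel {c..d} (\<lambda>z. w z * (component 1 y z * F z + component 2 y z * H z))"
        "set_borel_measurable lborel {c..d} (\<lambda>z. w z * (rep_l2 y z \<bullet> rep_l2 e z))"
        unfolding set_borel_measurable_def eq1 eq2 using meas by measurable
      show "AE z in lborel. z \<in> {c..d} \<longrightarrow>
          w z * (component 1 y z * F z + component 2 y z * H z) = w z * (rep_l2 y z \<bullet> rep_l2 e z)"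
        using ae_closed by eventually_elim (auto simp: inner_vec_def sum_2 component_def)
    qed
    show ?B
    proof (rule LBINT_cong_AE_on)
      show "set_borel_measurable lborel {c..d} (\<lambda>z. w' z * (F z * H z))"
        "set_borel_measurable lborel {c..d} (\<lambda>z. w' z * (component 1 e z * component 2 e z))"
        unfolding set_borel_measurable_def eq3 eq4 using meas by measurable
      show "AE z in lborel. z \<in> {c..d} \<longrightarrow> w' z * (F z * H z) = w' z * (component 1 e z * component 2 e z)"
        using ae_closed by eventually_elim auto
    qed
  qed
  have ae': "AE z in lborel. z \<in> {a<..<l} \<longrightarrow> E2 z = component 2 e z"
      "AE z in lborel. z \<in> {l<..<b} \<longrightarrow> E2 z = component 2 e z"
    using ae(3) l by (auto elim!: eventually_mono)
  note left = ac_weighted_energy[OF ac(1) ac'(1) h(1) less_imp_le[OF l(1)]]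
  note right = ac_weighted_energy[OF ac(2) ac'(2) k(1) less_imp_le[OF l(2)]]
  \<comment> \<open>The two energy identities have end terms at \<open>a\<close> and
    \<open>b\<close>, where the weights are 1, and at \<open>l\<close>, where \<open>E2\<close>
    vanishes; only the boundary form remains.\<close>
  have "E1 a * E2 a \<le> F1 b * E2 b"
    using boundary_form_nonpos[OF W G(3)] by simp
  then show ?thesis
    using left right
    unfolding replace[OF ac_on_continuous[OF ac(1)] ae(1) ac_on_continuous[OF ac'(1)] ae'(1) h(1)]
      replace[OF ac_on_continuous[OF ac(2)] ae(2) ac_on_continuous[OF ac'(2)] ae'(2) k(1)]
    by (simp add: y_def G(2) h(2) k(2))
qed

lemma J_dissipative:
  assumes W: "rank W = 2" "pos_semidef (W ** Sigma_mat ** transpose W)" and l: "a < l" "l < b"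
    and e: "e \<in> E_dom a b l W"
  shows "J_map a b l e \<in> X_space a b" "e \<in> X_space a b" "inner (J_map a b l e) e \<le> 0"
proof -
  from e l obtain E1 F1 E2 where G: "J_graph a b l e (J_map a b l e) E1 F1 E2" by (elim E_domE)
  then show X: "J_map a b l e \<in> X_space a b" "e \<in> X_space a b" by (auto simp: J_graph_def)
  have ac: "ac_on c d (\<lambda>_. 1) (\<lambda>_. 0)" for c d
    by (simp add: ac_on_def set_integrable_def set_lebesgue_integral_def)
  have int: "set_integrable lborel {a..b} (\<lambda>z. rep_l2 (J_map a b l e) z \<bullet> rep_l2 e z)"
    unfolding set_integrable_def by (intro integrable_mult_indicator sq_integrable_inner) auto
  have "inner (J_map a b l e) e = (LBINT z:{a..b}. rep_l2 (J_map a b l e) z \<bullet> rep_l2 e z)"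
    by (rule inner_X[OF X(1)])
  also have "\<dots> = (LBINT z:{a..l}. rep_l2 (J_map a b l e) z \<bullet> rep_l2 e z)
      + (LBINT z:{l..b}. rep_l2 (J_map a b l e) z \<bullet> rep_l2 e z)"
    using l by (intro LBINT_combine int) auto
  also have "\<dots> \<le> 0"
    using J_weighted_dissipative[OF W l e ac refl ac refl] by (simp add: set_lebesgue_integral_def)
  finally show "inner (J_map a b l e) e \<le> 0" .
qed

section \<open>Solving the resolvent equation of \<open>J\<close>\<close>

lemma ac_on_ext:
  assumes "ac_on c d F f" "\<And>z. F z = G z" "\<And>z. f z = g z"
  shows "ac_on c d G g"
proof -
  have "F = G" "f = g" using assms(2,3) by auto
  with assms(1) show ?thesis by simp
qed

lemma continuous_on_sq_integrable_on:
  assumes "continuous_on {c..d} F"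
  shows "sq_integrable_on {c<..<d} F"
proof -
  have "set_integrable lborel {c..d} F" "set_integrable lborel {c..d} (\<lambda>z. (F z)\<^sup>2)"
    unfolding set_integrable_def
    by (intro borel_integrable_compact compact_Icc assms continuous_on_power)+
  then have "set_integrable lborel {c<..<d} F" "set_integrable lborel {c<..<d} (\<lambda>z. (F z)\<^sup>2)"
    by (simp_all add: set_integrable_open_interval)
  then show ?thesis
    by (auto simp: sq_integrable_on_def set_borel_measurable_def set_integrable_def)
qed

text \<open>The equation \<open>c e - J e = y\<close> decouples in the variables \<open>e\<^sub>1 + e\<^sub>2\<close> and \<open>e\<^sub>1 - e\<^sub>2\<close>. On each side of
  \<open>l\<close> one integration constant remains after imposing \<open>e\<^sub>2 (l) = 0\<close>.\<close>

lemma scalar_solution: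
  assumes c: "0 < c" and l: "a < l" "l < b"
  obtains U1 U2 :: "real \<Rightarrow> real \<Rightarrow> real" and ka kb :: "real^2" where
    "\<And>r. ac_on a b (U1 r) (\<lambda>z. component 2 y z - c * U2 r z)"
    "\<And>r. ac_on a b (U2 r) (\<lambda>z. component 1 y z - c * U1 r z)"
    "\<And>r. U2 r l = 0"
    "\<And>r. vector [U1 r a, U2 r a] = r *\<^sub>R vector [cosh (c * (l - a)), sinh (c * (l - a))] + ka"
    "\<And>r. vector [U1 r b, U2 r b] = r *\<^sub>R vector [cosh (c * (b - l)), - sinh (c * (b - l))] + kb"
proof -
  have ac_exp: "ac_on a b (\<lambda>z. exp (k * (z - l))) (\<lambda>z. k * exp (k * (z - l)))" for k
    by (intro ac_on_C1) (auto intro!: derivative_eq_intros continuous_intros)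
  have prim: "\<exists>S. ac_on a b S (\<lambda>z. (component 1 y z + j * component 2 y z) * exp (k * (z - l))) \<and> S l = 0" for j k :: real
  proof -
    have "set_integrable lborel {a..b} (\<lambda>z. (component 1 y z + j * component 2 y z) * exp (k * (z - l)))"
      by (intro set_integrable_mult_continuous set_integral_add component_integrable set_integrable_mult_right continuous_intros)
    then have "ac_on a b (\<lambda>z. K + (LBINT t:{a..z}. (component 1 y t + j * component 2 y t) * exp (k * (t - l))))
        (\<lambda>z. (component 1 y z + j * component 2 y z) * exp (k * (z - l)))" for K
      by (rule ac_on_primitive)
    then show ?thesis
      by (rule exI[where x = "\<lambda>z. - (LBINT t:{a..l}. (component 1 y t + j * component 2 y t) * exp (k * (t - l)))
        + (LBINT t:{a..z}. (component 1 y t + j * component 2 y t) * exp (k * (t - l)))", OF conjI]) simp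
  qed
  obtain S where S: "ac_on a b S (\<lambda>z. (component 1 y z + 1 * component 2 y z) * exp (c * (z - l)))" "S l = 0"
    using prim[of 1 c] by blast
  obtain R where R: "ac_on a b R (\<lambda>z. (component 1 y z + (-1) * component 2 y z) * exp (- c * (z - l)))" "R l = 0"
    using prim[of "-1" "-c"] by blast
  \<comment> \<open>Variation of constants from \<open>l\<close> for
    \<open>P = e\<^sub>1 + e\<^sub>2\<close> and \<open>Q = e\<^sub>1 - e\<^sub>2\<close>, which
    solve \<open>P' = y\<^sub>1 + y\<^sub>2 - c P\<close> and
    \<open>Q' = y\<^sub>2 - y\<^sub>1 + c Q\<close>. Giving both the same value \<open>r\<close> at
    \<open>l\<close> is the condition \<open>e\<^sub>2 (l) = 0\<close>.\<close>
  define P where "P r z = exp (- c * (z - l)) * (r + S z)" for r z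
  define Q where "Q r z = exp (c * (z - l)) * (r - R z)" for r z
  have const: "ac_on a b (\<lambda>_. r) (\<lambda>_. 0)" for r
    by (simp add: ac_on_def set_integrable_def set_lebesgue_integral_def)
  have P: "ac_on a b (P r) (\<lambda>z. component 1 y z + component 2 y z - c * P r z)" for r
  proof (rule ac_on_ext[OF ac_on_mult[OF ac_exp[of "-c"] ac_on_add[OF const[of r] S(1)]]])
    fix z
    have "exp (- c * (z - l)) * (0 + s * exp (c * (z - l))) = s" for s :: real
      by (simp add: exp_minus)
    then show "- c * exp (- c * (z - l)) * (r + S z)
        + exp (- c * (z - l)) * (0 + (component 1 y z + 1 * component 2 y z) * exp (c * (z - l)))
      = component 1 y z + component 2 y z - c * P r z"
      by (simp only: P_def)
  qed (simp add: P_def)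
  have Q: "ac_on a b (Q r) (\<lambda>z. component 2 y z - component 1 y z + c * Q r z)" for r
  proof (rule ac_on_ext[OF ac_on_mult[OF ac_exp[of c] ac_on_diff[OF const[of r] R(1)]]])
    fix z
    have "exp (c * (z - l)) * (0 - s * exp (- c * (z - l))) = - s" for s :: real
      by (simp add: exp_minus)
    then show "c * exp (c * (z - l)) * (r - R z)
        + exp (c * (z - l)) * (0 - (component 1 y z + - 1 * component 2 y z) * exp (- c * (z - l)))
      = component 2 y z - component 1 y z + c * Q r z"
      by (simp only: Q_def)
  qed (simp add: Q_def)
  define U1 where "U1 r z = 1/2 * (P r z + Q r z)" for r z
  define U2 where "U2 r z = 1/2 * (P r z - Q r z)" for r z
  show thesis
  proof (rule that)
    show "ac_on a b (U1 r) (\<lambda>z. component 2 y z - c * U2 r z)" for r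
      by (rule ac_on_ext[OF ac_on_cmult[OF ac_on_add[OF P[of r] Q[of r]], of "1/2"]])
        (simp_all add: U1_def U2_def algebra_simps)
    show "ac_on a b (U2 r) (\<lambda>z. component 1 y z - c * U1 r z)" for r
      by (rule ac_on_ext[OF ac_on_cmult[OF ac_on_diff[OF P[of r] Q[of r]], of "1/2"]])
        (simp_all add: U1_def U2_def algebra_simps)
    show "U2 r l = 0" for r
      using S(2) R(2) by (simp add: U2_def P_def Q_def)
    show "vector [U1 r a, U2 r a] = r *\<^sub>R vector [cosh (c * (l - a)), sinh (c * (l - a))]
        + (vector [U1 0 a, U2 0 a] :: real^2)" for r
      by (simp add: vec_eq_iff forall_2 U1_def U2_def P_def Q_def cosh_def sinh_def algebra_simps)
    show "vector [U1 r b, U2 r b] = r *\<^sub>R vector [cosh (c * (b - l)), - sinh (c * (b - l))]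
        + (vector [U1 0 b, U2 0 b] :: real^2)" for r
      by (simp add: vec_eq_iff forall_2 U1_def U2_def P_def Q_def cosh_def sinh_def algebra_simps)
  qed
qed

text \<open>If \<open>(\<alpha>, \<beta>)\<close> solves the homogeneous problem,
  \<open>boundary_form_nonpos\<close> puts the nonnegative
  \<open>\<alpha>\<^sup>2 ha\<^sub>1 ha\<^sub>2\<close> below the nonpositive
  \<open>\<beta>\<^sup>2 hb\<^sub>1 hb\<^sub>2\<close>, so both constants vanish. The linear map of
  the constants is thus injective on the plane, hence onto.\<close>

lemma boundary_constants:
  assumes W: "rank W = 2" "pos_semidef (W ** Sigma_mat ** transpose W)"
    and ha: "0 < ha $ 1 * ha $ 2" and hb: "hb $ 1 * hb $ 2 < 0"
  obtains \<alpha> \<beta> where "boundary_map W (\<alpha> *\<^sub>R ha + ka) (\<beta> *\<^sub>R hb + kb) = 0"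
proof -
  define L :: "real^2 \<Rightarrow> real^2" where "L v = boundary_map W (v $ 1 *\<^sub>R ha) (v $ 2 *\<^sub>R hb)" for v
  have lin: "linear L"
  proof (rule linearI)
    show "L (v + w) = L v + L w" for v w
      unfolding L_def by (simp add: boundary_map_add[symmetric] scaleR_add_left)
    show "L (r *\<^sub>R v) = r *\<^sub>R L v" for r v
      unfolding L_def by (simp add: boundary_map_scaleR[symmetric])
  qed
  have "v = 0" if "L v = 0" for v
  proof -
    have "(v $ 1)\<^sup>2 * (ha $ 1 * ha $ 2) \<le> (v $ 2)\<^sup>2 * (hb $ 1 * hb $ 2)"
      using boundary_form_nonpos[OF W that[unfolded L_def]] by (simp add: power2_eq_square algebra_simps)
    moreover have "0 \<le> (v $ 1)\<^sup>2 * (ha $ 1 * ha $ 2)" "(v $ 2)\<^sup>2 * (hb $ 1 * hb $ 2) \<le> 0"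
      using ha hb by (auto simp: mult_nonneg_nonpos)
    ultimately have "(v $ 1)\<^sup>2 * (ha $ 1 * ha $ 2) = 0" "(v $ 2)\<^sup>2 * (hb $ 1 * hb $ 2) = 0"
      by linarith+
    then show "v = 0"
      using ha hb by (auto simp: vec_eq_iff forall_2)
  qed
  then have "inj L"
    by (simp add: linear_injective_0[OF lin])
  then have "surj L"
    using lin linear_injective_imp_surjective by blast
  then obtain v where "L v = - boundary_map W ka kb"
    by (metis surjD)
  then have "boundary_map W (v $ 1 *\<^sub>R ha + ka) (v $ 2 *\<^sub>R hb + kb) = 0"
    by (simp add: L_def boundary_map_add)
  then show thesis by (rule that)
qed

lemma J_range:
  assumes W: "rank W = 2" "pos_semidef (W ** Sigma_mat ** transpose W)" and l: "a < l" "l < b"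
    and c: "0 < c" and y: "y \<in> X_space a b"
  shows "\<exists>e\<in>E_dom a b l W. c *\<^sub>R e - J_map a b l e = y"
proof -
  obtain U1 U2 :: "real \<Rightarrow> real \<Rightarrow> real" and ka kb :: "real^2" where U: "\<And>r. ac_on a b (U1 r) (\<lambda>z. component 2 y z - c * U2 r z)"
    "\<And>r. ac_on a b (U2 r) (\<lambda>z. component 1 y z - c * U1 r z)"
    "\<And>r. U2 r l = 0"
    "\<And>r. vector [U1 r a, U2 r a] = r *\<^sub>R vector [cosh (c * (l - a)), sinh (c * (l - a))] + ka"
    "\<And>r. vector [U1 r b, U2 r b] = r *\<^sub>R vector [cosh (c * (b - l)), - sinh (c * (b - l))] + kb"
  proof (rule scalar_solution[OF c l, where y = y])
    fix U1 U2 :: "real \<Rightarrow> real \<Rightarrow> real" and ka kb :: "real^2"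
    assume "\<And>r. ac_on a b (U1 r) (\<lambda>z. component 2 y z - c * U2 r z)"
      "\<And>r. ac_on a b (U2 r) (\<lambda>z. component 1 y z - c * U1 r z)"
      "\<And>r. U2 r l = 0"
      "\<And>r. vector [U1 r a, U2 r a] = r *\<^sub>R vector [cosh (c * (l - a)), sinh (c * (l - a))] + ka"
      "\<And>r. vector [U1 r b, U2 r b] = r *\<^sub>R vector [cosh (c * (b - l)), - sinh (c * (b - l))] + kb"
    then show thesis by (rule that[of U1 U2 ka kb])
  qed
  have "0 < sinh (c * (l - a))" "0 < sinh (c * (b - l))"
    using c l by auto
  then obtain \<alpha> \<beta> where bm: "boundary_map W (vector [U1 \<alpha> a, U2 \<alpha> a]) (vector [U1 \<beta> b, U2 \<beta> b]) = 0"
    unfolding U(4,5)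
    using boundary_constants[OF W, of "vector [cosh (c * (l - a)), sinh (c * (l - a))]"
      "vector [cosh (c * (b - l)), - sinh (c * (b - l))]" ka kb]
    by (auto simp: cosh_real_pos)
  \<comment> \<open>The constants \<open>\<alpha>\<close> and \<open>\<beta>\<close> may differ, so
    \<open>e\<^sub>1\<close> may jump at \<open>l\<close>; \<open>e\<^sub>2\<close> is continuous
    because both pieces vanish there.\<close>
  define E2 where "E2 z = (if z \<le> l then U2 \<alpha> z else U2 \<beta> z)" for z
  define f :: "real \<Rightarrow> real^2" where "f z = (\<chi> i. if i = 2 then indicator {a<..<b} z *\<^sub>R E2 z
      else indicator {a<..<l} z *\<^sub>R U1 \<alpha> z + indicator {l<..<b} z *\<^sub>R U1 \<beta> z)" for z
  define e where "e = abs_l2 f"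
  define k where "k = c *\<^sub>R e - y"
  have acl: "ac_on a l (U1 \<alpha>) (\<lambda>z. component 2 y z - c * U2 \<alpha> z)" "ac_on a l (U2 \<alpha>) (\<lambda>z. component 1 y z - c * U1 \<alpha> z)"
    and acr: "ac_on l b (U1 \<beta>) (\<lambda>z. component 2 y z - c * U2 \<beta> z)" "ac_on l b (U2 \<beta>) (\<lambda>z. component 1 y z - c * U1 \<beta> z)"
    using l by (auto intro: ac_on_subset[OF U(1)] ac_on_subset[OF U(2)])
  have contE2: "continuous_on {a..b} E2"
  proof -
    have "{a..b} = {a..l} \<union> {l..b}" using l by auto
    moreover have "continuous_on ({a..l} \<union> {l..b}) (\<lambda>z. if z \<le> l then U2 \<alpha> z else U2 \<beta> z)"
      using ac_on_continuous[OF acl(2)] ac_on_continuous[OF acr(2)] U(3)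
      by (intro continuous_on_If) auto
    ultimately show ?thesis by (simp add: E2_def[abs_def])
  qed
  have "sq_integrable f"
    unfolding f_def[abs_def]
    by (intro sq_integrable_piecewise continuous_on_sq_integrable_on contE2 ac_on_continuous[OF acl(1)] ac_on_continuous[OF acr(1)])
  then have e: "AE z in lborel. rep_l2 e z = f z"
    unfolding e_def by (rule rep_abs_l2)
  have eX: "e \<in> X_space a b"
    unfolding X_space_def mem_Collect_eq using e
    by eventually_elim (use l in \<open>auto simp: f_def vec_eq_iff\<close>)
  have kX: "k \<in> X_space a b"
    unfolding k_def using eX y by (intro subspace_diff subspace_scale subspace_X)
  have k: "AE z in lborel. component i k z = c * component i e z - component i y z" for i
    using rep_diff[of "c *\<^sub>R e" y] rep_scaleR[of c e] unfolding k_def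
    by eventually_elim (simp add: component_def)
  have meas: "set_borel_measurable lborel {p..q} (\<lambda>z. - component i k z)" for p q i
    unfolding set_borel_measurable_def by measurable
  have left: "AE z in lborel. z \<in> {a<..<l} \<longrightarrow> component 1 e z = U1 \<alpha> z \<and> component 2 e z = U2 \<alpha> z"
    using e by eventually_elim (use l in \<open>auto simp: f_def E2_def component_def\<close>)
  have right: "AE z in lborel. z \<in> {l<..<b} \<longrightarrow> component 1 e z = U1 \<beta> z \<and> component 2 e z = U2 \<beta> z"
    using e by eventually_elim (use l in \<open>auto simp: f_def E2_def component_def\<close>)
  have "ac_on a l (U1 \<alpha>) (\<lambda>z. - component 2 k z)"
  proof (rule ac_on_cong[OF acl(1) refl meas])
    show "AE s in lborel. s \<in> {a<..<l} \<longrightarrow> component 2 y s - c * U2 \<alpha> s = - component 2 k s"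
      using left k[of 2] by eventually_elim auto
  qed
  moreover have "ac_on l b (U1 \<beta>) (\<lambda>z. - component 2 k z)"
  proof (rule ac_on_cong[OF acr(1) refl meas])
    show "AE s in lborel. s \<in> {l<..<b} \<longrightarrow> component 2 y s - c * U2 \<beta> s = - component 2 k s"
      using right k[of 2] by eventually_elim auto
  qed
  moreover have "ac_on a b E2 (\<lambda>z. - component 1 k z)"
  proof (rule ac_on_glue)
    show "ac_on a l E2 (\<lambda>z. - component 1 k z)"
    proof (rule ac_on_cong[OF acl(2) _ meas])
      show "AE s in lborel. s \<in> {a<..<l} \<longrightarrow> component 1 y s - c * U1 \<alpha> s = - component 1 k s"
        using left k[of 1] by eventually_elim auto
    qed (auto simp: E2_def)
    show "ac_on l b E2 (\<lambda>z. - component 1 k z)"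
    proof (rule ac_on_cong[OF acr(2) _ meas])
      show "AE s in lborel. s \<in> {l<..<b} \<longrightarrow> component 1 y s - c * U1 \<beta> s = - component 1 k s"
        using right k[of 1] by eventually_elim auto
    qed (auto simp: E2_def U(3))
  qed (use l in auto)
  moreover have "AE z in lborel. z \<in> {a<..<b} \<longrightarrow> E2 z = component 2 e z"
    using e by eventually_elim (use l in \<open>auto simp: f_def component_def\<close>)
  moreover have "AE z in lborel. z \<in> {a<..<l} \<longrightarrow> U1 \<alpha> z = component 1 e z"
    using left by eventually_elim auto
  moreover have "AE z in lborel. z \<in> {l<..<b} \<longrightarrow> U1 \<beta> z = component 1 e z"
    using right by eventually_elim auto
  ultimately have G: "J_graph a b l e k (U1 \<alpha>) (U1 \<beta>) E2"
    using eX kX by (simp add: J_graph_def)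
  have "E2 l = 0" "E2 a = U2 \<alpha> a" "E2 b = U2 \<beta> b"
    using l U(3) by (auto simp: E2_def)
  then have "e \<in> E_dom a b l W"
    unfolding E_dom_def mem_Collect_eq using G bm by (intro exI conjI) (rule G, auto)
  moreover have "c *\<^sub>R e - J_map a b l e = y"
    using J_graph_imp_J(2)[OF G l] by (simp add: k_def)
  ultimately show ?thesis by blast
qed

lemma monotone_operator_J:
  assumes W: "rank W = 2" "pos_semidef (W ** Sigma_mat ** transpose W)" and l: "a < l" "l < b"
  shows "monotone_operator (X_space a b) (E_dom a b l W) (J_map a b l)"
  by unfold_locales
    (use E_dom_linear[OF l] J_dissipative[OF W l] J_range[OF W l] subspace_X closed_X in auto)

section \<open>Diagonal coefficients\<close>

lemma C1_on_entry:
  fixes Q :: "real \<Rightarrow> real^2^2"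
  assumes "C1_on S Q"
  obtains D where "\<And>z. z \<in> S \<Longrightarrow> ((\<lambda>z. Q z $ i $ j) has_real_derivative D z) (at z within S)"
    "continuous_on S D"
proof -
  obtain Q' where Q': "\<And>z. z \<in> S \<Longrightarrow> (Q has_vector_derivative Q' z) (at z within S)" "continuous_on S Q'"
    using assms by (auto simp: C1_on_def)
  have lin: "bounded_linear (\<lambda>A :: real^2^2. A $ i $ j)"
    using bounded_linear_compose[OF bounded_linear_vec_nth[of j] bounded_linear_vec_nth[of i]] .
  show thesis
  proof (rule that[of "\<lambda>z. Q' z $ i $ j"])
    show "((\<lambda>z. Q z $ i $ j) has_real_derivative Q' z $ i $ j) (at z within S)" if "z \<in> S" for z
      unfolding has_real_derivative_iff_has_vector_derivative
      by (rule bounded_linear.has_vector_derivative[OF lin Q'(1)[OF that]])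
    show "continuous_on S (\<lambda>z. Q' z $ i $ j)"
      by (rule bounded_linear.continuous_on[OF lin Q'(2)])
  qed
qed

lemma weighted_component_product_le:
  assumes g: "continuous_on {c..d} g" "\<And>z. z \<in> {c..d} \<Longrightarrow> \<bar>g z\<bar> \<le> B"
  shows "(LBINT z:{c..d}. g z * (component 1 e z * component 2 e z)) \<le> (LBINT z:{c..d}. B * (rep_l2 e z \<bullet> rep_l2 e z))"
proof (rule set_integral_mono)
  have prod: "\<bar>component 1 e z * component 2 e z\<bar> \<le> rep_l2 e z \<bullet> rep_l2 e z" for z
  proof -
    have "rep_l2 e z \<bullet> rep_l2 e z = \<bar>component 1 e z\<bar>\<^sup>2 + \<bar>component 2 e z\<bar>\<^sup>2"
      unfolding power2_abs by (simp add: inner_vec_def sum_2 component_def power2_eq_square)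
    moreover have "0 \<le> \<bar>component 1 e z\<bar> * \<bar>component 2 e z\<bar>" by simp
    ultimately show ?thesis
      using sum_squares_bound[of "\<bar>component 1 e z\<bar>" "\<bar>component 2 e z\<bar>"]
      unfolding abs_mult mult.assoc by linarith
  qed
  have "integrable lborel (\<lambda>z. component 1 e z * component 2 e z)"
  proof (rule Bochner_Integration.integrable_bound[OF sq_integrable_inner[of "rep_l2 e" "rep_l2 e"]])
    show "AE z in lborel. norm (component 1 e z * component 2 e z) \<le> norm (rep_l2 e z \<bullet> rep_l2 e z)"
      using prod by simp
  qed auto
  then have "set_integrable lborel {c..d} (\<lambda>z. component 1 e z * component 2 e z)"
    unfolding set_integrable_def by (intro integrable_mult_indicator) auto
  from set_integrable_mult_continuous[OF this g(1)]
  show "set_integrable lborel {c..d} (\<lambda>z. g z * (component 1 e z * component 2 e z))"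
    by (simp only: mult.commute)
  show "set_integrable lborel {c..d} (\<lambda>z. B * (rep_l2 e z \<bullet> rep_l2 e z))"
    unfolding set_integrable_def by (intro integrable_mult_indicator integrable_mult_right sq_integrable_inner) auto
  fix z assume z: "z \<in> {c..d}"
  have "g z * (component 1 e z * component 2 e z) \<le> \<bar>g z\<bar> * \<bar>component 1 e z * component 2 e z\<bar>"
    by (metis abs_ge_self abs_mult)
  also have "\<dots> \<le> B * (rep_l2 e z \<bullet> rep_l2 e z)"
    using g(2)[OF z] prod[of z] by (intro mult_mono) auto
  finally show "g z * (component 1 e z * component 2 e z) \<le> B * (rep_l2 e z \<bullet> rep_l2 e z)" .
qed

lemma pos_semidef_diagonal:
  assumes "pos_semidef (A :: real^'n^'n)"
  shows "0 \<le> A $ i $ i"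
  using assms[unfolded pos_semidef_def, rule_format, of "axis i 1"]
  by (simp add: matrix_vector_mul_component inner_axis' cart_eq_inner_axis[symmetric] inner_axis)

locale diagonal_coefficients =
  fixes a b m M :: real and Qm Qp :: "real \<Rightarrow> real^2^2"
  assumes ab: "a < b" and m: "0 < m"
    and Qm_bounds: "\<And>z i. z \<in> {a..b} \<Longrightarrow> m \<le> Qm z $ i $ i \<and> Qm z $ i $ i \<le> M"
    and Qp_bounds: "\<And>z i. z \<in> {a..b} \<Longrightarrow> m \<le> Qp z $ i $ i \<and> Qp z $ i $ i \<le> M"
    and Qm_diag: "\<And>z. z \<in> {a..b} \<Longrightarrow> Qm z $ 1 $ 2 = 0 \<and> Qm z $ 2 $ 1 = 0"
    and Qp_diag: "\<And>z. z \<in> {a..b} \<Longrightarrow> Qp z $ 1 $ 2 = 0 \<and> Qp z $ 2 $ 1 = 0"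
    and C1: "C1_on {a..b} Qm" "C1_on {a..b} Qp"
    and ratio: "\<And>z. z \<in> {a..b} \<Longrightarrow> Qp z $ 1 $ 1 / Qm z $ 1 $ 1 = Qp z $ 2 $ 2 / Qm z $ 2 $ 2"
begin

text \<open>The diagonal entries are extended to the whole line so that all bounds hold globally;
  elements of \<open>X_space a b\<close> do not see the extension.\<close>

definition dm :: "2 \<Rightarrow> real \<Rightarrow> real" where
  "dm i z = (if z \<in> {a..b} then Qm z $ i $ i else m)"

definition dp :: "2 \<Rightarrow> real \<Rightarrow> real" where
  "dp i z = (if z \<in> {a..b} then Qp z $ i $ i else m)"

definition q_cut :: "real \<Rightarrow> real \<Rightarrow> real^2" where
  "q_cut l z = (\<chi> i. indicator {a..<l} z * dm i z + indicator {l<..b} z * dp i z)"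

text \<open>The cut-off coefficient vanishes at \<open>l\<close> and outside \<open>{a..b}\<close>
  and so has no inverse. This version is bounded below everywhere and agrees with it almost
  everywhere on \<open>{a..b}\<close>.\<close>

definition q_ext :: "real \<Rightarrow> real \<Rightarrow> real^2" where
  "q_ext l z = (\<chi> i. if z < l then dm i z else dp i z)"

text \<open>The affine function \<open>kappa\<close> is chosen such that \<open>kappa Q\<^sup>-\<close> equals \<open>kappa Q\<^sub>l\<close> on the left of \<open>l\<close>
  and \<open>kappa_right Q\<^sub>l\<close> on its right, with \<open>kappa (a) = kappa_right (b) = 1\<close>, whatever \<open>l\<close> is.\<close>

definition end_ratio :: real where
  "end_ratio = Qp b $ 1 $ 1 / Qm b $ 1 $ 1"

definition kappa :: "real \<Rightarrow> real" where
  "kappa z = 1 + (z - a) / (b - a) * (end_ratio - 1)"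

text \<open>A square root of \<open>kappa Q\<^sup>-\<close>: the common weighted norm becomes the
  plain norm of \<open>dmul sqrt_weight x\<close>, the form that
  \<open>m_dissipative_compose\<close> asks for.\<close>

definition sqrt_weight :: "real \<Rightarrow> real^2" where
  "sqrt_weight z = (\<chi> i. sqrt ((if z \<in> {a..b} then kappa z else 1) * dm i z))"

lemma M_bounds: "m \<le> M"
  using Qm_bounds[of a 1] ab by force

lemma M_pos: "0 < M"
  using M_bounds m by simp

lemma dm_bounds: "m \<le> dm i z" "dm i z \<le> M" and dp_bounds: "m \<le> dp i z" "dp i z \<le> M"
  using Qm_bounds Qp_bounds M_bounds by (auto simp: dm_def dp_def)

lemma Q_entry_continuous: "continuous_on {a..b} (\<lambda>z. Qm z $ i $ j)" "continuous_on {a..b} (\<lambda>z. Qp z $ i $ j)"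
proof -
  show "continuous_on {a..b} (\<lambda>z. Qm z $ i $ j)"
    by (rule C1_on_entry[OF C1(1), of i j]) (rule DERIV_continuous_on)
  show "continuous_on {a..b} (\<lambda>z. Qp z $ i $ j)"
    by (rule C1_on_entry[OF C1(2), of i j]) (rule DERIV_continuous_on)
qed

lemma measurable_extension:
  assumes "continuous_on {a..b} f"
  shows "(\<lambda>z. if z \<in> {a..b} then f z else r :: real) \<in> borel_measurable borel"
proof -
  have [measurable]: "(\<lambda>z. indicator {a..b} z *\<^sub>R f z) \<in> borel_measurable borel"
    using assms by (intro borel_measurable_continuous_on_indicator) auto
  have "(\<lambda>z. if z \<in> {a..b} then f z else r) = (\<lambda>z. indicator {a..b} z *\<^sub>R f z + indicator (- {a..b}) z * r)"
    by (auto simp: indicator_def)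
  then show ?thesis by (simp only:) measurable
qed

lemma dm_measurable [measurable]: "dm i \<in> borel_measurable borel"
  and dp_measurable [measurable]: "dp i \<in> borel_measurable borel"
  unfolding dm_def[abs_def] dp_def[abs_def] by (intro measurable_extension Q_entry_continuous)+

lemma q_ext_multiplier:
  shows "q_ext l \<in> borel_measurable borel" "m \<le> q_ext l z $ i" "q_ext l z $ i \<le> M"
proof -
  show "q_ext l \<in> borel_measurable borel"
    unfolding q_ext_def[abs_def] by (intro borel_measurable_vec_lambda) measurable
qed (auto simp: q_ext_def dm_bounds dp_bounds)

lemma q_cut_multiplier: "multiplier (M + M) (q_cut l)"
proof -
  have "\<bar>indicator {a..<l} z * dm i z + indicator {l<..b} z * dp i z\<bar> \<le> M + M" for z i
    using dm_bounds[of i z] dp_bounds[of i z] m M_pos by (auto simp: indicator_def)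
  moreover have "q_cut l \<in> borel_measurable borel"
    unfolding q_cut_def[abs_def] by (intro borel_measurable_vec_lambda) measurable
  ultimately show ?thesis
    by (simp add: multiplier_def q_cut_def)
qed

lemma dmul_q_cut:
  assumes "x \<in> X_space a b"
  shows "dmul (q_cut l) x = dmul (q_ext l) x"
proof (rule dmul_cong_X[OF q_cut_multiplier multiplier_inverse(1) assms])
  show "AE z in lborel. z \<in> {a..b} \<longrightarrow> q_cut l z = q_ext l z"
    using AE_lborel_singleton[of l] by eventually_elim (auto simp: q_cut_def q_ext_def vec_eq_iff)
qed (use q_ext_multiplier m in auto)

lemma Q_l_mult: "Q_l a b Qm Qp l z *v v = (\<chi> i. q_cut l z $ i * v $ i)" if "a < l" "l < b"
  using Qm_diag[of z] Qp_diag[of z] that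
  by (auto simp: Q_l_def q_cut_def dm_def dp_def vec_eq_iff forall_2 matrix_vector_mult_def sum_2 indicator_def)

lemma mult_op_eq: "a < l \<Longrightarrow> l < b \<Longrightarrow> mult_op (Q_l a b Qm Qp l) = dmul (q_cut l)"
  by (simp add: fun_eq_iff mult_op_def dmul_def Q_l_mult)

text \<open>The diagonal entries lie between \<open>m\<close> and \<open>M\<close>, and the factor
  1/2 of \<open>inner_Q\<close> accounts for \<open>M / 2\<close> and \<open>2 / m\<close>.\<close>

lemma norm_Q_bounds:
  assumes x: "x \<in> X_space a b" and l: "a < l" "l < b"
  shows "norm_Q a b (Q_l a b Qm Qp l) x \<le> sqrt (M / 2) * norm x"
    and "norm x \<le> sqrt (2 / m) * norm_Q a b (Q_l a b Qm Qp l) x"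
proof -
  have mult: "multiplier M (q_ext l)"
    using q_ext_multiplier m by (intro multiplier_inverse(1)[of _ m]) auto
  have "(LBINT z:{a..b}. rep_l2 x z \<bullet> (Q_l a b Qm Qp l z *v rep_l2 x z))
      = (LBINT z:{a..b}. rep_l2 x z \<bullet> rep_l2 (dmul (q_ext l) x) z)"
  proof (rule LBINT_cong_AE_on)
    have [measurable]: "q_cut l \<in> borel_measurable borel"
      using q_cut_multiplier by (simp add: multiplier_def)
    have [measurable]: "(\<lambda>z. \<chi> i. q_cut l z $ i * rep_l2 x z $ i) \<in> borel_measurable borel"
      by (intro borel_measurable_vec_lambda) measurable
    show "set_borel_measurable lborel {a..b} (\<lambda>z. rep_l2 x z \<bullet> (Q_l a b Qm Qp l z *v rep_l2 x z))"
      "set_borel_measurable lborel {a..b} (\<lambda>z. rep_l2 x z \<bullet> rep_l2 (dmul (q_ext l) x) z)"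
      unfolding set_borel_measurable_def Q_l_mult[OF l] by measurable
    show "AE z in lborel. z \<in> {a..b} \<longrightarrow>
        rep_l2 x z \<bullet> (Q_l a b Qm Qp l z *v rep_l2 x z) = rep_l2 x z \<bullet> rep_l2 (dmul (q_ext l) x) z"
      unfolding dmul_q_cut[OF x, symmetric] using rep_dmul[OF q_cut_multiplier, of l x]
      by eventually_elim (simp add: Q_l_mult[OF l])
  qed
  then have sq: "inner_Q a b (Q_l a b Qm Qp l) x x = 1/2 * inner x (dmul (q_ext l) x)"
    by (simp add: inner_Q_def inner_X[OF x])
  have lower: "m * (norm x)\<^sup>2 \<le> inner x (dmul (q_ext l) x)"
    by (rule inner_dmul_lower[OF mult q_ext_multiplier(2)])
  have "inner x (dmul (q_ext l) x) \<le> norm x * norm (dmul (q_ext l) x)"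
    by (rule norm_cauchy_schwarz)
  also have "\<dots> \<le> norm x * (M * norm x)"
    by (intro mult_left_mono norm_dmul_le[OF mult]) auto
  finally have "inner x (dmul (q_ext l) x) \<le> M * (norm x)\<^sup>2"
    by (simp add: power2_eq_square mult_ac)
  then have "norm_Q a b (Q_l a b Qm Qp l) x \<le> sqrt (M / 2 * (norm x)\<^sup>2)"
    unfolding norm_Q_def sq by (intro real_sqrt_le_mono) simp
  then show "norm_Q a b (Q_l a b Qm Qp l) x \<le> sqrt (M / 2) * norm x"
    by (simp only: real_sqrt_mult real_sqrt_abs abs_norm_cancel)
  have "sqrt ((norm x)\<^sup>2) \<le> sqrt (2 / m * (1/2 * inner x (dmul (q_ext l) x)))"
    using lower m by (intro real_sqrt_le_mono) (simp add: field_simps)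
  then show "norm x \<le> sqrt (2 / m) * norm_Q a b (Q_l a b Qm Qp l) x"
    unfolding norm_Q_def sq by (simp only: real_sqrt_mult real_sqrt_abs abs_norm_cancel)
qed

section \<open>The common weight and its derivative bounds\<close>

lemma end_ratio_pos: "0 < end_ratio"
proof -
  have "0 < Qp b $ 1 $ 1" "0 < Qm b $ 1 $ 1"
    using Qp_bounds[of b 1] Qm_bounds[of b 1] m ab by auto
  then show ?thesis by (simp add: end_ratio_def)
qed

lemma kappa_bounds:
  assumes "z \<in> {a..b}"
  shows "min 1 end_ratio \<le> kappa z" "kappa z \<le> max 1 end_ratio"
proof -
  define t where "t = (z - a) / (b - a)"
  have t: "0 \<le> t" "t \<le> 1" using assms ab by (auto simp: t_def)
  have k: "kappa z = (1 - t) * 1 + t * end_ratio"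
    by (simp add: kappa_def t_def[symmetric] algebra_simps)
  have "(1 - t) * min 1 end_ratio + t * min 1 end_ratio \<le> (1 - t) * 1 + t * end_ratio"
    using t by (intro add_mono mult_left_mono) auto
  then show "min 1 end_ratio \<le> kappa z" unfolding k by (simp add: algebra_simps)
  have "(1 - t) * 1 + t * end_ratio \<le> (1 - t) * max 1 end_ratio + t * max 1 end_ratio"
    using t by (intro add_mono mult_left_mono) auto
  then show "kappa z \<le> max 1 end_ratio" unfolding k by (simp add: algebra_simps)
qed

lemma kappa_pos: "z \<in> {a..b} \<Longrightarrow> 0 < kappa z"
  using kappa_bounds(1)[of z] end_ratio_pos by (auto simp: min_def split: if_splits)

lemma kappa_continuous: "continuous_on S kappa"
  using ab unfolding kappa_def[abs_def] by (intro continuous_intros) auto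

lemma sqrt_weight_multiplier:
  shows "sqrt_weight \<in> borel_measurable borel" "sqrt (min 1 end_ratio * m) \<le> sqrt_weight z $ i"
    "sqrt_weight z $ i \<le> sqrt (max 1 end_ratio * M)"
proof -
  have [measurable]: "(\<lambda>z. if z \<in> {a..b} then kappa z else 1) \<in> borel_measurable borel"
    by (intro measurable_extension kappa_continuous)
  show "sqrt_weight \<in> borel_measurable borel"
    unfolding sqrt_weight_def[abs_def] by (intro borel_measurable_vec_lambda) measurable
  define t where "t = (if z \<in> {a..b} then kappa z else 1)"
  have "min 1 end_ratio \<le> t" "t \<le> max 1 end_ratio"
    using kappa_bounds[of z] by (auto simp: t_def)
  then show "sqrt (min 1 end_ratio * m) \<le> sqrt_weight z $ i" "sqrt_weight z $ i \<le> sqrt (max 1 end_ratio * M)"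
    unfolding sqrt_weight_def t_def[symmetric] using dm_bounds[of i z] m end_ratio_pos
    by (auto intro!: real_sqrt_le_mono mult_mono)
qed

definition kappa_right :: "real \<Rightarrow> real" where
  "kappa_right z = kappa z * Qm z $ 1 $ 1 / Qp z $ 1 $ 1"

text \<open>Each weight is used on one side of \<open>l\<close> only, but \<open>B\<close> bounds
  both derivatives on all of \<open>{a..b}\<close>; this makes it independent of
  \<open>l\<close>.\<close>

lemma kappa_ac:
  obtains h k B where "ac_on a b kappa h" "ac_on a b kappa_right k"
    "continuous_on {a..b} h" "continuous_on {a..b} k" "0 \<le> B" "\<And>z. z \<in> {a..b} \<Longrightarrow> \<bar>h z\<bar> \<le> B \<and> \<bar>k z\<bar> \<le> B"
proof -
  obtain Dm where Dm: "\<And>z. z \<in> {a..b} \<Longrightarrow> ((\<lambda>z. Qm z $ 1 $ 1) has_real_derivative Dm z) (at z within {a..b})"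
    "continuous_on {a..b} Dm" by (rule C1_on_entry[OF C1(1), of 1 1]) (rule that)
  obtain Dp where Dp: "\<And>z. z \<in> {a..b} \<Longrightarrow> ((\<lambda>z. Qp z $ 1 $ 1) has_real_derivative Dp z) (at z within {a..b})"
    "continuous_on {a..b} Dp" by (rule C1_on_entry[OF C1(2), of 1 1]) (rule that)
  define s where "s = (end_ratio - 1) / (b - a)"
  have ne: "Qp z $ 1 $ 1 \<noteq> 0" if "z \<in> {a..b}" for z
    using Qp_bounds[OF that, of 1] m by auto
  have Dk: "(kappa has_real_derivative s) (at z within S)" for z S
  proof -
    have "kappa = (\<lambda>z. 1 + (z - a) * s)"
      by (auto simp: kappa_def s_def)
    then show ?thesis by (auto intro!: derivative_eq_intros)
  qed
  define k where "k z = ((s * Qm z $ 1 $ 1 + kappa z * Dm z) * Qp z $ 1 $ 1 - kappa z * Qm z $ 1 $ 1 * Dp z)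
    / (Qp z $ 1 $ 1 * Qp z $ 1 $ 1)" for z
  have Dkr: "(kappa_right has_real_derivative k z) (at z within {a..b})" if "z \<in> {a..b}" for z
    unfolding kappa_right_def[abs_def] k_def using ne[OF that]
    by (auto intro!: derivative_eq_intros Dk Dm(1)[OF that] Dp(1)[OF that])
  have ck: "continuous_on {a..b} k"
    unfolding k_def[abs_def] using ne
    by (intro continuous_intros kappa_continuous Q_entry_continuous Dm(2) Dp(2)) auto
  then have "bounded (k ` {a..b})"
    by (intro compact_imp_bounded compact_continuous_image) auto
  then obtain B where "\<forall>y\<in>k ` {a..b}. norm y \<le> B"
    unfolding bounded_iff by blast
  then have B: "\<bar>k z\<bar> \<le> B" if "z \<in> {a..b}" for z
    using that by auto
  show thesis
  proof (rule that[of "\<lambda>_. s" k "max B \<bar>s\<bar>"])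
    show "ac_on a b kappa (\<lambda>_. s)" "ac_on a b kappa_right k"
      by (auto intro!: ac_on_C1 Dk Dkr ck)
  qed (use ck B in \<open>auto simp: le_max_iff_disj\<close>)
qed

text \<open>Links the two views of the weight: the left side does not mention \<open>l\<close>, the
  right side is an energy of \<open>J\<close> with a weight that jumps at \<open>l\<close>. They
  agree since \<open>kappa_right Q\<^sup>+ = kappa Q\<^sup>-\<close>.\<close>

lemma weighted_inner:
  assumes x: "x \<in> X_space a b" and y: "y \<in> X_space a b" and l: "a < l" "l < b"
  shows "inner (dmul sqrt_weight y) (dmul sqrt_weight x)
    = (LBINT z:{a..l}. kappa z * (rep_l2 y z \<bullet> rep_l2 (dmul (q_cut l) x) z))
      + (LBINT z:{l..b}. kappa_right z * (rep_l2 y z \<bullet> rep_l2 (dmul (q_cut l) x) z))"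
proof -
  have S: "multiplier (sqrt (max 1 end_ratio * M)) sqrt_weight"
    using sqrt_weight_multiplier m end_ratio_pos
    by (intro multiplier_inverse(1)[of _ "sqrt (min 1 end_ratio * m)"]) auto
  let ?f = "\<lambda>z. rep_l2 (dmul sqrt_weight y) z \<bullet> rep_l2 (dmul sqrt_weight x) z"
  have int: "set_integrable lborel {a..b} ?f"
    unfolding set_integrable_def by (intro integrable_mult_indicator sq_integrable_inner) auto
  have ne: "0 < Qp z $ i $ i" "0 < Qm z $ i $ i" if "z \<in> {a..b}" for z i
    using Qp_bounds[OF that, of i] Qm_bounds[OF that, of i] m by auto
  \<comment> \<open>\<open>kappa_right\<close> is defined by the first diagonal entries; the
    equality of the ratios carries the identity over to the second.\<close>
  have right_weight: "kappa_right z * Qp z $ i $ i = kappa z * Qm z $ i $ i" if z: "z \<in> {a..b}" for z i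
  proof -
    have "Qm z $ 1 $ 1 / Qp z $ 1 $ 1 = Qm z $ 2 $ 2 / Qp z $ 2 $ 2"
      using arg_cong[OF ratio[OF z], of inverse] by simp
    then have "kappa_right z = kappa z * (Qm z $ 2 $ 2 / Qp z $ 2 $ 2)"
      unfolding kappa_right_def by (simp only: times_divide_eq_right[symmetric])
    then have "kappa_right z * Qp z $ 2 $ 2 = kappa z * Qm z $ 2 $ 2"
      using ne(1)[OF z, of 2] by simp
    moreover have "kappa_right z * Qp z $ 1 $ 1 = kappa z * Qm z $ 1 $ 1"
      using ne(1)[OF z, of 1] by (simp add: kappa_right_def)
    moreover have "i = 1 \<or> i = 2" by (rule exhaust_2)
    ultimately show ?thesis by auto
  qed
  have f_eq: "?f z = kappa z * (\<Sum>i\<in>UNIV. Qm z $ i $ i * (rep_l2 y z $ i * rep_l2 x z $ i))"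
    if "rep_l2 (dmul sqrt_weight y) z = (\<chi> i. sqrt_weight z $ i * rep_l2 y z $ i)"
      "rep_l2 (dmul sqrt_weight x) z = (\<chi> i. sqrt_weight z $ i * rep_l2 x z $ i)" and z: "z \<in> {a..b}" for z
  proof -
    have sq: "sqrt_weight z $ i * sqrt_weight z $ i = kappa z * Qm z $ i $ i" for i
      using z kappa_pos[OF z] ne(2)[OF z, of i] by (simp add: sqrt_weight_def dm_def)
    have "?f z = (\<Sum>i\<in>UNIV. (sqrt_weight z $ i * sqrt_weight z $ i) * (rep_l2 y z $ i * rep_l2 x z $ i))"
      unfolding that by (simp add: inner_vec_def mult_ac)
    also have "\<dots> = kappa z * (\<Sum>i\<in>UNIV. Qm z $ i $ i * (rep_l2 y z $ i * rep_l2 x z $ i))"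
      unfolding sq sum_distrib_left by (simp add: mult.assoc)
    finally show ?thesis .
  qed
  have cont: "continuous_on {a..b} kappa_right"
    using ne(1) unfolding kappa_right_def[abs_def]
    by (intro continuous_intros kappa_continuous Q_entry_continuous) (auto simp: less_le)
  have meas: "set_borel_measurable lborel {c..d} (\<lambda>z. k z * (rep_l2 y z \<bullet> rep_l2 (dmul (q_cut l) x) z))"
    if "continuous_on {c..d} k" for c d k
  proof -
    have [measurable]: "(\<lambda>z. indicator {c..d} z *\<^sub>R k z) \<in> borel_measurable borel"
      using that by (intro borel_measurable_continuous_on_indicator) auto
    have *: "indicator {c..d} z *\<^sub>R (k z * (rep_l2 y z \<bullet> rep_l2 (dmul (q_cut l) x) z))
        = (indicator {c..d} z *\<^sub>R k z) * (rep_l2 y z \<bullet> rep_l2 (dmul (q_cut l) x) z)" for z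
      by simp
    show ?thesis unfolding set_borel_measurable_def * by measurable
  qed
  have measf: "set_borel_measurable lborel {c..d} ?f" for c d
    unfolding set_borel_measurable_def by measurable
  have "inner (dmul sqrt_weight y) (dmul sqrt_weight x) = (LBINT z:{a..b}. ?f z)"
    by (rule inner_X[OF dmul_X[OF S y]])
  also have "\<dots> = (LBINT z:{a..l}. ?f z) + (LBINT z:{l..b}. ?f z)"
    using l by (intro LBINT_combine int) auto
  also have "(LBINT z:{a..l}. ?f z) = (LBINT z:{a..l}. kappa z * (rep_l2 y z \<bullet> rep_l2 (dmul (q_cut l) x) z))"
  proof (rule LBINT_cong_AE_on[OF measf meas[OF kappa_continuous]])
    show "AE z in lborel. z \<in> {a..l} \<longrightarrow> ?f z = kappa z * (rep_l2 y z \<bullet> rep_l2 (dmul (q_cut l) x) z)"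
      using rep_dmul[OF S, of x] rep_dmul[OF S, of y] rep_dmul[OF q_cut_multiplier, of l x] AE_lborel_singleton[of l]
    proof eventually_elim
      case (elim z)
      show ?case
      proof
        assume z: "z \<in> {a..l}"
        then have zab: "z \<in> {a..b}" using l by auto
        show "?f z = kappa z * (rep_l2 y z \<bullet> rep_l2 (dmul (q_cut l) x) z)"
          unfolding f_eq[OF elim(2,1) zab] elim(3) using z zab elim(4) l
          by (simp add: inner_vec_def sum_2 q_cut_def dm_def mult_ac)
      qed
    qed
  qed
  also have "(LBINT z:{l..b}. ?f z) = (LBINT z:{l..b}. kappa_right z * (rep_l2 y z \<bullet> rep_l2 (dmul (q_cut l) x) z))"
  proof (rule LBINT_cong_AE_on[OF measf meas])
    show "continuous_on {l..b} kappa_right"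
      using l by (intro continuous_on_subset[OF cont]) auto
    show "AE z in lborel. z \<in> {l..b} \<longrightarrow> ?f z = kappa_right z * (rep_l2 y z \<bullet> rep_l2 (dmul (q_cut l) x) z)"
      using rep_dmul[OF S, of x] rep_dmul[OF S, of y] rep_dmul[OF q_cut_multiplier, of l x] AE_lborel_singleton[of l]
    proof eventually_elim
      case (elim z)
      show ?case
      proof
        assume z: "z \<in> {l..b}"
        then have zab: "z \<in> {a..b}" using l by auto
        have "?f z = (\<Sum>i\<in>UNIV. (kappa z * Qm z $ i $ i) * (rep_l2 y z $ i * rep_l2 x z $ i))"
          unfolding f_eq[OF elim(2,1) zab] sum_distrib_left by (simp add: mult.assoc)
        also have "\<dots> = kappa_right z * (\<Sum>i\<in>UNIV. Qp z $ i $ i * (rep_l2 y z $ i * rep_l2 x z $ i))"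
          unfolding right_weight[OF zab, symmetric] sum_distrib_left by (simp add: mult.assoc)
        finally show "?f z = kappa_right z * (rep_l2 y z \<bullet> rep_l2 (dmul (q_cut l) x) z)"
          unfolding elim(3) using z zab elim(4) l
          by (simp add: inner_vec_def sum_2 q_cut_def dp_def mult_ac)
      qed
    qed
  qed
  finally show ?thesis .
qed

text \<open>The constants are fixed before \<open>l\<close>, as \<open>stable_familyI\<close> asks
  for one norm and one growth rate for the whole family.\<close>

lemma pH_op_m_dissipative:
  assumes W: "rank W = 2" "pos_semidef (W ** Sigma_mat ** transpose W)"
  obtains w c C where "\<And>l. a < l \<Longrightarrow> l < b \<Longrightarrow> m_dissipative (X_space a b) (fst (pH_op a b Qm Qp 0 W l))
    (\<lambda>x. snd (pH_op a b Qm Qp 0 W l) x - w *\<^sub>R x) (\<lambda>x. norm (dmul sqrt_weight x)) c C"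
proof -
  obtain h k B where ac: "ac_on a b kappa h" "ac_on a b kappa_right k"
    and hk: "continuous_on {a..b} h" "continuous_on {a..b} k" and B: "0 \<le> B"
    "\<And>z. z \<in> {a..b} \<Longrightarrow> \<bar>h z\<bar> \<le> B \<and> \<bar>k z\<bar> \<le> B"
    by (rule kappa_ac) blast
  define \<delta> where "\<delta> = sqrt (min 1 end_ratio * m)"
  define C where "C = sqrt (max 1 end_ratio * M)"
  have \<delta>: "0 < \<delta>" using m end_ratio_pos by (simp add: \<delta>_def)
  have C: "0 < C" using M_pos by (simp add: C_def)
  note S = multiplier_inverse[OF sqrt_weight_multiplier(1) \<delta> sqrt_weight_multiplier(2)[folded \<delta>_def] sqrt_weight_multiplier(3)[folded C_def]]
  have S_lower: "norm x \<le> 1 / \<delta> * norm (dmul sqrt_weight x)" for x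
    using norm_dmul_le[OF S(2), of "dmul sqrt_weight x"] by (simp only: S(3))
  \<comment> \<open>\<open>B |e|\<^sup>2\<close> is what the derivatives of the weights leave over,
    and \<open>|e| \<le> M |x| \<le> (M / \<delta>) |S x|\<close> for
    \<open>S = dmul sqrt_weight\<close>.\<close>
  define w where "w = B * (M * (1 / \<delta>))\<^sup>2"
  show thesis
  proof (rule that[of w "1 / \<delta>" C])
    fix l assume l: "a < l" "l < b"
    interpret monotone_operator "X_space a b" "E_dom a b l W" "J_map a b l"
      by (rule monotone_operator_J[OF W l])
    note Q = multiplier_inverse[OF q_ext_multiplier(1) m q_ext_multiplier(2) q_ext_multiplier(3), of l]
    have diff: "multiplier (1 / m - 1 / M) (\<lambda>z. \<chi> i. 1 / m - (\<chi> i. 1 / q_ext l z $ i) $ i)"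
    proof -
      have "\<bar>1 / m - 1 / q_ext l z $ i\<bar> \<le> 1 / m - 1 / M" for z i
      proof -
        have "1 / q_ext l z $ i \<le> 1 / m" "1 / M \<le> 1 / q_ext l z $ i"
          using q_ext_multiplier(2,3)[of l z i] m by (simp_all add: frac_le)
        then show ?thesis by (simp only: abs_if) auto
      qed
      moreover have [measurable]: "q_ext l \<in> borel_measurable borel" by (rule q_ext_multiplier)
      have "(\<lambda>z. \<chi> i. 1 / m - 1 / q_ext l z $ i) \<in> borel_measurable borel"
        by (intro borel_measurable_vec_lambda) measurable
      ultimately show ?thesis by (simp add: multiplier_def)
    qed
    have "m_dissipative (X_space a b) {x \<in> X_space a b. dmul (q_cut l) x \<in> E_dom a b l W}
      (\<lambda>x. J_map a b l (dmul (q_cut l) x) - w *\<^sub>R x) (\<lambda>x. norm (dmul sqrt_weight x)) (1 / \<delta>) C"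
    \<comment> \<open>The inverse coefficients lie in \<open>[1 / M, 1 / m]\<close>, so their
      distance from the scalar \<open>1 / m\<close> is at most
      \<open>1 / m - 1 / M = (1 - m / M) (1 / m)\<close>; this gives the contraction factor
      \<open>1 - m / M\<close>.\<close>
    proof (rule m_dissipative_compose[where P = "dmul (\<lambda>z. \<chi> i. 1 / q_ext l z $ i)" and ?c0.0 = "1 / m" and q = "1 - m / M"])
      show "bounded_linear (dmul (q_cut l))" "bounded_linear (dmul (\<lambda>z. \<chi> i. 1 / q_ext l z $ i))"
        "bounded_linear (dmul sqrt_weight)"
        by (auto intro: bounded_linear_dmul q_cut_multiplier Q(2) S(1))
      show "dmul (q_cut l) x \<in> X_space a b" "dmul (\<lambda>z. \<chi> i. 1 / q_ext l z $ i) x \<in> X_space a b"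
        if "x \<in> X_space a b" for x
        using that by (auto intro: dmul_X q_cut_multiplier Q(2))
      then show "dmul (q_cut l) (dmul (\<lambda>z. \<chi> i. 1 / q_ext l z $ i) x) = x"
        "dmul (\<lambda>z. \<chi> i. 1 / q_ext l z $ i) (dmul (q_cut l) x) = x" if "x \<in> X_space a b" for x
        using that Q(3,4) by (simp_all add: dmul_q_cut)
      show "norm ((1 / m) *\<^sub>R x - dmul (\<lambda>z. \<chi> i. 1 / q_ext l z $ i) x) \<le> (1 - m / M) * (1 / m) * norm x" for x
      proof -
        have "(1 - m / M) * (1 / m) = 1 / m - 1 / M" using m by (simp add: field_simps)
        then show ?thesis
          using norm_dmul_le[OF diff, of x] dmul_sub_const[OF Q(2) diff, of x] by simp
      qed
      show "norm x \<le> 1 / \<delta> * norm (dmul sqrt_weight x)" for x by (rule S_lower)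
      show "norm (dmul sqrt_weight x) \<le> C * norm x" for x by (rule norm_dmul_le[OF S(1)])
      show "inner (dmul sqrt_weight (J_map a b l (dmul (q_cut l) x))) (dmul sqrt_weight x)
          \<le> w * (norm (dmul sqrt_weight x))\<^sup>2"
        if x: "x \<in> X_space a b" "dmul (q_cut l) x \<in> E_dom a b l W" for x
      proof -
        let ?e = "dmul (q_cut l) x"
        have e: "?e \<in> X_space a b" "J_map a b l ?e \<in> X_space a b"
          using J_dissipative(1,2)[OF W l x(2)] by auto
        have acl: "ac_on a l kappa h" and acr: "ac_on l b kappa_right k"
          using l by (auto intro: ac_on_subset[OF ac(1)] ac_on_subset[OF ac(2)])
        have ends: "kappa a = 1" "kappa_right b = 1"
          using ab Qp_bounds[of b 1] Qm_bounds[of b 1] m by (auto simp: kappa_def kappa_right_def end_ratio_def)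
        have int: "set_integrable lborel {a..b} (\<lambda>z. B * (rep_l2 ?e z \<bullet> rep_l2 ?e z))"
          unfolding set_integrable_def by (intro integrable_mult_indicator integrable_mult_right sq_integrable_inner) auto
        have "inner (dmul sqrt_weight (J_map a b l ?e)) (dmul sqrt_weight x)
            \<le> (LBINT z:{a..l}. h z * (component 1 ?e z * component 2 ?e z))
              + (LBINT z:{l..b}. k z * (component 1 ?e z * component 2 ?e z))"
          unfolding weighted_inner[OF x(1) e(2) l]
          by (rule J_weighted_dissipative[OF W l x(2) acl ends(1) acr ends(2)])
        also have "\<dots> \<le> (LBINT z:{a..l}. B * (rep_l2 ?e z \<bullet> rep_l2 ?e z)) + (LBINT z:{l..b}. B * (rep_l2 ?e z \<bullet> rep_l2 ?e z))"
          using l B by (intro add_mono weighted_component_product_le continuous_on_subset[OF hk(1)] continuous_on_subset[OF hk(2)]) auto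
        also have "\<dots> = (LBINT z:{a..b}. B * (rep_l2 ?e z \<bullet> rep_l2 ?e z))"
          using LBINT_combine[OF int, of l] l by simp
        also have "\<dots> = B * (norm ?e)\<^sup>2"
          unfolding power2_norm_eq_inner inner_X[OF e(1)] by simp
        also have "\<dots> \<le> B * (M * (1 / \<delta> * norm (dmul sqrt_weight x)))\<^sup>2"
        proof (intro mult_left_mono power_mono)
          have "norm ?e \<le> M * norm x"
            unfolding dmul_q_cut[OF x(1)] by (rule norm_dmul_le[OF Q(1)])
          also have "\<dots> \<le> M * (1 / \<delta> * norm (dmul sqrt_weight x))"
            using S_lower[of x] M_pos by (intro mult_left_mono) auto
          finally show "norm ?e \<le> M * (1 / \<delta> * norm (dmul sqrt_weight x))" .
        qed (use B in auto)
        also have "\<dots> = w * (norm (dmul sqrt_weight x))\<^sup>2"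
          by (simp add: w_def power_mult_distrib power_divide)
        finally show ?thesis .
      qed
    qed (use m M_bounds M_pos C \<delta> B in \<open>auto simp: w_def\<close>)
    moreover have "snd (pH_op a b Qm Qp 0 W l) = (\<lambda>x. J_map a b l (dmul (q_cut l) x))"
      by (simp add: pH_op_def mult_op_eq[OF l])
    ultimately show "m_dissipative (X_space a b) (fst (pH_op a b Qm Qp 0 W l))
        (\<lambda>x. snd (pH_op a b Qm Qp 0 W l) x - w *\<^sub>R x) (\<lambda>x. norm (dmul sqrt_weight x)) (1 / \<delta>) C"
      by (simp add: pH_op_domain[OF l] mult_op_eq[OF l])
  qed
qed

end

theorem corollary5p25:
  fixes a b m M r \<tau> :: real
    and Qm Qp :: "real \<Rightarrow> real^2^2"
    and W :: "real^4^2"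
    and l :: "real \<Rightarrow> real"
  assumes "a < 0" and "0 < b"
    and "0 < m" and "m \<le> M"
    and "\<forall>z\<in>{a..b}. transpose (Qm z) = Qm z \<and>
           pos_semidef (Qm z - m *\<^sub>R mat 1) \<and> pos_semidef (M *\<^sub>R mat 1 - Qm z)"
    and "\<forall>z\<in>{a..b}. transpose (Qp z) = Qp z \<and>
           pos_semidef (Qp z - m *\<^sub>R mat 1) \<and> pos_semidef (M *\<^sub>R mat 1 - Qp z)"
    and "0 < \<tau>"
    and "\<forall>t\<in>{0..\<tau>}. l t \<in> {a<..<b}"
    and "C1_on {0..\<tau>} l"
    and "C1_on {a..b} Qm" and "C1_on {a..b} Qp"
    and "\<forall>z\<in>{a..b}. Qm z $ 1 $ 2 = 0 \<and> Qm z $ 2 $ 1 = 0"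
    and "\<forall>z\<in>{a..b}. Qp z $ 1 $ 2 = 0 \<and> Qp z $ 2 $ 1 = 0"
    and "(Qp 0 $ 1 $ 1) / (Qm 0 $ 1 $ 1) = 1"
    and "\<forall>z\<in>{a..b}. (Qp z $ 1 $ 1) / (Qm z $ 1 $ 1) = (Qp z $ 2 $ 2) / (Qm z $ 2 $ 2)"
    and "r = 0"
    and "rank W = 2"
    and "pos_semidef (W ** Sigma_mat ** transpose W)"
  shows "stable_family (X_space a b) (norm_Q a b (Q_l a b Qm Qp 0)) \<tau>
           (\<lambda>t. pH_op a b Qm Qp r W (l t))"
proof -
  have diag_bounds: "m \<le> A $ i $ i \<and> A $ i $ i \<le> M"
    if "pos_semidef (A - m *\<^sub>R mat 1)" "pos_semidef (M *\<^sub>R mat 1 - A)" for A :: "real^2^2" and i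
    using pos_semidef_diagonal[OF that(1), of i] pos_semidef_diagonal[OF that(2), of i]
    by (simp add: mat_def)
  interpret diagonal_coefficients a b m M Qm Qp
  proof
    show "a < b" using assms(1,2) by simp
    show "m \<le> Qm z $ i $ i \<and> Qm z $ i $ i \<le> M" "m \<le> Qp z $ i $ i \<and> Qp z $ i $ i \<le> M" if "z \<in> {a..b}" for z i
      using assms(5,6) that by (auto intro!: diag_bounds)
  qed (use assms in auto)
  obtain w c C where diss: "\<And>l. a < l \<Longrightarrow> l < b \<Longrightarrow> m_dissipative (X_space a b) (fst (pH_op a b Qm Qp 0 W l))
      (\<lambda>x. snd (pH_op a b Qm Qp 0 W l) x - w *\<^sub>R x) (\<lambda>x. norm (dmul sqrt_weight x)) c C"
    by (rule pH_op_m_dissipative[OF assms(17,18)]) (rule that)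
  show ?thesis
    unfolding assms(16)
  proof (rule stable_familyI)
    show "m_dissipative (X_space a b) (fst (pH_op a b Qm Qp 0 W (l t)))
        (\<lambda>x. snd (pH_op a b Qm Qp 0 W (l t)) x - w *\<^sub>R x) (\<lambda>x. norm (dmul sqrt_weight x)) c C"
      if "t \<in> {0..\<tau>}" for t
      using assms(8) that by (intro diss) auto
    \<comment> \<open>As \<open>a < 0 < b\<close>, the position 0 is itself admissible, so the norm
      of \<open>Q_0\<close> is covered by \<open>norm_Q_bounds\<close>.\<close>
    show "norm_Q a b (Q_l a b Qm Qp 0) x \<le> sqrt (M / 2) * norm x"
      "norm x \<le> sqrt (2 / m) * norm_Q a b (Q_l a b Qm Qp 0) x" if "x \<in> X_space a b" for x
      using norm_Q_bounds[OF that assms(1,2)] by auto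
  qed (use assms M_pos in auto)
qed

end
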